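(* Assume the potential assumption (P) and the controlled-coefficient assumption (CC) stated in the context, and adopt the bounded-domain setup of the context. Let $\Sigma\in\{\partial A,\partial B,\partial\mathcal D\}$, $M<\infty$, and let $K\subset\overline{\mathcal D}\setminus\Sigma$ be compact. Then $$\lim_{b\downarrow0}\sup_{z\in K}\mathbb P_z\big(|r_{\tau_\Sigma}|\le b,\ \tau_\Sigma\le M\big)=0.$$ Moreover, for every $\lambda\in(0,1/2)$ and every fixed $K_0>0$, with $b_\delta=\delta^{\lambda/4}$, $$\sup_{z\in K}\mathbb P_z^\delta\big(|r^\delta_{\tau_\Sigma^\delta}|\le K_0b_\delta,\ \tau_\Sigma^\delta\le M\big)\longrightarrow0\qquad\text{as }\delta\downarrow0.$$ The same statements hold for the adjoint processes.
   Context: Fix $d\ge1$ and constants $\gamma,L,\varepsilon>0$, and a function $U:\mathbb R^d\to\mathbb R$. Write $z=(\theta,p,r)\in\mathbb R^{3d}$ with $\theta,p,r\in\mathbb R^d$. Processes. For $\varsigma\in\{+1,-1\}$ and $0\le\delta\le1$ let $Z^{\delta,\varsigma}=(\theta^{\delta,\varsigma},p^{\delta,\varsigma},r^{\delta,\varsigma})$ solve (superscripts omitted) $$d\theta_t=\varsigma p_tdt-\delta\nabla U(\theta_t)dt+\sqrt{2\varepsilon\delta}\,dW^\theta_t,$$ $$dp_t=-\varsigma L^{-1}\nabla U(\theta_t)dt+\varsigma\gamma r_tdt-\delta Lp_tdt+\sqrt{2\varepsilon\delta}\,dW^p_t,$$ $$dr_t=-\varsigma\gamma p_tdt-\gamma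 r_tdt+\sqrt{2\gamma\varepsilon/L}\,dB_t,$$ with $W^\theta,W^p,B$ independent standard $d$-dimensional Brownian motions. $Z^\delta:=Z^{\delta,+1}=(\theta^\delta,p^\delta,r^\delta)$ (forward) and $Z^{\delta,*}:=Z^{\delta,-1}$ (adjoint) have laws $\mathbb P_z^\delta,\mathbb P_z^{\delta,*}$ from $z$; at $\delta=0$ write $Z=(\theta,p,r)$, $Z^*$, $\mathbb P_z,\mathbb P_z^*$. For a Borel set $E$, $\tau_E=\inf\{t\ge0:Z_t\in E\}$, with superscript $\delta$ for the regularized process. (P): $U\in C^\infty(\mathbb R^d)$, $U\ge0$, the sublevel sets of $U$ are compact, and there are $c_0,R_0>0$ with $\theta\cdot\nabla U(\theta)\ge c_0(|\theta|^2+U(\theta))$ for $|\theta|\ge R_0$. (CC): (a) for every multi-index $\alpha$ with $|\alpha|\ge0$ there are $C_\alpha,m_\alpha<\infty$ with $|\partial^\alpha\nabla U(\theta)|\le C_\alpha(1+|\theta|^{m_\alpha})$ for all $\theta$; (b) for every $0\le\delta\le1$ the forward and adjoint SDEs have unique non-explosive strong solutions, and for all $T<\infty$, $q\ge1$ and compact $K'\subset\mathbb R^{3d}$, $\sup_{0\le\delta\le1}\sup_{z\in K'}\mathbb E_z^\delta[\sup_{0\le t\le T}(1+|Z_t^\delta|)^q]<\infty$, and likewise for the adjoint processes. Bounded-domain setup. $m,s\in\mathbb R^d$ are two distinguished local minima of $U$; $\rho>0$ is such that the open Euclidean balls $A=B((m,0,0),\rho)$ and $B=B((s,0,0),\rho)$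 in $\mathbb R^{3d}$ have disjoint closures; $N>0$ is such that $\overline A\cup\overline B\subset\mathcal D:=B(0,N)\subset\mathbb R^{3d}$. *)

theory Defs
  imports "HOL-Probability.Probability"
begin

section \<open>Derivatives of the potential\<close>

definition partial_deriv ::
  "'d \<Rightarrow> ((real ^ 'd::finite) \<Rightarrow> 'b::real_normed_vector) \<Rightarrow> (real ^ 'd) \<Rightarrow> 'b"
  where "partial_deriv i f x = frechet_derivative f (at x) (axis i 1)"

text \<open>A multi-index \<open>\<alpha>\<close> is represented by a list of coordinates in which each \<open>i\<close> occurs
  \<open>\<alpha> i\<close> times.  For the smooth functions considered here the order of the list is
  irrelevant.\<close>

definition multi_deriv ::
  "'d list \<Rightarrow> ((real ^ 'd::finite) \<Rightarrow> 'b::real_normed_vector) \<Rightarrow> (real ^ 'd) \<Rightarrow> 'b"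
  where "multi_deriv \<alpha> f = foldr partial_deriv \<alpha> f"

definition smooth :: "((real ^ 'd::finite) \<Rightarrow> real) \<Rightarrow> bool"
  where "smooth f \<longleftrightarrow> (\<forall>\<alpha> x. multi_deriv \<alpha> f differentiable (at x))"

definition grad :: "((real ^ 'd::finite) \<Rightarrow> real) \<Rightarrow> (real ^ 'd) \<Rightarrow> (real ^ 'd)"
  where "grad U x = (\<chi> i. partial_deriv i U x)"

definition potential_assumption :: "((real ^ 'd::finite) \<Rightarrow> real) \<Rightarrow> bool"
  where "potential_assumption U \<longleftrightarrow>
    smooth U \<and> (\<forall>\<theta>. 0 \<le> U \<theta>) \<and> (\<forall>c. compact {\<theta>. U \<theta> \<le> c}) \<and>
    (\<exists>c\<^sub>0>0. \<exists>R\<^sub>0>0. \<forall>\<theta>. R\<^sub>0 \<le> norm \<theta> \<longrightarrow>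
       c\<^sub>0 * ((norm \<theta>)\<^sup>2 + U \<theta>) \<le> \<theta> \<bullet> grad U \<theta>)"


section \<open>Brownian motion\<close>

definition brownian_motion_1d :: "'w measure \<Rightarrow> (real \<Rightarrow> 'w \<Rightarrow> real) \<Rightarrow> bool"
  where "brownian_motion_1d \<mu> W \<longleftrightarrow>
    (\<forall>t\<ge>0. W t \<in> borel_measurable \<mu>) \<and>
    (\<forall>\<omega>\<in>space \<mu>. W 0 \<omega> = 0 \<and> continuous_on {0..} (\<lambda>t. W t \<omega>)) \<and>
    (\<forall>s t. 0 \<le> s \<and> s < t \<longrightarrow>
       distributed \<mu> lborel (\<lambda>\<omega>. W t \<omega> - W s \<omega>) (normal_density 0 (sqrt (t - s)))) \<and>
    (\<forall>ts. sorted ts \<and> (\<forall>t\<in>set ts. 0 \<le> t) \<longrightarrow>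
       prob_space.indep_vars \<mu> (\<lambda>_. borel)
         (\<lambda>k \<omega>. W (ts ! Suc k) \<omega> - W (ts ! k) \<omega>) {..<length ts - 1})"

definition independent_processes ::
  "'w measure \<Rightarrow> ('i \<Rightarrow> real \<Rightarrow> 'w \<Rightarrow> 'b::topological_space) \<Rightarrow> 'i set \<Rightarrow> bool"
  where "independent_processes \<mu> W I \<longleftrightarrow>
    prob_space.indep_vars \<mu> (\<lambda>_. PiM {0..} (\<lambda>_. borel)) (\<lambda>i \<omega>. \<lambda>t\<in>{0..}. W i t \<omega>) I"

definition brownian_motion :: "'w measure \<Rightarrow> (real \<Rightarrow> 'w \<Rightarrow> real ^ 'd::finite) \<Rightarrow> bool"
  where "brownian_motion \<mu> W \<longleftrightarrow>
    (\<forall>i. brownian_motion_1d \<mu> (\<lambda>t \<omega>. W t \<omega> $ i)) \<and>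
    independent_processes \<mu> (\<lambda>i t \<omega>. W t \<omega> $ i) UNIV"

definition independent_brownian_motions ::
  "'w measure \<Rightarrow> (real \<Rightarrow> 'w \<Rightarrow> real ^ 'd::finite) \<Rightarrow> (real \<Rightarrow> 'w \<Rightarrow> real ^ 'd)
     \<Rightarrow> (real \<Rightarrow> 'w \<Rightarrow> real ^ 'd) \<Rightarrow> bool"
  where "independent_brownian_motions \<mu> W\<^sub>1 W\<^sub>2 W\<^sub>3 \<longleftrightarrow>
    brownian_motion \<mu> W\<^sub>1 \<and> brownian_motion \<mu> W\<^sub>2 \<and> brownian_motion \<mu> W\<^sub>3 \<and>
    independent_processes \<mu> (\<lambda>k. [W\<^sub>1, W\<^sub>2, W\<^sub>3] ! k) {0..<3}"

text \<open>The filtration generated by the driving Brownian motions, augmented by the null sets.\<close>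

definition brownian_filtration ::
  "'w measure \<Rightarrow> (real \<Rightarrow> 'w \<Rightarrow> real ^ 'd::finite) \<Rightarrow> (real \<Rightarrow> 'w \<Rightarrow> real ^ 'd)
     \<Rightarrow> (real \<Rightarrow> 'w \<Rightarrow> real ^ 'd) \<Rightarrow> real \<Rightarrow> 'w measure"
  where "brownian_filtration \<mu> W\<^sub>1 W\<^sub>2 W\<^sub>3 t =
    sigma (space \<mu>)
      ({W s -` A \<inter> space \<mu> | W s A. W \<in> {W\<^sub>1, W\<^sub>2, W\<^sub>3} \<and> s \<in> {0..t} \<and> A \<in> sets borel}
        \<union> null_sets \<mu>)"


section \<open>The stochastic differential equations\<close>

text \<open>The norm of the product type is the Euclidean norm of \<open>\<real>\<^bsup>3d\<^esup>\<close>.\<close>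

type_synonym 'd state = "(real ^ 'd) \<times> (real ^ 'd) \<times> (real ^ 'd)"

definition drift ::
  "real \<Rightarrow> real \<Rightarrow> ((real ^ 'd::finite) \<Rightarrow> real) \<Rightarrow> real \<Rightarrow> real \<Rightarrow> 'd state \<Rightarrow> 'd state"
  where "drift \<gamma> L U \<delta> \<sigma> = (\<lambda>(\<theta>, p, r).
    (\<sigma> *\<^sub>R p - \<delta> *\<^sub>R grad U \<theta>,
     - (\<sigma> * inverse L) *\<^sub>R grad U \<theta> + (\<sigma> * \<gamma>) *\<^sub>R r - (\<delta> * L) *\<^sub>R p,
     - (\<sigma> * \<gamma>) *\<^sub>R p - \<gamma> *\<^sub>R r))"

definition noise ::
  "real \<Rightarrow> real \<Rightarrow> real \<Rightarrow> (real \<Rightarrow> 'w \<Rightarrow> real ^ 'd::finite) \<Rightarrow> (real \<Rightarrow> 'w \<Rightarrow> real ^ 'd)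
     \<Rightarrow> (real \<Rightarrow> 'w \<Rightarrow> real ^ 'd) \<Rightarrow> real \<Rightarrow> real \<Rightarrow> 'w \<Rightarrow> 'd state"
  where "noise \<gamma> L \<epsilon> W\<^sub>\<theta> W\<^sub>p W\<^sub>r \<delta> t \<omega> =
    (sqrt (2 * \<epsilon> * \<delta>) *\<^sub>R W\<^sub>\<theta> t \<omega>, sqrt (2 * \<epsilon> * \<delta>) *\<^sub>R W\<^sub>p t \<omega>, sqrt (2 * \<gamma> * \<epsilon> / L) *\<^sub>R W\<^sub>r t \<omega>)"

text \<open>Global (non-explosive) strong solution started at \<open>z\<close>.  The noise is additive with
  constant coefficients, so the stochastic integral is a multiple of the Brownian motion and
  the equation can be written without Ito integrals.  The sign \<open>\<sigma> = 1\<close> gives the forward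
  and \<open>\<sigma> = -1\<close> the adjoint equation.  Continuity is required of every path, so that hitting
  events of closed sets are measurable without completing \<open>\<mu>\<close>.\<close>

definition strong_solution ::
  "real \<Rightarrow> real \<Rightarrow> real \<Rightarrow> ((real ^ 'd::finite) \<Rightarrow> real) \<Rightarrow> 'w measure
     \<Rightarrow> (real \<Rightarrow> 'w \<Rightarrow> real ^ 'd) \<Rightarrow> (real \<Rightarrow> 'w \<Rightarrow> real ^ 'd) \<Rightarrow> (real \<Rightarrow> 'w \<Rightarrow> real ^ 'd)
     \<Rightarrow> real \<Rightarrow> real \<Rightarrow> 'd state \<Rightarrow> (real \<Rightarrow> 'w \<Rightarrow> 'd state) \<Rightarrow> bool"
  where "strong_solution \<gamma> L \<epsilon> U \<mu> W\<^sub>\<theta> W\<^sub>p W\<^sub>r \<delta> \<sigma> z X \<longleftrightarrow>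
    (\<forall>t\<ge>0. X t \<in> borel_measurable (brownian_filtration \<mu> W\<^sub>\<theta> W\<^sub>p W\<^sub>r t)) \<and>
    (\<forall>\<omega>\<in>space \<mu>. continuous_on {0..} (\<lambda>t. X t \<omega>)) \<and>
    (AE \<omega> in \<mu>. \<forall>t\<ge>0.
       ((\<lambda>s. drift \<gamma> L U \<delta> \<sigma> (X s \<omega>)) has_integral
          (X t \<omega> - z - noise \<gamma> L \<epsilon> W\<^sub>\<theta> W\<^sub>p W\<^sub>r \<delta> t \<omega>)) {0..t})"

text \<open>\<open>Z \<delta> \<sigma> z\<close> is the process with parameters \<open>\<delta>, \<sigma>\<close> started at \<open>z\<close>; part (b) asserts
  in particular that it is the unique strong solution, up to indistinguishability.\<close>

definition controlled_coefficients ::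
  "real \<Rightarrow> real \<Rightarrow> real \<Rightarrow> ((real ^ 'd::finite) \<Rightarrow> real) \<Rightarrow> 'w measure
     \<Rightarrow> (real \<Rightarrow> 'w \<Rightarrow> real ^ 'd) \<Rightarrow> (real \<Rightarrow> 'w \<Rightarrow> real ^ 'd) \<Rightarrow> (real \<Rightarrow> 'w \<Rightarrow> real ^ 'd)
     \<Rightarrow> (real \<Rightarrow> real \<Rightarrow> 'd state \<Rightarrow> real \<Rightarrow> 'w \<Rightarrow> 'd state) \<Rightarrow> bool"
  where "controlled_coefficients \<gamma> L \<epsilon> U \<mu> W\<^sub>\<theta> W\<^sub>p W\<^sub>r Z \<longleftrightarrow>
    (\<forall>\<alpha>. \<exists>C. \<exists>m::nat. \<forall>\<theta>. norm (multi_deriv \<alpha> (grad U) \<theta>) \<le> C * (1 + norm \<theta> ^ m)) \<and>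
    (\<forall>\<sigma>\<in>{1, -1}.
      (\<forall>\<delta>\<in>{0..1}. \<forall>z.
         strong_solution \<gamma> L \<epsilon> U \<mu> W\<^sub>\<theta> W\<^sub>p W\<^sub>r \<delta> \<sigma> z (Z \<delta> \<sigma> z) \<and>
         (\<forall>X. strong_solution \<gamma> L \<epsilon> U \<mu> W\<^sub>\<theta> W\<^sub>p W\<^sub>r \<delta> \<sigma> z X \<longrightarrow>
            (AE \<omega> in \<mu>. \<forall>t\<ge>0. X t \<omega> = Z \<delta> \<sigma> z t \<omega>))) \<and>
      (\<forall>(T::real) (q::real) K'. 1 \<le> q \<and> compact K' \<longrightarrow>
         (SUP \<delta>\<in>{0..1}. SUP z\<in>K'.
            \<integral>\<^sup>+ \<omega>. (SUP t\<in>{0..T}. ennreal ((1 + norm (Z \<delta> \<sigma> z t \<omega>)) powr q)) \<partial>\<mu>) < \<infinity>))"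


section \<open>Hitting events\<close>

definition hitting_time :: "(real \<Rightarrow> 'w \<Rightarrow> 's) \<Rightarrow> 's set \<Rightarrow> 'w \<Rightarrow> ereal"
  where "hitting_time X E \<omega> = Inf {ereal t | t. 0 \<le> t \<and> X t \<omega> \<in> E}"

definition hit_with_small_r ::
  "'w measure \<Rightarrow> (real \<Rightarrow> 'w \<Rightarrow> 'd::finite state) \<Rightarrow> 'd state set \<Rightarrow> real \<Rightarrow> real \<Rightarrow> 'w set"
  where "hit_with_small_r \<mu> X E b M =
    {\<omega>\<in>space \<mu>. hitting_time X E \<omega> \<le> ereal M \<and>
       (case X (real_of_ereal (hitting_time X E \<omega>)) \<omega> of (\<theta>, p, r) \<Rightarrow> norm r \<le> b)}"

end

theory Submission
  imports Defs
begin

text \<open>Since the noise is additive, the regularized and the limiting process live on the same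
  Brownian paths and depend continuously, path by path, on \<open>\<delta>\<close> and on the starting point.  By
  compactness of \<open>K\<close>, both claims reduce to one statement about \<open>\<delta> = 0\<close> and a single starting
  point \<open>z \<notin> \<Sigma>\<close>: almost surely the path never lies on the sphere \<open>\<Sigma>\<close> with \<open>r = 0\<close>.

  Locally \<open>\<Sigma> \<inter> {r = 0}\<close> is contained in \<open>{\<phi> = 0, r\<^sub>i = 0}\<close> where \<open>\<phi>\<close> depends on \<open>(\<theta>, p)\<close> only and
  is non-degenerate in \<open>p\<^sub>i\<close>: take \<open>\<phi> = p\<^sub>i\<close> where \<open>p = 0\<close>, and the defining function of the sphere where
  \<open>p\<^sub>i \<noteq> 0\<close>.  As \<open>t \<mapsto> \<phi>(Z\<^sub>t)\<close> is Lipschitz, a hit before time \<open>T\<close> forces \<open>\<bar>\<phi>(Z\<^sub>t)\<bar> < h\<close> and \<open>\<bar>r\<^sub>i\<bar> < \<beta>\<close> at one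
  of \<open>O(1/h)\<close> grid times, so a bound \<open>O(\<beta> h)\<close> for the probability at a fixed time suffices: the sum
  is \<open>O(\<beta>)\<close> for every \<open>\<beta> > 0\<close>.

  The bound \<open>O(\<beta> h)\<close> replaces a hypoelliptic density estimate.  Over a short window before time \<open>t\<close>
  shift the \<open>i\<close>-th driving Brownian motion by a ramp of height \<open>a\<^sub>1\<close> plus a tent of height \<open>a\<^sub>2\<close>: the ramp
  moves \<open>r\<^sub>i\<close> at order one, while the tent returns to \<open>0\<close> and moves \<open>p\<^sub>i\<close>, hence \<open>\<phi>\<close>.  For \<open>(a\<^sub>1, a\<^sub>2)\<close> in a
  lattice of mesh \<open>C \<beta> \<times> C h\<close> the shifted events are pairwise disjoint, and by quasi-invariance of
  Gaussian measure each has probability at least a constant times that of the unshifted one.  The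
  argument is carried out for Euler schemes, which are explicit functions of finitely many
  Gaussian increments, uniformly in the step size.\<close>

section \<open>Shifting the driving noise of the Euler scheme\<close>

text \<open>A single free parameter in the noise would yield only O(\<beta>) at a fixed time, which
  is lost in a sum over O(1/h) grid times. As \<open>r\<close> has no more than Brownian regularity
  in time, the grid cannot be adapted to \<open>r\<close>; it is adapted to \<phi>, and the missing
  factor h must come from a second parameter. That parameter has to reach \<open>p\<close>, although
  noise enters only \<open>r\<close>. Since \<open>p\<close> integrates \<open>r\<close>, an
  excursion of the shift leaves in \<open>p\<close> its area, of order \<open>s * a\<^sub>2\<close>
  on a window of length s; this dominates the feedback of the drift, which is O(s^2) in
  \<open>p\<close>, and the final \<open>r\<close> feels \<open>a\<^sub>2\<close> only through O(s).
  The ramp displaces \<open>p\<close> at order s as well. Shifts are therefore told apart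
  lexicographically: by \<open>a\<^sub>1\<close> first, and by \<open>a\<^sub>2\<close> only when
  the first parameters agree. With finite schemes the change of measure is a product of
  one-dimensional Gaussian densities and the shifted path is an explicit recursion. Limits are then
  handled by inclusions into events of controlled probability, which spares measurability of
  uncountable unions over time.\<close>

definition tent_rate :: "nat \<Rightarrow> real \<Rightarrow> real \<Rightarrow> nat \<Rightarrow> real" where
  "tent_rate q a\<^sub>1 a\<^sub>2 k = (if k < q then a\<^sub>2 / q else (a\<^sub>1 - a\<^sub>2) / q)"

definition tent :: "nat \<Rightarrow> real \<Rightarrow> real \<Rightarrow> nat \<Rightarrow> real" where
  "tent q a\<^sub>1 a\<^sub>2 k = (\<Sum>l<k. tent_rate q a\<^sub>1 a\<^sub>2 l)"

lemma tent_Suc: "tent q a\<^sub>1 a\<^sub>2 (Suc k) = tent q a\<^sub>1 a\<^sub>2 k + tent_rate q a\<^sub>1 a\<^sub>2 k"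
  by (simp add: tent_def)

lemma tent_0 [simp]: "tent q a\<^sub>1 a\<^sub>2 0 = 0"
  by (simp add: tent_def)

lemma tent_left: "k \<le> q \<Longrightarrow> tent q a\<^sub>1 a\<^sub>2 k = k * a\<^sub>2 / q"
  by (induction k) (auto simp: tent_Suc tent_rate_def field_simps)

lemma tent_right:
  assumes "q > 0" shows "tent q a\<^sub>1 a\<^sub>2 (q + j) = a\<^sub>2 + j * (a\<^sub>1 - a\<^sub>2) / q"
proof (induction j)
  case 0 show ?case using assms by (simp add: tent_left)
next
  case (Suc j) then show ?case using assms by (simp add: tent_Suc tent_rate_def field_simps)
qed

lemma tent_end: "q > 0 \<Longrightarrow> tent q a\<^sub>1 a\<^sub>2 (2 * q) = a\<^sub>1"
  using tent_right[of q a\<^sub>1 a\<^sub>2 q] by (simp add: mult_2)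

lemma abs_tent_le:
  assumes "q > 0" "k \<le> 2 * q"
  shows "\<bar>tent q a\<^sub>1 a\<^sub>2 k\<bar> \<le> \<bar>a\<^sub>1\<bar> + \<bar>a\<^sub>2\<bar>"
proof (cases "k \<le> q")
  case True
  have "\<bar>tent q a\<^sub>1 a\<^sub>2 k\<bar> = (real k / real q) * \<bar>a\<^sub>2\<bar>"
    using True by (simp add: tent_left abs_mult)
  also have "\<dots> \<le> 1 * \<bar>a\<^sub>2\<bar>"
    using True assms by (intro mult_right_mono) auto
  finally show ?thesis by simp
next
  case False
  define j where "j = k - q"
  define c where "c = real j / real q"
  have c: "0 \<le> c" "c \<le> 1" using assms False by (auto simp: c_def j_def)
  have "tent q a\<^sub>1 a\<^sub>2 k = a\<^sub>2 + j * (a\<^sub>1 - a\<^sub>2) / q"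
    using tent_right[of q a\<^sub>1 a\<^sub>2 j] assms False by (simp add: j_def)
  also have "\<dots> = (1 - c) * a\<^sub>2 + c * a\<^sub>1" by (simp add: c_def algebra_simps diff_divide_distrib)
  finally have "\<bar>tent q a\<^sub>1 a\<^sub>2 k\<bar> \<le> \<bar>(1 - c) * a\<^sub>2\<bar> + \<bar>c * a\<^sub>1\<bar>" by linarith
  also have "\<dots> = (1 - c) * \<bar>a\<^sub>2\<bar> + c * \<bar>a\<^sub>1\<bar>" using c by (simp add: abs_mult)
  also have "\<dots> \<le> 1 * \<bar>a\<^sub>2\<bar> + 1 * \<bar>a\<^sub>1\<bar>"
    using c by (intro add_mono mult_right_mono) auto
  finally show ?thesis by simp
qed

text \<open>This is the area that \<open>p\<close> accumulates by integrating \<open>r\<close>, as a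
  left Riemann sum. The tent contributes \<open>q * a\<^sub>2\<close>, half base times height; the
  ramp, which rises only in the second half, contributes the other term.\<close>

lemma sum_tent:
  assumes "q > 0"
  shows "(\<Sum>l<2 * q. tent q a\<^sub>1 a\<^sub>2 l) = q * a\<^sub>2 + a\<^sub>1 * (real q - 1) / 2"
proof -
  have left: "(\<Sum>l<k. tent q a\<^sub>1 a\<^sub>2 l) = a\<^sub>2 / q * (real k * (real k - 1) / 2)" if "k \<le> q" for k
    using that
  proof (induction k)
    case (Suc k)
    then have "(\<Sum>l<Suc k. tent q a\<^sub>1 a\<^sub>2 l) = a\<^sub>2 / q * (real k * (real k - 1) / 2) + k * a\<^sub>2 / q"
      by (simp add: tent_left)
    then show ?case using assms by (simp add: field_simps)
  qed simp
  have "(\<Sum>l<q + j. tent q a\<^sub>1 a\<^sub>2 l)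
      = a\<^sub>2 * (real q - 1) / 2 + j * a\<^sub>2 + (a\<^sub>1 - a\<^sub>2) / q * (real j * (real j - 1) / 2)" for j
  proof (induction j)
    case 0 show ?case using left[of q] assms by simp
  next
    case (Suc j)
    have "(\<Sum>l<q + Suc j. tent q a\<^sub>1 a\<^sub>2 l)
        = (\<Sum>l<q + j. tent q a\<^sub>1 a\<^sub>2 l) + (a\<^sub>2 + j * (a\<^sub>1 - a\<^sub>2) / q)"
      using assms by (simp add: tent_right)
    also have "\<dots> = a\<^sub>2 * (real q - 1) / 2 + j * a\<^sub>2 + (a\<^sub>1 - a\<^sub>2) / q * (real j * (real j - 1) / 2)
        + (a\<^sub>2 + j * (a\<^sub>1 - a\<^sub>2) / q)"
      by (simp only: Suc.IH)
    also have "\<dots> = a\<^sub>2 * (real q - 1) / 2 + Suc j * a\<^sub>2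
        + (a\<^sub>1 - a\<^sub>2) / q * (real (Suc j) * (real (Suc j) - 1) / 2)"
      using assms by (simp add: field_simps)
    finally show ?case .
  qed
  note this[of q]
  also have "(a\<^sub>1 - a\<^sub>2) / q * (real q * (real q - 1) / 2) = (a\<^sub>1 - a\<^sub>2) * ((real q - 1) / 2)"
    using assms by simp
  also have "a\<^sub>2 * (real q - 1) / 2 + q * a\<^sub>2 + (a\<^sub>1 - a\<^sub>2) * ((real q - 1) / 2)
      = q * a\<^sub>2 + a\<^sub>1 * (real q - 1) / 2"
    by (simp add: algebra_simps diff_divide_distrib)
  finally show ?thesis by (simp only: mult_2)
qed

text \<open>Here \<open>dt\<close>, \<open>dp\<close>, \<open>dr\<close> are the differences of the \<open>\<theta>\<close>, \<open>p\<close>, \<open>r\<close> components of two Euler schemes, \<open>er\<close>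
  is the difference of the gradient terms, and \<open>s\<close> is the length of the window.\<close>

lemma discrete_sensitivity:
  fixes dt dp dr er :: "nat \<Rightarrow> 'v::real_normed_vector" and e :: 'v
  assumes dt: "dt 0 = 0" "\<And>k. dt (Suc k) = dt k + (\<tau> * \<sigma>) *\<^sub>R dp k"
    and dp: "dp 0 = 0" "\<And>k. dp (Suc k) = dp k + \<tau> *\<^sub>R (er k + (\<sigma> * \<gamma>) *\<^sub>R dr k)"
    and dr: "dr 0 = 0" "\<And>k. dr (Suc k) = dr k + \<tau> *\<^sub>R (- (\<sigma> * \<gamma>) *\<^sub>R dp k - \<gamma> *\<^sub>R dr k)
                 + (\<kappa> * tent_rate q a\<^sub>1 a\<^sub>2 k) *\<^sub>R e"
    and er: "\<And>k. norm (er k) \<le> Q * norm (dt k)"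
    and pos: "\<bar>\<sigma>\<bar> = 1" "\<gamma> > 0" "\<kappa> > 0" "Q \<ge> 0" "\<tau> > 0" "q > 0" and e: "norm e = 1"
    and s: "s = 2 * real q * \<tau>" "s \<le> 1" "s * (Q + \<gamma>) \<le> 1" "4 * \<gamma> * s \<le> 1"
    and D: "D = 2 * \<kappa> * (\<bar>a\<^sub>1\<bar> + \<bar>a\<^sub>2\<bar>)"
  shows "norm (dt (2 * q)) \<le> s\<^sup>2 * (Q + \<gamma>) * D"
    and "norm (dp (2 * q) - (\<sigma> * \<gamma> * \<kappa> * \<tau> * (\<Sum>l<2 * q. tent q a\<^sub>1 a\<^sub>2 l)) *\<^sub>R e) \<le> s\<^sup>2 * (Q + 2 * \<gamma>\<^sup>2) * D"
    and "norm (dr (2 * q) - (\<kappa> * a\<^sub>1) *\<^sub>R e) \<le> 2 * \<gamma> * s * D"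
proof -
  let ?g = "tent q a\<^sub>1 a\<^sub>2"
  have D0: "D \<ge> 0" using D pos by simp
  have kt: "0 \<le> real k * \<tau>" "real k * \<tau> \<le> s" if "k \<le> 2 * q" for k
  proof -
    have "real k \<le> 2 * real q" using that by linarith
    then show "real k * \<tau> \<le> s" using pos s(1) by (simp add: mult_right_mono)
  qed (use pos in simp)
  have s0: "s \<ge> 0" using kt[of 0] by simp
  \<comment> \<open>Bootstrap: \<open>D\<close> is twice the bound on the forcing \<kappa> times the
    tent, and the smallness of \<open>s\<close> lets every component stay below \<open>D\<close>, so
    the rates of change stay proportional to \<open>D\<close>. The result is a first-order estimate
    in elapsed time.\<close>
  have first: "norm (dt k) \<le> real k * \<tau> * D \<and> norm (dp k) \<le> real k * \<tau> * ((Q + \<gamma>) * D)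
      \<and> norm (dr k - (\<kappa> * ?g k) *\<^sub>R e) \<le> real k * \<tau> * (2 * \<gamma> * D)
      \<and> norm (dt k) \<le> D \<and> norm (dp k) \<le> D \<and> norm (dr k) \<le> D"
    if "k \<le> 2 * q" for k
    using that
  proof (induction k)
    case 0 show ?case using dt(1) dp(1) dr(1) D0 by simp
  next
    case (Suc k)
    then have k: "Suc k \<le> 2 * q" "k \<le> 2 * q" by auto
    note IH = Suc.IH[OF k(2)]
    have sc: "real (Suc k) * \<tau> * c = real k * \<tau> * c + \<tau> * c" for c by (simp add: algebra_simps)
    have 1: "norm (dt (Suc k)) \<le> real (Suc k) * \<tau> * D"
    proof -
      have "norm (dt (Suc k)) \<le> norm (dt k) + norm ((\<tau> * \<sigma>) *\<^sub>R dp k)"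
        unfolding dt by (rule norm_triangle_ineq)
      also have "norm ((\<tau> * \<sigma>) *\<^sub>R dp k) = \<tau> * norm (dp k)" using pos by (simp add: abs_mult)
      also have "\<dots> \<le> \<tau> * D" using IH pos by (intro mult_left_mono) auto
      finally show ?thesis using IH sc by auto
    qed
    have 2: "norm (dp (Suc k)) \<le> real (Suc k) * \<tau> * ((Q + \<gamma>) * D)"
    proof -
      have "norm (er k + (\<sigma> * \<gamma>) *\<^sub>R dr k) \<le> norm (er k) + norm ((\<sigma> * \<gamma>) *\<^sub>R dr k)"
        by (rule norm_triangle_ineq)
      also have "\<dots> \<le> Q * norm (dt k) + \<gamma> * norm (dr k)"
        using er[of k] pos by (simp add: abs_mult)
      also have "\<dots> \<le> Q * D + \<gamma> * D" using IH pos by (intro add_mono mult_left_mono) auto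
      finally have "\<tau> * norm (er k + (\<sigma> * \<gamma>) *\<^sub>R dr k) \<le> \<tau> * ((Q + \<gamma>) * D)"
        using pos by (intro mult_left_mono) (auto simp: algebra_simps)
      then have "norm (\<tau> *\<^sub>R (er k + (\<sigma> * \<gamma>) *\<^sub>R dr k)) \<le> \<tau> * ((Q + \<gamma>) * D)"
        using pos by simp
      moreover have "norm (dp (Suc k)) \<le> norm (dp k) + norm (\<tau> *\<^sub>R (er k + (\<sigma> * \<gamma>) *\<^sub>R dr k))"
        unfolding dp by (rule norm_triangle_ineq)
      ultimately show ?thesis using IH sc[of "(Q + \<gamma>) * D"] by linarith
    qed
    have 3: "norm (dr (Suc k) - (\<kappa> * ?g (Suc k)) *\<^sub>R e) \<le> real (Suc k) * \<tau> * (2 * \<gamma> * D)"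
    proof -
      have "norm (- (\<sigma> * \<gamma>) *\<^sub>R dp k - \<gamma> *\<^sub>R dr k) \<le> norm (- (\<sigma> * \<gamma>) *\<^sub>R dp k) + norm (\<gamma> *\<^sub>R dr k)"
        by (rule norm_triangle_ineq4)
      also have "\<dots> = \<gamma> * norm (dp k) + \<gamma> * norm (dr k)"
        using pos by (simp add: abs_mult)
      also have "\<dots> \<le> \<gamma> * D + \<gamma> * D" using IH pos by (intro add_mono mult_left_mono) auto
      finally have "\<tau> * norm (- (\<sigma> * \<gamma>) *\<^sub>R dp k - \<gamma> *\<^sub>R dr k) \<le> \<tau> * (2 * \<gamma> * D)"
        using pos by (intro mult_left_mono) (auto simp: algebra_simps)
      then have "norm (\<tau> *\<^sub>R (- (\<sigma> * \<gamma>) *\<^sub>R dp k - \<gamma> *\<^sub>R dr k)) \<le> \<tau> * (2 * \<gamma> * D)"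
        using pos by simp
      moreover have "norm (dr (Suc k) - (\<kappa> * ?g (Suc k)) *\<^sub>R e)
          = norm ((dr k - (\<kappa> * ?g k) *\<^sub>R e) + \<tau> *\<^sub>R (- (\<sigma> * \<gamma>) *\<^sub>R dp k - \<gamma> *\<^sub>R dr k))"
        by (simp add: dr(2) tent_Suc algebra_simps)
      ultimately show ?thesis
        using IH sc[of "2 * \<gamma> * D"] norm_triangle_ineq[of "dr k - (\<kappa> * ?g k) *\<^sub>R e" "\<tau> *\<^sub>R (- (\<sigma> * \<gamma>) *\<^sub>R dp k - \<gamma> *\<^sub>R dr k)"]
        by linarith
    qed
    have 4: "norm (dt (Suc k)) \<le> D"
    proof -
      have "real (Suc k) * \<tau> * D \<le> 1 * D"
        using kt[OF k(1)] s(2) D0 by (intro mult_right_mono) auto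
      then show ?thesis using 1 by simp
    qed
    have 5: "norm (dp (Suc k)) \<le> D"
    proof -
      have "real (Suc k) * \<tau> * (Q + \<gamma>) \<le> s * (Q + \<gamma>)"
        using kt[OF k(1)] pos by (intro mult_right_mono) auto
      then have "real (Suc k) * \<tau> * (Q + \<gamma>) * D \<le> 1 * D"
        using s(3) D0 by (intro mult_right_mono) auto
      then show ?thesis using 2 by (simp add: mult.assoc)
    qed
    have 6: "norm (dr (Suc k)) \<le> D"
    proof -
      have "real (Suc k) * \<tau> * (2 * \<gamma>) \<le> s * (2 * \<gamma>)"
        using kt[OF k(1)] pos by (intro mult_right_mono) auto
      also have "\<dots> \<le> 1 / 2" using s(4) by (simp add: mult.commute[of s])
      finally have "real (Suc k) * \<tau> * (2 * \<gamma>) * D \<le> (1 / 2) * D"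
        using D0 by (intro mult_right_mono) auto
      then have "norm (dr (Suc k) - (\<kappa> * ?g (Suc k)) *\<^sub>R e) \<le> D / 2"
        using 3 by (simp add: mult.assoc)
      moreover have "norm ((\<kappa> * ?g (Suc k)) *\<^sub>R e) \<le> D / 2"
        using abs_tent_le[OF pos(6) k(1), of a\<^sub>1 a\<^sub>2] pos(3) e D by (simp add: abs_mult)
      ultimately show ?thesis
        using norm_triangle_sub[of "dr (Suc k)" "(\<kappa> * ?g (Suc k)) *\<^sub>R e"] by linarith
    qed
    show ?case using 1 2 3 4 5 6 by blast
  qed
  \<comment> \<open>Second pass: with the O(s) bounds of the first pass inserted on the right,
    \<open>dt\<close> and the deviation of \<open>dp\<close> from the area term become O(s^2), one
    order below the area term itself.\<close>
  have second: "norm (dt k) \<le> real k * \<tau> * (s * (Q + \<gamma>) * D)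
     \<and> norm (dp k - (\<sigma> * \<gamma> * \<kappa> * \<tau> * (\<Sum>l<k. ?g l)) *\<^sub>R e) \<le> real k * \<tau> * (s * (Q + 2 * \<gamma>\<^sup>2) * D)"
    if "k \<le> 2 * q" for k
    using that
  proof (induction k)
    case 0 show ?case using dt(1) dp(1) by simp
  next
    case (Suc k)
    then have k: "Suc k \<le> 2 * q" "k \<le> 2 * q" by auto
    note IH = Suc.IH[OF k(2)] note F = first[OF k(2)] note t = kt[OF k(2)]
    have sc: "real (Suc k) * \<tau> * c = real k * \<tau> * c + \<tau> * c" for c by (simp add: algebra_simps)
    have up: "x \<le> s * c" if "x \<le> real k * \<tau> * c" "c \<ge> 0" for x c
      using that t mult_right_mono[of "real k * \<tau>" s c] by linarith
    have "norm (dt (Suc k)) \<le> norm (dt k) + norm ((\<tau> * \<sigma>) *\<^sub>R dp k)"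
      unfolding dt by (rule norm_triangle_ineq)
    also have "norm ((\<tau> * \<sigma>) *\<^sub>R dp k) = \<tau> * norm (dp k)" using pos by (simp add: abs_mult)
    also have "\<dots> \<le> \<tau> * (s * ((Q + \<gamma>) * D))"
      using F pos D0 by (intro mult_left_mono up) auto
    finally have 1: "norm (dt (Suc k)) \<le> real (Suc k) * \<tau> * (s * (Q + \<gamma>) * D)"
      using IH sc[of "s * (Q + \<gamma>) * D"] by (simp add: mult.assoc)
    let ?f = "dr k - (\<kappa> * ?g k) *\<^sub>R e"
    have "norm (er k + (\<sigma> * \<gamma>) *\<^sub>R ?f) \<le> norm (er k) + norm ((\<sigma> * \<gamma>) *\<^sub>R ?f)"
      by (rule norm_triangle_ineq)
    also have "\<dots> \<le> Q * norm (dt k) + \<gamma> * norm ?f"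
      using er[of k] pos by (simp add: abs_mult)
    also have "\<dots> \<le> Q * (s * D) + \<gamma> * (s * (2 * \<gamma> * D))"
      using F pos D0 by (intro add_mono mult_left_mono up) auto
    also have "\<dots> = s * (Q + 2 * \<gamma>\<^sup>2) * D" by (simp add: algebra_simps power2_eq_square)
    finally have "\<tau> * norm (er k + (\<sigma> * \<gamma>) *\<^sub>R ?f) \<le> \<tau> * (s * (Q + 2 * \<gamma>\<^sup>2) * D)"
      using pos by (intro mult_left_mono) auto
    then have "norm (\<tau> *\<^sub>R (er k + (\<sigma> * \<gamma>) *\<^sub>R ?f)) \<le> \<tau> * (s * (Q + 2 * \<gamma>\<^sup>2) * D)"
      using pos by simp
    moreover have "norm (dp (Suc k) - (\<sigma> * \<gamma> * \<kappa> * \<tau> * (\<Sum>l<Suc k. ?g l)) *\<^sub>R e)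
        = norm ((dp k - (\<sigma> * \<gamma> * \<kappa> * \<tau> * (\<Sum>l<k. ?g l)) *\<^sub>R e) + \<tau> *\<^sub>R (er k + (\<sigma> * \<gamma>) *\<^sub>R ?f))"
      by (simp add: dp(2) algebra_simps)
    ultimately have 2: "norm (dp (Suc k) - (\<sigma> * \<gamma> * \<kappa> * \<tau> * (\<Sum>l<Suc k. ?g l)) *\<^sub>R e)
         \<le> real (Suc k) * \<tau> * (s * (Q + 2 * \<gamma>\<^sup>2) * D)"
      using IH sc[of "s * (Q + 2 * \<gamma>\<^sup>2) * D"] norm_triangle_ineq[of "dp k - (\<sigma> * \<gamma> * \<kappa> * \<tau> * (\<Sum>l<k. ?g l)) *\<^sub>R e"
         "\<tau> *\<^sub>R (er k + (\<sigma> * \<gamma>) *\<^sub>R ?f)"] by linarith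
    show ?case using 1 2 by blast
  qed
  have s': "real (2 * q) * \<tau> = s" using s(1) by simp
  show "norm (dt (2 * q)) \<le> s\<^sup>2 * (Q + \<gamma>) * D"
    using second[of "2 * q"] unfolding s' by (simp add: power2_eq_square mult.assoc)
  show "norm (dp (2 * q) - (\<sigma> * \<gamma> * \<kappa> * \<tau> * (\<Sum>l<2 * q. ?g l)) *\<^sub>R e) \<le> s\<^sup>2 * (Q + 2 * \<gamma>\<^sup>2) * D"
    using second[of "2 * q"] unfolding s' by (simp add: power2_eq_square mult.assoc)
  show "norm (dr (2 * q) - (\<kappa> * a\<^sub>1) *\<^sub>R e) \<le> 2 * \<gamma> * s * D"
    using first[of "2 * q"] unfolding s' tent_end[OF pos(6)] by (simp add: mult_ac)
qed

section \<open>Separation of the endpoints of differently shifted schemes\<close>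

definition kinetic_drift ::
  "real \<Rightarrow> real \<Rightarrow> real \<Rightarrow> (real ^ 'd::finite \<Rightarrow> real ^ 'd) \<Rightarrow> 'd state \<Rightarrow> 'd state" where
  "kinetic_drift \<gamma> L \<sigma> G = (\<lambda>(\<theta>, p, r).
    (\<sigma> *\<^sub>R p, - (\<sigma> * inverse L) *\<^sub>R G \<theta> + (\<sigma> * \<gamma>) *\<^sub>R r, - (\<sigma> * \<gamma>) *\<^sub>R p - \<gamma> *\<^sub>R r))"

text \<open>Elimination with absorption. For small \<open>s\<close> the term with s^2
  \<open>A\<^sub>2\<close> in the first inequality is absorbed on the left, bounding
  \<open>A\<^sub>2\<close> by a multiple of \<open>h / s + A\<^sub>1\<close>. The second inequality
  contains \<open>A\<^sub>2\<close> only multiplied by \<open>s\<close>, so it turns into a bound by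
  \<beta>, \<open>h\<close> and half of \<open>A\<^sub>1\<close>. The two non-trivial terms in the
  minimum defining \<open>s\<^sub>0\<close> are the thresholds for these two absorptions.\<close>

lemma separation_inequalities:
  fixes \<eta> C K \<gamma> \<kappa> :: real
  assumes pos: "\<eta> > 0" "C \<ge> 0" "K \<ge> 0" "\<gamma> > 0" "\<kappa> > 0"
  obtains s\<^sub>0 C\<^sub>1 where "s\<^sub>0 > 0" "C\<^sub>1 > 0"
    "\<And>s A\<^sub>1 A\<^sub>2 h \<beta>. \<lbrakk>0 < s; s \<le> s\<^sub>0; 0 \<le> A\<^sub>1; 0 \<le> A\<^sub>2; 0 < h; h \<le> \<beta>;
     \<eta> * \<gamma> * \<kappa> * s / 2 * A\<^sub>2 \<le> 2 * h + C * (4 * s\<^sup>2 * K * \<kappa> * (A\<^sub>1 + A\<^sub>2) + \<gamma> * \<kappa> * s * A\<^sub>1);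
     \<kappa> * A\<^sub>1 \<le> 2 * \<beta> + 4 * \<gamma> * \<kappa> * s * (A\<^sub>1 + A\<^sub>2)\<rbrakk>
     \<Longrightarrow> A\<^sub>1 \<le> C\<^sub>1 * \<beta> \<and> (A\<^sub>1 = 0 \<longrightarrow> A\<^sub>2 \<le> C\<^sub>1 * h / s)"
proof -
  define c where "c = \<eta> * \<gamma> * \<kappa> / 2"
  define E where "E = 4 * C * K * \<kappa>"
  define F where "F = E + C * \<gamma> * \<kappa>"
  have c: "c > 0" and E: "E \<ge> 0" and F: "F \<ge> 0" using pos by (simp_all add: c_def E_def F_def)
  define s\<^sub>0 where "s\<^sub>0 = min 1 (min (c / (2 * (E + 1))) (1 / (8 * \<gamma> * (1 + 2 * F / c))))"
  define C\<^sub>1 where "C\<^sub>1 = 2 / \<kappa> * (2 + 16 * \<gamma> * \<kappa> / c) + 4 / c"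
  have s0: "s\<^sub>0 > 0" using c E F pos by (simp add: s\<^sub>0_def add_pos_nonneg)
  have C1: "C\<^sub>1 > 0" using c pos by (simp add: C\<^sub>1_def add_pos_pos)
  have "A\<^sub>1 \<le> C\<^sub>1 * \<beta> \<and> (A\<^sub>1 = 0 \<longrightarrow> A\<^sub>2 \<le> C\<^sub>1 * h / s)"
    if s: "0 < s" "s \<le> s\<^sub>0" and A: "0 \<le> A\<^sub>1" "0 \<le> A\<^sub>2" and h: "0 < h" "h \<le> \<beta>"
     and h1: "\<eta> * \<gamma> * \<kappa> * s / 2 * A\<^sub>2 \<le> 2 * h + C * (4 * s\<^sup>2 * K * \<kappa> * (A\<^sub>1 + A\<^sub>2) + \<gamma> * \<kappa> * s * A\<^sub>1)"
     and h2: "\<kappa> * A\<^sub>1 \<le> 2 * \<beta> + 4 * \<gamma> * \<kappa> * s * (A\<^sub>1 + A\<^sub>2)"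
    for s A\<^sub>1 A\<^sub>2 h \<beta>
  proof -
    have s1: "s \<le> 1" and s2: "s * (2 * (E + 1)) \<le> c" and s3: "s * (8 * \<gamma> * (1 + 2 * F / c)) \<le> 1"
      using s E F c pos by (auto simp: s\<^sub>0_def pos_le_divide_eq add_pos_nonneg mult.commute)
    have sE: "s * E \<le> c / 2" using s2 s(1) by (simp add: algebra_simps)
    have "c * s * A\<^sub>2 \<le> 2 * h + s * s * E * A\<^sub>1 + s * s * E * A\<^sub>2 + s * (C * \<gamma> * \<kappa>) * A\<^sub>1"
      using h1 by (simp add: c_def E_def power2_eq_square algebra_simps)
    also have "s * s * E * A\<^sub>1 \<le> s * E * A\<^sub>1"
    proof -
      have "s * (s * E * A\<^sub>1) \<le> 1 * (s * E * A\<^sub>1)" using s s1 E A by (intro mult_right_mono) auto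
      then show ?thesis by (simp add: mult_ac)
    qed
    also have "s * s * E * A\<^sub>2 \<le> s * (c / 2) * A\<^sub>2"
    proof -
      have "s * (s * E) * A\<^sub>2 \<le> s * (c / 2) * A\<^sub>2" using s A sE by (intro mult_right_mono mult_left_mono) auto
      then show ?thesis by (simp add: mult_ac)
    qed
    finally have "s * (c / 2 * A\<^sub>2) \<le> s * (2 * h / s + F * A\<^sub>1)"
      using s by (simp add: F_def algebra_simps)
    then have "c / 2 * A\<^sub>2 \<le> 2 * h / s + F * A\<^sub>1" using s(1) by (simp only: mult_le_cancel_left_pos)
    then have A2: "A\<^sub>2 \<le> 4 / c * (h / s) + 2 * F / c * A\<^sub>1" using c by (simp add: field_simps)
    have "s * A\<^sub>2 \<le> s * (4 / c * (h / s) + 2 * F / c * A\<^sub>1)" using s A2 by (intro mult_left_mono) auto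
    then have sA2: "s * A\<^sub>2 \<le> 4 / c * h + s * (2 * F / c) * A\<^sub>1" using s by (simp add: algebra_simps)
    have "\<kappa> * A\<^sub>1 \<le> 2 * \<beta> + 4 * \<gamma> * \<kappa> * (s * A\<^sub>1 + s * A\<^sub>2)" using h2 by (simp add: algebra_simps)
    also have "\<dots> \<le> 2 * \<beta> + 4 * \<gamma> * \<kappa> * (s * A\<^sub>1 + (4 / c * h + s * (2 * F / c) * A\<^sub>1))"
      using sA2 pos by (intro add_left_mono mult_left_mono) auto
    also have "\<dots> = 2 * \<beta> + 16 * \<gamma> * \<kappa> / c * h + (\<kappa> * A\<^sub>1 / 2) * (s * (8 * \<gamma> * (1 + 2 * F / c)))"
      by (simp add: algebra_simps)
    also have "\<dots> \<le> 2 * \<beta> + 16 * \<gamma> * \<kappa> / c * \<beta> + (\<kappa> * A\<^sub>1 / 2) * 1"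
      using s3 h c pos A by (intro add_mono mult_left_mono) auto
    finally have "A\<^sub>1 \<le> 2 / \<kappa> * (2 + 16 * \<gamma> * \<kappa> / c) * \<beta>"
      using pos by (simp add: field_simps)
    also have "\<dots> \<le> C\<^sub>1 * \<beta>" using h c by (intro mult_right_mono) (auto simp: C\<^sub>1_def)
    finally have 1: "A\<^sub>1 \<le> C\<^sub>1 * \<beta>" .
    have "A\<^sub>2 \<le> C\<^sub>1 * (h / s)" if "A\<^sub>1 = 0"
    proof -
      have "4 / c * (h / s) \<le> C\<^sub>1 * (h / s)" using h s c pos by (intro mult_right_mono) (auto simp: C\<^sub>1_def)
      then show ?thesis using A2 that by simp
    qed
    then show ?thesis using 1 by simp
  qed
  then show thesis by (rule that[OF s0 C1])
qed

text \<open>The sequences start from an arbitrary common state because the property is applied on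
  the last window only, after two schemes have run together. The bound on \<open>a\<^sub>2\<close>
  is conditional since the ramp moves \<open>p\<close> at the same order in the window length as the
  tent.\<close>

definition euler_separated ::
  "('d::finite state \<Rightarrow> 'd state) \<Rightarrow> real \<Rightarrow> 'd state set \<Rightarrow> ('d state \<Rightarrow> real) \<Rightarrow> 'd
     \<Rightarrow> nat \<Rightarrow> real \<Rightarrow> real \<Rightarrow> real \<Rightarrow> real \<Rightarrow> bool" where
  "euler_separated b \<kappa> V \<phi> i q \<tau> h \<beta> C \<longleftrightarrow> (\<forall>a\<^sub>1 a\<^sub>2 w x y. x 0 = y 0 \<longrightarrow>
      (\<forall>k. x (Suc k) = x k + \<tau> *\<^sub>R b (x k) + (0, 0, \<kappa> *\<^sub>R w k)) \<longrightarrow>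
      (\<forall>k. y (Suc k) = y k + \<tau> *\<^sub>R b (y k) + (0, 0, \<kappa> *\<^sub>R (w k + tent_rate q a\<^sub>1 a\<^sub>2 k *\<^sub>R axis i 1))) \<longrightarrow>
      x (2 * q) \<in> V \<longrightarrow> y (2 * q) \<in> V \<longrightarrow> \<bar>\<phi> (x (2 * q))\<bar> \<le> h \<longrightarrow> \<bar>\<phi> (y (2 * q))\<bar> \<le> h \<longrightarrow>
      \<bar>snd (snd (x (2 * q))) $ i\<bar> \<le> \<beta> \<longrightarrow> \<bar>snd (snd (y (2 * q))) $ i\<bar> \<le> \<beta> \<longrightarrow>
      \<bar>a\<^sub>1\<bar> \<le> C * \<beta> \<and> (a\<^sub>1 = 0 \<longrightarrow> \<bar>a\<^sub>2\<bar> \<le> C * h / (2 * real q * \<tau>)))"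

text \<open>The hypothesis on \<phi> is a finite-increment form of a lower bound \<eta> on its
  derivative in \<open>p\<close> along axis \<open>i\<close>: \<open>l\<close> is the wanted
  displacement, and all other motion of (\<theta>, \<open>p\<close>) is charged to \<open>C\<close>.
  As both endpoints have \<phi> within \<open>h\<close> of zero, a large tent displacement is
  impossible unless the errors compensate it, and those are O(s^2) or due to
  \<open>a\<^sub>1\<close>.\<close>

lemma euler_separation:
  fixes G :: "real ^ 'd::finite \<Rightarrow> real ^ 'd" and i :: 'd and V :: "'d state set" and \<phi> :: "'d state \<Rightarrow> real"
  assumes pos: "\<bar>\<sigma>\<bar> = 1" "\<gamma> > 0" "\<kappa> > 0" "L > 0" "\<eta> > 0" "C \<ge> 0" "\<Lambda> \<ge> 0"
    and G: "\<And>a b. norm (G a - G b) \<le> \<Lambda> * norm (a - b)"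
    and \<phi>: "\<And>x y l. x \<in> V \<Longrightarrow> y \<in> V \<Longrightarrow> \<bar>\<phi> y - \<phi> x\<bar> \<ge> \<eta> * \<bar>l\<bar> -
           C * (norm (fst y - fst x) + norm (fst (snd y) - fst (snd x) - l *\<^sub>R axis i 1))"
  obtains s\<^sub>0 C\<^sub>1 where "s\<^sub>0 > 0" "C\<^sub>1 > 0"
    "\<And>q \<tau> h \<beta>. \<lbrakk>q > 0; \<tau> > 0; 2 * real q * \<tau> \<le> s\<^sub>0; 0 < h; h \<le> \<beta>\<rbrakk>
     \<Longrightarrow> euler_separated (kinetic_drift \<gamma> L \<sigma> G) \<kappa> V \<phi> i q \<tau> h \<beta> C\<^sub>1"
proof -
  define Q where "Q = \<Lambda> * inverse L"
  define K where "K = Q + \<gamma> + 2 * \<gamma>\<^sup>2"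
  have Q: "Q \<ge> 0" and K: "K \<ge> 0" "Q + \<gamma> \<le> K" "Q + 2 * \<gamma>\<^sup>2 \<le> K" using pos by (auto simp: Q_def K_def)
  obtain s\<^sub>0 C\<^sub>1 where s0: "s\<^sub>0 > 0" "C\<^sub>1 > 0"
    and sep: "\<And>s A\<^sub>1 A\<^sub>2 h \<beta>. \<lbrakk>0 < s; s \<le> s\<^sub>0; 0 \<le> A\<^sub>1; 0 \<le> A\<^sub>2; 0 < h; h \<le> \<beta>;
     \<eta> * \<gamma> * \<kappa> * s / 2 * A\<^sub>2 \<le> 2 * h + C * (4 * s\<^sup>2 * K * \<kappa> * (A\<^sub>1 + A\<^sub>2) + \<gamma> * \<kappa> * s * A\<^sub>1);
     \<kappa> * A\<^sub>1 \<le> 2 * \<beta> + 4 * \<gamma> * \<kappa> * s * (A\<^sub>1 + A\<^sub>2)\<rbrakk>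
     \<Longrightarrow> A\<^sub>1 \<le> C\<^sub>1 * \<beta> \<and> (A\<^sub>1 = 0 \<longrightarrow> A\<^sub>2 \<le> C\<^sub>1 * h / s)"
    by (rule separation_inequalities[OF pos(5,6) K(1) pos(2,3)]) (rule that)
  define s' where "s' = min s\<^sub>0 (min 1 (min (1 / (Q + \<gamma>)) (1 / (4 * \<gamma>))))"
  have s': "s' > 0" using s0 pos Q by (simp add: s'_def add_nonneg_pos)
  have "\<bar>a\<^sub>1\<bar> \<le> C\<^sub>1 * \<beta> \<and> (a\<^sub>1 = 0 \<longrightarrow> \<bar>a\<^sub>2\<bar> \<le> C\<^sub>1 * h / (2 * real q * \<tau>))"
    if qt: "q > 0" "\<tau> > 0" "2 * real q * \<tau> \<le> s'" and h: "0 < h" "h \<le> \<beta>" and xy0: "x 0 = y 0"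
     and x: "\<And>k. x (Suc k) = x k + \<tau> *\<^sub>R kinetic_drift \<gamma> L \<sigma> G (x k) + (0, 0, \<kappa> *\<^sub>R w k)"
     and y: "\<And>k. y (Suc k) = y k + \<tau> *\<^sub>R kinetic_drift \<gamma> L \<sigma> G (y k)
         + (0, 0, \<kappa> *\<^sub>R (w k + tent_rate q a\<^sub>1 a\<^sub>2 k *\<^sub>R axis i 1))"
     and V: "x (2 * q) \<in> V" "y (2 * q) \<in> V" "\<bar>\<phi> (x (2 * q))\<bar> \<le> h" "\<bar>\<phi> (y (2 * q))\<bar> \<le> h"
     and r: "\<bar>snd (snd (x (2 * q))) $ i\<bar> \<le> \<beta>" "\<bar>snd (snd (y (2 * q))) $ i\<bar> \<le> \<beta>"
    for q \<tau> h \<beta> a\<^sub>1 a\<^sub>2 w x y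
  proof -
    define s where "s = 2 * real q * \<tau>"
    define D where "D = 2 * \<kappa> * (\<bar>a\<^sub>1\<bar> + \<bar>a\<^sub>2\<bar>)"
    define dt where "dt k = fst (y k) - fst (x k)" for k
    define dp where "dp k = fst (snd (y k)) - fst (snd (x k))" for k
    define dr where "dr k = snd (snd (y k)) - snd (snd (x k))" for k
    define er where "er k = - (\<sigma> * inverse L) *\<^sub>R (G (fst (y k)) - G (fst (x k)))" for k
    have s: "s > 0" "s \<le> s\<^sub>0" "s \<le> 1" "s * (Q + \<gamma>) \<le> 1" "4 * \<gamma> * s \<le> 1"
      using qt pos Q by (auto simp: s_def s'_def pos_le_divide_eq add_nonneg_pos mult.commute)
    have D0: "D \<ge> 0" using pos by (simp add: D_def)
    have z: "dt 0 = 0" "dp 0 = 0" "dr 0 = 0" using xy0 by (auto simp: dt_def dp_def dr_def)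
    have dt: "dt (Suc k) = dt k + (\<tau> * \<sigma>) *\<^sub>R dp k" for k
      unfolding dt_def dp_def x y by (simp add: kinetic_drift_def case_prod_beta algebra_simps)
    have dp: "dp (Suc k) = dp k + \<tau> *\<^sub>R (er k + (\<sigma> * \<gamma>) *\<^sub>R dr k)" for k
      unfolding dp_def dr_def er_def x y by (simp add: kinetic_drift_def case_prod_beta algebra_simps)
    have dr: "dr (Suc k) = dr k + \<tau> *\<^sub>R (- (\<sigma> * \<gamma>) *\<^sub>R dp k - \<gamma> *\<^sub>R dr k)
                 + (\<kappa> * tent_rate q a\<^sub>1 a\<^sub>2 k) *\<^sub>R axis i 1" for k
      unfolding dp_def dr_def x y by (simp add: kinetic_drift_def case_prod_beta algebra_simps)
    have er: "norm (er k) \<le> Q * norm (dt k)" for k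
    proof -
      have "norm (er k) = inverse L * norm (G (fst (y k)) - G (fst (x k)))"
        using pos by (simp add: er_def abs_mult)
      also have "\<dots> \<le> inverse L * (\<Lambda> * norm (dt k))"
        unfolding dt_def using pos G by (intro mult_left_mono) auto
      finally show ?thesis by (simp add: Q_def mult_ac)
    qed
    note sens = discrete_sensitivity[where dt = dt and dp = dp and dr = dr and er = er and e = "axis i 1",
        OF z(1) dt z(2) dp z(3) dr er pos(1-3) Q qt(2,1) _ s_def s(3-5) D_def, simplified]
    \<comment> \<open>The tent part of the area in \<open>sum_tent\<close>, of modulus
      \<open>\<gamma> * \<kappa> * s / 2 * \<bar>a\<^sub>2\<bar>\<close>; the ramp part is treated
      as an error.\<close>
    let ?l = "\<sigma> * \<gamma> * \<kappa> * \<tau> * (real q * a\<^sub>2)"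
    have sD: "s\<^sup>2 * c * D \<le> s\<^sup>2 * K * D" if "c \<le> K" for c
      using that D0 by (intro mult_right_mono mult_left_mono) auto
    have T: "norm (dt (2 * q)) \<le> s\<^sup>2 * K * D" using sens(1) sD[OF K(2)] by linarith
    have "dp (2 * q) - ?l *\<^sub>R axis i 1 = (dp (2 * q) - (\<sigma> * \<gamma> * \<kappa> * \<tau> * (\<Sum>l<2 * q. tent q a\<^sub>1 a\<^sub>2 l)) *\<^sub>R axis i 1)
        + (\<sigma> * \<gamma> * \<kappa> * \<tau> * (a\<^sub>1 * (real q - 1) / 2)) *\<^sub>R axis i 1"
      unfolding sum_tent[OF qt(1)] by (simp add: algebra_simps)
    then have "norm (dp (2 * q) - ?l *\<^sub>R axis i 1)
       \<le> norm (dp (2 * q) - (\<sigma> * \<gamma> * \<kappa> * \<tau> * (\<Sum>l<2 * q. tent q a\<^sub>1 a\<^sub>2 l)) *\<^sub>R axis i 1)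
        + norm ((\<sigma> * \<gamma> * \<kappa> * \<tau> * (a\<^sub>1 * (real q - 1) / 2)) *\<^sub>R (axis i 1 :: real ^ 'd))"
      by (metis norm_triangle_ineq)
    also have "norm ((\<sigma> * \<gamma> * \<kappa> * \<tau> * (a\<^sub>1 * (real q - 1) / 2)) *\<^sub>R (axis i 1 :: real ^ 'd))
        = \<gamma> * \<kappa> * (\<tau> * (real q - 1) / 2) * \<bar>a\<^sub>1\<bar>" using pos qt by (simp add: abs_mult)
    also have "\<dots> \<le> \<gamma> * \<kappa> * s * \<bar>a\<^sub>1\<bar>"
    proof -
      have "\<tau> * (real q - 1) / 2 \<le> s" using qt by (simp add: s_def algebra_simps)
      then show ?thesis using pos by (intro mult_right_mono mult_left_mono) auto
    qed
    finally have P: "norm (dp (2 * q) - ?l *\<^sub>R axis i 1) \<le> s\<^sup>2 * K * D + \<gamma> * \<kappa> * s * \<bar>a\<^sub>1\<bar>"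
      using sens(2) sD[OF K(3)] by linarith
    have "\<bar>dr (2 * q) $ i - \<kappa> * a\<^sub>1\<bar> \<le> norm (dr (2 * q) - (\<kappa> * a\<^sub>1) *\<^sub>R axis i 1)"
      using component_le_norm_cart[of "dr (2 * q) - (\<kappa> * a\<^sub>1) *\<^sub>R axis i 1" i] by (simp add: axis_def)
    then have R: "\<bar>dr (2 * q) $ i - \<kappa> * a\<^sub>1\<bar> \<le> 2 * \<gamma> * s * D" using sens(3) by linarith
    have R2: "\<bar>dr (2 * q) $ i\<bar> \<le> 2 * \<beta>" using r by (simp add: dr_def)
    have 1: "\<kappa> * \<bar>a\<^sub>1\<bar> \<le> 2 * \<beta> + 4 * \<gamma> * \<kappa> * s * (\<bar>a\<^sub>1\<bar> + \<bar>a\<^sub>2\<bar>)"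
    proof -
      have "\<kappa> * \<bar>a\<^sub>1\<bar> = \<bar>\<kappa> * a\<^sub>1\<bar>" using pos by (simp add: abs_mult)
      also have "\<dots> \<le> 2 * \<beta> + 2 * \<gamma> * s * D" using R R2 by linarith
      finally show ?thesis by (simp add: D_def algebra_simps)
    qed
    have l: "\<bar>?l\<bar> = \<gamma> * \<kappa> * s / 2 * \<bar>a\<^sub>2\<bar>" using pos qt by (simp add: abs_mult s_def)
    have "\<eta> * \<bar>?l\<bar> \<le> \<bar>\<phi> (y (2 * q)) - \<phi> (x (2 * q))\<bar> + C * (norm (dt (2 * q)) + norm (dp (2 * q) - ?l *\<^sub>R axis i 1))"
      using \<phi>[OF V(1,2), of ?l] by (simp add: dt_def dp_def)
    also have "\<dots> \<le> 2 * h + C * (s\<^sup>2 * K * D + (s\<^sup>2 * K * D + \<gamma> * \<kappa> * s * \<bar>a\<^sub>1\<bar>))"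
      using V T P pos by (intro add_mono mult_left_mono) auto
    finally have 2: "\<eta> * \<gamma> * \<kappa> * s / 2 * \<bar>a\<^sub>2\<bar> \<le> 2 * h + C * (4 * s\<^sup>2 * K * \<kappa> * (\<bar>a\<^sub>1\<bar> + \<bar>a\<^sub>2\<bar>) + \<gamma> * \<kappa> * s * \<bar>a\<^sub>1\<bar>)"
      unfolding l by (simp add: D_def algebra_simps)
    show ?thesis using sep[OF s(1,2) _ _ h 2 1] by (simp add: s_def)
  qed
  then have "euler_separated (kinetic_drift \<gamma> L \<sigma> G) \<kappa> V \<phi> i q \<tau> h \<beta> C\<^sub>1"
    if "q > 0" "\<tau> > 0" "2 * real q * \<tau> \<le> s'" "0 < h" "h \<le> \<beta>" for q \<tau> h \<beta>
    using that unfolding euler_separated_def by blast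
  then show thesis by (rule that[OF s' s0(2)])
qed

section \<open>Gaussian quasi-invariance\<close>

abbreviation gauss :: "real \<Rightarrow> real measure" where
  "gauss s \<equiv> density lborel (normal_density 0 s)"

lemma nn_integral_gauss_shift:
  fixes f :: "real \<Rightarrow> ennreal"
  assumes s: "s > 0" and [measurable]: "f \<in> borel_measurable borel"
  shows "(\<integral>\<^sup>+x. f (x + v) \<partial>gauss s) = (\<integral>\<^sup>+x. f x * ennreal (exp (x * v / s\<^sup>2 - v\<^sup>2 / (2 * s\<^sup>2))) \<partial>gauss s)"
proof -
  have nd: "normal_density 0 s (x - v) = normal_density 0 s x * exp (x * v / s\<^sup>2 - v\<^sup>2 / (2 * s\<^sup>2))" for x
  proof -
    have "- (x - v)\<^sup>2 / (2 * s\<^sup>2) = - x\<^sup>2 / (2 * s\<^sup>2) + (x * v / s\<^sup>2 - v\<^sup>2 / (2 * s\<^sup>2))"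
      using s by (simp add: field_simps power2_eq_square)
    then have "exp (- (x - v)\<^sup>2 / (2 * s\<^sup>2)) = exp (- x\<^sup>2 / (2 * s\<^sup>2)) * exp (x * v / s\<^sup>2 - v\<^sup>2 / (2 * s\<^sup>2))"
      by (simp only: exp_add)
    then show ?thesis by (simp add: normal_density_def)
  qed
  have "(\<integral>\<^sup>+x. f (x + v) \<partial>gauss s) = (\<integral>\<^sup>+x. ennreal (normal_density 0 s x) * f (x + v) \<partial>lborel)"
    by (subst nn_integral_density) auto
  also have "\<dots> = (\<integral>\<^sup>+x. ennreal (normal_density 0 s (x - v)) * f x \<partial>lborel)"
    by (subst nn_integral_real_affine[where c = 1 and t = "- v"]) auto
  also have "\<dots> = (\<integral>\<^sup>+x. ennreal (normal_density 0 s x) * (f x * ennreal (exp (x * v / s\<^sup>2 - v\<^sup>2 / (2 * s\<^sup>2)))) \<partial>lborel)"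
    by (intro nn_integral_cong) (simp add: nd ennreal_mult' mult_ac)
  also have "\<dots> = (\<integral>\<^sup>+x. f x * ennreal (exp (x * v / s\<^sup>2 - v\<^sup>2 / (2 * s\<^sup>2))) \<partial>gauss s)"
    by (subst nn_integral_density) auto
  finally show ?thesis .
qed

text \<open>Cameron-Martin formula in finite dimension: Fubini splits off one coordinate at a time,
  and on each coordinate completing the square gives the density. The parameter \<open>s\<close> is
  the standard deviation.\<close>

lemma nn_integral_PiM_gauss_shift:
  fixes f :: "('i \<Rightarrow> real) \<Rightarrow> ennreal" and v :: "'i \<Rightarrow> real"
  assumes s: "s > 0" and "finite I" and "f \<in> borel_measurable (PiM I (\<lambda>_. borel))"
  shows "(\<integral>\<^sup>+x. f (\<lambda>k\<in>I. x k + v k) \<partial>PiM I (\<lambda>_. gauss s))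
       = (\<integral>\<^sup>+x. f x * ennreal (exp (\<Sum>k\<in>I. x k * v k / s\<^sup>2 - (v k)\<^sup>2 / (2 * s\<^sup>2))) \<partial>PiM I (\<lambda>_. gauss s))"
  using assms(2,3)
proof (induction I arbitrary: f rule: finite_induct)
  case empty
  interpret product_sigma_finite "\<lambda>_::'i. gauss s"
    using s by (intro product_sigma_finite.intro) (auto intro!: prob_space_imp_sigma_finite prob_space_normal_density)
  show ?case by (simp add: PiM_empty nn_integral_count_space_finite)
next
  case (insert i I)
  interpret product_sigma_finite "\<lambda>_::'i. gauss s"
    using s by (intro product_sigma_finite.intro) (auto intro!: prob_space_imp_sigma_finite prob_space_normal_density)
  have sets_eq: "sets (PiM J (\<lambda>_. gauss s)) = sets (PiM J (\<lambda>_. borel))" for J :: "'i set"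
    by (intro sets_PiM_cong) auto
  note [measurable] = insert.prems
  note [measurable_cong] = sets_eq
  define g where "g = (\<lambda>k x. exp (x * v k / s\<^sup>2 - (v k)\<^sup>2 / (2 * s\<^sup>2)))"
  have expsum: "exp (\<Sum>k\<in>J. x k * v k / s\<^sup>2 - (v k)\<^sup>2 / (2 * s\<^sup>2)) = (\<Prod>k\<in>J. g k (x k))" if "finite J" for J x
    using that by (simp add: g_def exp_sum)
  interpret I: finite_product_sigma_finite "\<lambda>_::'i. gauss s" I
    by standard (rule insert.hyps)
  have upd[measurable]: "(\<lambda>(y, x). f (x(i := y))) \<in> borel_measurable (borel \<Otimes>\<^sub>M PiM I (\<lambda>_. borel))"
    by (subst measurable_split_conv, rule measurable_compose[OF _ insert.prems])
       (rule measurable_fun_upd[where J = I], use insert.hyps in auto)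
  have upd1[measurable]: "(\<lambda>x. f (x(i := y))) \<in> borel_measurable (PiM I (\<lambda>_. borel))" for y
    using measurable_compose[OF measurable_Pair1' upd, of y] by simp
  have [measurable]: "(\<lambda>x. ennreal (\<Prod>k\<in>I. g k (x k))) \<in> borel_measurable (PiM I (\<lambda>_. borel))"
    unfolding g_def by measurable
  define F where "F y = (\<integral>\<^sup>+x. f (x(i := y)) * ennreal (\<Prod>k\<in>I. g k (x k)) \<partial>PiM I (\<lambda>_. gauss s))" for y
  have F[measurable]: "F \<in> borel_measurable borel"
    unfolding F_def by measurable
  have "(\<integral>\<^sup>+x. f (\<lambda>k\<in>insert i I. x k + v k) \<partial>PiM (insert i I) (\<lambda>_. gauss s))
      = (\<integral>\<^sup>+y. \<integral>\<^sup>+x. f (\<lambda>k\<in>insert i I. (x(i := y)) k + v k) \<partial>PiM I (\<lambda>_. gauss s) \<partial>gauss s)"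
    using insert.hyps by (intro product_nn_integral_insert_rev) auto
  also have "\<dots> = (\<integral>\<^sup>+y. \<integral>\<^sup>+x. f ((\<lambda>k\<in>I. x k + v k)(i := y + v i)) \<partial>PiM I (\<lambda>_. gauss s) \<partial>gauss s)"
    using insert.hyps
    by (intro nn_integral_cong arg_cong[where f = f]) (auto simp: restrict_def fun_eq_iff)
  also have "\<dots> = (\<integral>\<^sup>+y. F (y + v i) \<partial>gauss s)"
    unfolding F_def expsum[OF insert.hyps(1), symmetric]
    by (rule nn_integral_cong) (rule insert.IH[OF upd1])
  also have "\<dots> = (\<integral>\<^sup>+y. F y * ennreal (g i y) \<partial>gauss s)"
    unfolding g_def by (intro nn_integral_gauss_shift s F)
  also have "\<dots> = (\<integral>\<^sup>+y. \<integral>\<^sup>+x. f (x(i := y)) * ennreal (\<Prod>k\<in>insert i I. g k ((x(i := y)) k)) \<partial>PiM I (\<lambda>_. gauss s) \<partial>gauss s)"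
  proof (intro nn_integral_cong)
    fix y :: real
    have "(\<Prod>k\<in>insert i I. g k ((x(i := y)) k)) = (\<Prod>k\<in>I. g k (x k)) * g i y" for x
    proof -
      have "(\<Prod>k\<in>I. g k ((x(i := y)) k)) = (\<Prod>k\<in>I. g k (x k))"
        using insert.hyps by (intro prod.cong) auto
      then show ?thesis using insert.hyps by simp
    qed
    moreover have "(\<Prod>k\<in>I. g k (x k)) \<ge> 0" for x by (intro prod_nonneg) (simp add: g_def)
    ultimately have "(\<integral>\<^sup>+x. f (x(i := y)) * ennreal (\<Prod>k\<in>insert i I. g k ((x(i := y)) k)) \<partial>PiM I (\<lambda>_. gauss s))
       = (\<integral>\<^sup>+x. (f (x(i := y)) * ennreal (\<Prod>k\<in>I. g k (x k))) * ennreal (g i y) \<partial>PiM I (\<lambda>_. gauss s))"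
      by (simp add: ennreal_mult' mult.assoc)
    also have "\<dots> = F y * ennreal (g i y)"
      unfolding F_def by (intro nn_integral_multc) measurable
    finally show "F y * ennreal (g i y)
       = (\<integral>\<^sup>+x. f (x(i := y)) * ennreal (\<Prod>k\<in>insert i I. g k ((x(i := y)) k)) \<partial>PiM I (\<lambda>_. gauss s))" ..
  qed
  also have "\<dots> = (\<integral>\<^sup>+x. f x * ennreal (\<Prod>k\<in>insert i I. g k (x k)) \<partial>PiM (insert i I) (\<lambda>_. gauss s))"
    using insert.hyps
    by (intro product_nn_integral_insert_rev[symmetric]) (auto simp: g_def)
  also have "\<dots> = (\<integral>\<^sup>+x. f x * ennreal (exp (\<Sum>k\<in>insert i I. x k * v k / s\<^sup>2 - (v k)\<^sup>2 / (2 * s\<^sup>2)))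
       \<partial>PiM (insert i I) (\<lambda>_. gauss s))"
    using insert.hyps by (subst expsum) auto
  finally show ?case .
qed

text \<open>Fubini freezes the independent \<open>Y\<close> and the Cameron-Martin density is
  applied to the Gaussian vector alone. That density is not bounded below in general, so the lower
  bound \<open>exp (- c)\<close> is demanded only on \<open>H\<close>; the events used later carry
  bounds on the noise for this purpose.\<close>

lemma (in prob_space) gauss_shift_quasi_invariance:
  fixes \<xi> :: "'a \<Rightarrow> 'i \<Rightarrow> real" and v :: "'i \<Rightarrow> real"
  assumes s: "s > 0" and I: "finite I"
    and \<xi>[measurable]: "\<xi> \<in> M \<rightarrow>\<^sub>M PiM I (\<lambda>_. borel)" and Y[measurable]: "Y \<in> M \<rightarrow>\<^sub>M N"
    and ind: "distr M (PiM I (\<lambda>_. borel) \<Otimes>\<^sub>M N) (\<lambda>\<omega>. (\<xi> \<omega>, Y \<omega>))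
        = distr M (PiM I (\<lambda>_. borel)) \<xi> \<Otimes>\<^sub>M distr M N Y"
    and distr: "distr M (PiM I (\<lambda>_. borel)) \<xi> = PiM I (\<lambda>_. gauss s)"
    and H[measurable]: "H \<in> sets (PiM I (\<lambda>_. borel) \<Otimes>\<^sub>M N)"
    and c: "\<And>x y. (x, y) \<in> H \<Longrightarrow> - c \<le> (\<Sum>k\<in>I. x k * v k / s\<^sup>2 - (v k)\<^sup>2 / (2 * s\<^sup>2))"
  shows "prob {\<omega>\<in>space M. (\<xi> \<omega>, Y \<omega>) \<in> H} \<le> exp c * prob {\<omega>\<in>space M. (\<lambda>k\<in>I. \<xi> \<omega> k + v k, Y \<omega>) \<in> H}"
proof -
  let ?B = "PiM I (\<lambda>_. borel) :: ('i \<Rightarrow> real) measure" and ?G = "PiM I (\<lambda>_. gauss s)"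
  have sets_eq[measurable_cong]: "sets ?G = sets ?B"
    by (intro sets_PiM_cong) auto
  have pair: "distr M (?B \<Otimes>\<^sub>M N) (\<lambda>\<omega>. (\<xi> \<omega>, Y \<omega>)) = ?G \<Otimes>\<^sub>M distr M N Y"
    using ind distr by simp
  interpret G: prob_space ?G
    using s by (intro prob_space_PiM prob_space_normal_density)
  interpret N: prob_space "distr M N Y" by (intro prob_space_distr) auto
  interpret P: pair_sigma_finite ?G "distr M N Y" ..
  have fub: "(\<integral>\<^sup>+\<omega>. F (\<xi> \<omega>, Y \<omega>) \<partial>M) = (\<integral>\<^sup>+y. \<integral>\<^sup>+x. F (x, y) \<partial>?G \<partial>distr M N Y)"
    if [measurable]: "F \<in> borel_measurable (?B \<Otimes>\<^sub>M N)" for F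
  proof -
    have "(\<integral>\<^sup>+\<omega>. F (\<xi> \<omega>, Y \<omega>) \<partial>M) = (\<integral>\<^sup>+z. F z \<partial>distr M (?B \<Otimes>\<^sub>M N) (\<lambda>\<omega>. (\<xi> \<omega>, Y \<omega>)))"
      by (subst nn_integral_distr) auto
    also have "\<dots> = (\<integral>\<^sup>+y. \<integral>\<^sup>+x. F (x, y) \<partial>?G \<partial>distr M N Y)"
      unfolding pair by (subst P.nn_integral_snd[symmetric]) auto
    finally show ?thesis .
  qed
  define S where "S = (\<lambda>x::'i \<Rightarrow> real. \<lambda>k\<in>I. x k + v k)"
  have S[measurable]: "S \<in> ?B \<rightarrow>\<^sub>M ?B" unfolding S_def by measurable
  have "ennreal (exp (- c)) * emeasure M {\<omega>\<in>space M. (\<xi> \<omega>, Y \<omega>) \<in> H}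
      = (\<integral>\<^sup>+\<omega>. ennreal (exp (- c)) * indicator H (\<xi> \<omega>, Y \<omega>) \<partial>M)"
    by (subst nn_integral_cmult) (auto simp: nn_integral_indicator[symmetric] indicator_def intro!: arg_cong2[where f = "(*)"] nn_integral_cong)
  also have "\<dots> = (\<integral>\<^sup>+y. \<integral>\<^sup>+x. ennreal (exp (- c)) * indicator H (x, y) \<partial>?G \<partial>distr M N Y)"
    by (rule fub) auto
  also have "\<dots> \<le> (\<integral>\<^sup>+y. \<integral>\<^sup>+x. indicator H (x, y) * ennreal (exp (\<Sum>k\<in>I. x k * v k / s\<^sup>2 - (v k)\<^sup>2 / (2 * s\<^sup>2))) \<partial>?G \<partial>distr M N Y)"
    using c by (intro nn_integral_mono) (auto simp: indicator_def)
  also have "\<dots> = (\<integral>\<^sup>+y. \<integral>\<^sup>+x. indicator H (S x, y) \<partial>?G \<partial>distr M N Y)"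
    unfolding S_def
    by (intro nn_integral_cong nn_integral_PiM_gauss_shift[symmetric] s I) auto
  also have "\<dots> = (\<integral>\<^sup>+\<omega>. indicator H (S (\<xi> \<omega>), Y \<omega>) \<partial>M)"
    using fub[of "\<lambda>(x, y). indicator H (S x, y)"] by simp
  also have "\<dots> = emeasure M {\<omega>\<in>space M. (S (\<xi> \<omega>), Y \<omega>) \<in> H}"
    by (auto simp: nn_integral_indicator[symmetric] indicator_def intro!: nn_integral_cong)
  finally have "exp (- c) * prob {\<omega>\<in>space M. (\<xi> \<omega>, Y \<omega>) \<in> H} \<le> prob {\<omega>\<in>space M. (S (\<xi> \<omega>), Y \<omega>) \<in> H}"
    by (simp add: emeasure_eq_measure ennreal_mult'[symmetric])
  then show ?thesis unfolding S_def by (simp add: exp_minus field_simps)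
qed

section \<open>The Euler scheme as a function of the Brownian increments\<close>

primrec euler :: "('d::finite state \<Rightarrow> 'd state) \<Rightarrow> real \<Rightarrow> real \<Rightarrow> 'd state \<Rightarrow> (nat \<Rightarrow> real ^ 'd) \<Rightarrow> nat \<Rightarrow> 'd state" where
  "euler b \<kappa> \<tau> z w 0 = z"
| "euler b \<kappa> \<tau> z w (Suc k) = euler b \<kappa> \<tau> z w k + \<tau> *\<^sub>R b (euler b \<kappa> \<tau> z w k) + (0, 0, \<kappa> *\<^sub>R w k)"

lemma euler_cong: "(\<And>k. k < n \<Longrightarrow> w k = w' k) \<Longrightarrow> euler b \<kappa> \<tau> z w n = euler b \<kappa> \<tau> z w' n"
  by (induction n) auto

lemma borel_measurable_vec_lambda:
  assumes "\<And>j. (\<lambda>x. f x j) \<in> borel_measurable M"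
  shows "(\<lambda>x. (\<chi> j. f x j) :: real ^ 'd::finite) \<in> borel_measurable M"
  by (subst borel_measurable_euclidean_space) (use assms in \<open>auto simp: Basis_vec_def inner_axis\<close>)

lemma borel_measurable_euler:
  assumes b: "b \<in> borel_measurable borel"
    and w: "\<And>k. k < n \<Longrightarrow> (\<lambda>x. w x k) \<in> borel_measurable M"
  shows "(\<lambda>x. euler b \<kappa> \<tau> z (w x) n) \<in> borel_measurable M"
  using w
proof (induction n)
  case (Suc n)
  have [measurable]: "(\<lambda>x. euler b \<kappa> \<tau> z (w x) n) \<in> borel_measurable M" "(\<lambda>x. w x n) \<in> borel_measurable M"
    using Suc by auto
  note [measurable] = b
  have "(\<lambda>x. (0::real^'a, 0::real^'a, \<kappa> *\<^sub>R w x n)) \<in> borel_measurable M"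
    by (simp add: borel_prod[symmetric])
  then show ?case by simp
qed simp

lemma tent_rate_add: "tent_rate q (a\<^sub>1 + b\<^sub>1) (a\<^sub>2 + b\<^sub>2) k = tent_rate q a\<^sub>1 a\<^sub>2 k + tent_rate q b\<^sub>1 b\<^sub>2 k"
  by (simp add: tent_rate_def add_divide_distrib diff_divide_distrib)

section \<open>Tent shifts on the last window, and the law of the shifted coordinate\<close>

definition delayed_tent :: "nat \<Rightarrow> nat \<Rightarrow> real \<Rightarrow> real \<Rightarrow> nat \<Rightarrow> real" where
  "delayed_tent m q a\<^sub>1 a\<^sub>2 k = (if k < m then 0 else tent_rate q a\<^sub>1 a\<^sub>2 (k - m))"

text \<open>The shift has constant rate on each half of the window, so the linear part of the
  exponent sees the noise only through its two half-window sums, and the quadratic part is a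
  multiple of \<open>1 / (q * \<tau>)\<close>. Hence the bound depends on the window length
  \<open>2 * q * \<tau>\<close> but not on the step size, which is what survives the limit of fine
  schemes.\<close>

lemma delayed_tent_exponent:
  assumes q: "q > 0" and \<tau>: "\<tau> > 0" and a: "0 \<le> a\<^sub>1" "a\<^sub>1 \<le> 1" "0 \<le> a\<^sub>2" "a\<^sub>2 \<le> 1"
    and S: "\<bar>\<Sum>k\<in>{m..<m+q}. x k\<bar> \<le> 2 * B" "\<bar>\<Sum>k\<in>{m+q..<m+2*q}. x k\<bar> \<le> 2 * B"
  shows "- ((8 * B + 2) / (2 * real q * \<tau>)) \<le>
    (\<Sum>k\<in>{..<m+2*q}. x k * delayed_tent m q a\<^sub>1 a\<^sub>2 k / \<tau> - (delayed_tent m q a\<^sub>1 a\<^sub>2 k)\<^sup>2 / (2 * \<tau>))"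
proof -
  let ?f = "\<lambda>k. x k * delayed_tent m q a\<^sub>1 a\<^sub>2 k / \<tau> - (delayed_tent m q a\<^sub>1 a\<^sub>2 k)\<^sup>2 / (2 * \<tau>)"
  define S1 where "S1 = (\<Sum>k\<in>{m..<m+q}. x k)"
  define S2 where "S2 = (\<Sum>k\<in>{m+q..<m+2*q}. x k)"
  define Q where "Q = real q * \<tau>"
  have Q: "Q > 0" using q \<tau> by (simp add: Q_def)
  have split: "{..<m+2*q} = {..<m} \<union> ({m..<m+q} \<union> {m+q..<m+2*q})" by auto
  have "sum ?f {..<m} = 0" by (simp add: delayed_tent_def)
  moreover have "sum ?f {m..<m+q} = a\<^sub>2 / Q * S1 - a\<^sub>2\<^sup>2 / (2 * Q)"
  proof -
    have "sum ?f {m..<m+q} = (\<Sum>k\<in>{m..<m+q}. a\<^sub>2 / Q * x k - (a\<^sub>2 / q)\<^sup>2 / (2 * \<tau>))"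
      by (intro sum.cong) (auto simp: delayed_tent_def tent_rate_def Q_def)
    also have "\<dots> = a\<^sub>2 / Q * S1 - q * ((a\<^sub>2 / q)\<^sup>2 / (2 * \<tau>))"
      by (simp add: sum_subtractf sum_distrib_left S1_def)
    also have "q * ((a\<^sub>2 / q)\<^sup>2 / (2 * \<tau>)) = a\<^sub>2\<^sup>2 / (2 * Q)"
      using q \<tau> by (simp add: Q_def power2_eq_square)
    finally show ?thesis .
  qed
  moreover have "sum ?f {m+q..<m+2*q} = (a\<^sub>1 - a\<^sub>2) / Q * S2 - (a\<^sub>1 - a\<^sub>2)\<^sup>2 / (2 * Q)"
  proof -
    have "sum ?f {m+q..<m+2*q} = (\<Sum>k\<in>{m+q..<m+2*q}. (a\<^sub>1 - a\<^sub>2) / Q * x k - ((a\<^sub>1 - a\<^sub>2) / q)\<^sup>2 / (2 * \<tau>))"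
      by (intro sum.cong) (auto simp: delayed_tent_def tent_rate_def Q_def)
    also have "\<dots> = (a\<^sub>1 - a\<^sub>2) / Q * S2 - q * (((a\<^sub>1 - a\<^sub>2) / q)\<^sup>2 / (2 * \<tau>))"
      by (simp add: sum_subtractf sum_distrib_left S2_def)
    also have "q * (((a\<^sub>1 - a\<^sub>2) / q)\<^sup>2 / (2 * \<tau>)) = (a\<^sub>1 - a\<^sub>2)\<^sup>2 / (2 * Q)"
      using q \<tau> by (simp add: Q_def power2_eq_square)
    finally show ?thesis .
  qed
  ultimately have "sum ?f {..<m+2*q} = (a\<^sub>2 * S1 + (a\<^sub>1 - a\<^sub>2) * S2 - (a\<^sub>2\<^sup>2 + (a\<^sub>1 - a\<^sub>2)\<^sup>2) / 2) / Q"
    unfolding split by (subst sum.union_disjoint, auto)+ (simp add: diff_divide_distrib add_divide_distrib)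
  moreover have "- (4 * B + 1) \<le> a\<^sub>2 * S1 + (a\<^sub>1 - a\<^sub>2) * S2 - (a\<^sub>2\<^sup>2 + (a\<^sub>1 - a\<^sub>2)\<^sup>2) / 2"
  proof -
    have lower: "- (4 * B + 1) \<le> x + y - (z + w) / 2"
      if "\<bar>x\<bar> \<le> 2 * B" "\<bar>y\<bar> \<le> 2 * B" "z \<le> 1" "w \<le> 1" for x y z w :: real
    proof -
      have "(z + w) / 2 \<le> 1" using that by simp
      then show ?thesis using that by linarith
    qed
    have "\<bar>a\<^sub>2 * S1\<bar> \<le> 1 * (2 * B)" unfolding abs_mult using a S by (intro mult_mono) (auto simp: S1_def)
    moreover have "\<bar>(a\<^sub>1 - a\<^sub>2) * S2\<bar> \<le> 1 * (2 * B)" unfolding abs_mult using a S by (intro mult_mono) (auto simp: S2_def)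
    moreover have "a\<^sub>2\<^sup>2 \<le> 1" "(a\<^sub>1 - a\<^sub>2)\<^sup>2 \<le> 1" using a by (auto simp: abs_square_le_1)
    ultimately show ?thesis by (intro lower) auto
  qed
  moreover have "- ((8 * B + 2) / (2 * real q * \<tau>)) = - (4 * B + 1) / Q"
  proof -
    have "(8 * B + 2) / (2 * real q * \<tau>) = 2 * (4 * B + 1) / (2 * Q)"
      by (simp add: Q_def mult.assoc)
    also have "\<dots> = (4 * B + 1) / Q" by (rule mult_divide_mult_cancel_left) simp
    finally show ?thesis by (simp only: minus_divide_left)
  qed
  ultimately show ?thesis using Q by (simp only: divide_right_mono less_imp_le)
qed

definition increments :: "(real \<Rightarrow> 'w \<Rightarrow> real ^ 'd::finite) \<Rightarrow> real \<Rightarrow> 'w \<Rightarrow> nat \<Rightarrow> real ^ 'd" where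
  "increments W \<tau> \<omega> k = W (real (Suc k) * \<tau>) \<omega> - W (real k * \<tau>) \<omega>"

text \<open>The increments of coordinate \<open>i\<close> are a measurable function of that
  coordinate process, so independence of the coordinate processes separates them from the entire
  paths of the others. Only coordinate \<open>i\<close> is going to be shifted; \<open>Y\<close> is
  what stays frozen.\<close>

lemma (in prob_space) brownian_increments_coordinate:
  fixes W :: "real \<Rightarrow> 'a \<Rightarrow> real ^ 'd::finite" and i :: 'd
  assumes W: "brownian_motion M W" and \<tau>: "\<tau> > 0" and n: "n > 0"
  defines "\<xi> \<equiv> \<lambda>\<omega>. \<lambda>k\<in>{..<n}. increments W \<tau> \<omega> k $ i" and "Y \<equiv> \<lambda>\<omega>. \<lambda>j\<in>UNIV - {i}. \<lambda>t\<in>{0..}. W t \<omega> $ j"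
    and "B \<equiv> PiM {..<n} (\<lambda>_. borel)" and "N \<equiv> PiM (UNIV - {i}) (\<lambda>_. PiM {0..} (\<lambda>_. borel))"
  shows "\<xi> \<in> M \<rightarrow>\<^sub>M B" (is ?m1) and "Y \<in> M \<rightarrow>\<^sub>M N" (is ?m2)
    and "distr M (B \<Otimes>\<^sub>M N) (\<lambda>\<omega>. (\<xi> \<omega>, Y \<omega>)) = distr M B \<xi> \<Otimes>\<^sub>M distr M N Y" (is ?ind)
    and "distr M B \<xi> = PiM {..<n} (\<lambda>_. gauss (sqrt \<tau>))" (is ?dist)
proof -
  have W1: "brownian_motion_1d M (\<lambda>t \<omega>. W t \<omega> $ i)"
    and ip: "indep_vars (\<lambda>_. PiM {0..} (\<lambda>_. borel)) (\<lambda>j \<omega>. \<lambda>t\<in>{0..}. W t \<omega> $ j) UNIV"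
    using W by (auto simp: brownian_motion_def independent_processes_def)
  define g :: "('d \<Rightarrow> real \<Rightarrow> real) \<Rightarrow> nat \<Rightarrow> real"
    where "g y = (\<lambda>k\<in>{..<n}. y i (real (Suc k) * \<tau>) - y i (real k * \<tau>))" for y
  have g: "g \<in> PiM {i} (\<lambda>_. PiM {0..} (\<lambda>_. borel)) \<rightarrow>\<^sub>M PiM {..<n} (\<lambda>_. borel)"
    unfolding g_def
  proof (intro measurable_restrict borel_measurable_diff)
    fix k :: nat
    have ev: "(\<lambda>y. y i t) \<in> borel_measurable (PiM {i} (\<lambda>_. PiM {0..} (\<lambda>_. borel)))" if "t \<ge> 0" for t :: real
      by (rule measurable_compose[OF measurable_component_singleton[of i] measurable_component_singleton])
         (use that in auto)
    show "(\<lambda>y. y i (real (Suc k) * \<tau>)) \<in> borel_measurable (PiM {i} (\<lambda>_. PiM {0..} (\<lambda>_. borel)))"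
      "(\<lambda>y. y i (real k * \<tau>)) \<in> borel_measurable (PiM {i} (\<lambda>_. PiM {0..} (\<lambda>_. borel)))"
      by (rule ev, use \<tau> in simp)+
  qed
  let ?N' = "PiM {i} (\<lambda>_. PiM {0..} (\<lambda>_. borel)) :: ('d \<Rightarrow> real \<Rightarrow> real) measure"
  let ?X = "\<lambda>\<omega>. \<lambda>j\<in>{i}. \<lambda>t\<in>{0..}. W t \<omega> $ j"
  have iv: "indep_var ?N' ?X N Y"
    unfolding N_def Y_def by (intro indep_var_restrict[OF ip]) auto
  have X: "?X \<in> M \<rightarrow>\<^sub>M ?N'" and Y: "Y \<in> M \<rightarrow>\<^sub>M N"
    and dXY: "distr M ?N' ?X \<Otimes>\<^sub>M distr M N Y = distr M (?N' \<Otimes>\<^sub>M N) (\<lambda>\<omega>. (?X \<omega>, Y \<omega>))"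
    using iv by (simp_all add: indep_var_distribution_eq)
  have gX: "\<xi> = g \<circ> ?X"
    using \<tau> by (auto simp: fun_eq_iff g_def increments_def \<xi>_def)
  note g' = g[folded B_def]
  show ?m1 unfolding gX by (rule measurable_comp[OF X g'])
  show ?m2 by (rule Y)
  interpret Y: prob_space "distr M N Y" by (rule prob_space_distr[OF Y])
  have "distr M B \<xi> \<Otimes>\<^sub>M distr M N Y = distr (distr M ?N' ?X) B g \<Otimes>\<^sub>M distr (distr M N Y) N (\<lambda>y. y)"
    unfolding gX using X Y g' by (simp add: distr_distr comp_def)
  also have "\<dots> = distr (distr M ?N' ?X \<Otimes>\<^sub>M distr M N Y) (B \<Otimes>\<^sub>M N) (\<lambda>(x, y). (g x, y))"
    by (rule pair_measure_distr) (use g' in \<open>auto intro!: prob_space_imp_sigma_finite Y.prob_space_distr\<close>)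
  also have "\<dots> = distr M (B \<Otimes>\<^sub>M N) (\<lambda>\<omega>. (\<xi> \<omega>, Y \<omega>))"
    unfolding dXY gX using X Y g' by (subst distr_distr) (auto simp: comp_def)
  finally show ?ind ..
  define ts where "ts = map (\<lambda>k. real k * \<tau>) [0..<Suc n]"
  have "sorted ts" "\<forall>t\<in>set ts. 0 \<le> t"
    using \<tau> by (auto simp: ts_def sorted_iff_nth_mono mult_right_mono simp del: upt_Suc)
  then have "indep_vars (\<lambda>_. borel) (\<lambda>k \<omega>. W (ts ! Suc k) \<omega> $ i - W (ts ! k) \<omega> $ i) {..<length ts - 1}"
    using W1 unfolding brownian_motion_1d_def by blast
  moreover have len: "length ts - 1 = n" by (simp add: ts_def)
  ultimately have iv: "indep_vars (\<lambda>_. borel) (\<lambda>k \<omega>. increments W \<tau> \<omega> k $ i) {..<n}"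
    by (subst indep_vars_cong[OF refl, where Y = "\<lambda>k \<omega>. W (ts ! Suc k) \<omega> $ i - W (ts ! k) \<omega> $ i"])
       (auto simp: increments_def ts_def simp del: upt_Suc)
  have dk: "distr M borel (\<lambda>\<omega>. increments W \<tau> \<omega> k $ i) = gauss (sqrt \<tau>)" for k
  proof -
    have lt: "0 \<le> real k * \<tau>" "real k * \<tau> < real (Suc k) * \<tau>" and eq: "real (Suc k) * \<tau> - real k * \<tau> = \<tau>"
      using \<tau> by (auto simp: algebra_simps)
    have "distributed M lborel (\<lambda>\<omega>. W (real (Suc k) * \<tau>) \<omega> $ i - W (real k * \<tau>) \<omega> $ i)
        (normal_density 0 (sqrt (real (Suc k) * \<tau> - real k * \<tau>)))"
      using W1 lt unfolding brownian_motion_1d_def by blast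
    from distributed_distr_eq_density[OF this]
    have "distr M lborel (\<lambda>\<omega>. increments W \<tau> \<omega> k $ i) = gauss (sqrt \<tau>)"
      unfolding eq by (simp add: increments_def)
    then show ?thesis by (simp cong: distr_cong)
  qed
  have rv: "random_variable borel (\<lambda>\<omega>. increments W \<tau> \<omega> k $ i)" if "k \<in> {..<n}" for k
    using iv that by (auto simp: indep_vars_def)
  have "distr M B \<xi> = PiM {..<n} (\<lambda>k. distr M borel (\<lambda>\<omega>. increments W \<tau> \<omega> k $ i))"
    unfolding B_def \<xi>_def
    by (rule indep_vars_iff_distr_eq_PiM'[THEN iffD1, OF _ rv iv]) (use n in auto)
  then show ?dist unfolding dk .
qed

text \<open>A packing argument in the unit square of shift parameters. Shifts by distinct lattice
  points give disjoint events, each of probability at least a fixed fraction of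
  \<open>prob E\<close>; there are at least \<open>1 / (c1 * c2)\<close> of them, and their total
  probability is at most one. The bounds on \<open>W\<close> at the two ends and the midpoint of the
  window keep that fraction away from zero.\<close>

lemma (in prob_space) euler_box_probability:
  fixes W :: "real \<Rightarrow> 'a \<Rightarrow> real ^ 'd::finite" and i :: 'd and V :: "'d state set" and \<phi> :: "'d state \<Rightarrow> real"
    and B :: real and z :: "'d state" and m :: nat
  assumes W: "brownian_motion M W" and \<tau>: "\<tau> > 0" and q: "q > 0"
    and b: "b \<in> borel_measurable borel" and V: "V \<in> sets borel" and \<phi>: "\<phi> \<in> borel_measurable borel"
    and C1: "C\<^sub>1 > 0" and h: "0 < h" "h \<le> \<beta>"
    and sep: "euler_separated b \<kappa> V \<phi> i q \<tau> h \<beta> C\<^sub>1"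
  defines "E \<equiv> {\<omega>\<in>space M. euler b \<kappa> \<tau> z (increments W \<tau> \<omega>) (m + 2 * q) \<in> V \<and>
     \<bar>\<phi> (euler b \<kappa> \<tau> z (increments W \<tau> \<omega>) (m + 2 * q))\<bar> \<le> h \<and>
     \<bar>snd (snd (euler b \<kappa> \<tau> z (increments W \<tau> \<omega>) (m + 2 * q))) $ i\<bar> \<le> \<beta> \<and>
     (\<forall>l\<in>{m, m + q, m + 2 * q}. \<bar>W (real l * \<tau>) \<omega> $ i\<bar> \<le> B)}"
  shows "E \<in> events" and "prob E \<le> exp ((8 * B + 2) / (2 * real q * \<tau>)) * 4 * C\<^sub>1\<^sup>2 / (2 * real q * \<tau>) * (\<beta> * h)"
proof -
  let ?n = "m + 2 * q"
  let ?s = "2 * real q * \<tau>"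
  define I where "I = {..<?n}"
  define \<xi> where "\<xi> = (\<lambda>\<omega>. \<lambda>k\<in>{..<?n}. increments W \<tau> \<omega> k $ i)"
  define Y where "Y = (\<lambda>\<omega>. \<lambda>j\<in>UNIV - {i}. \<lambda>t\<in>{0..}. W t \<omega> $ j)"
  define N :: "('d \<Rightarrow> real \<Rightarrow> real) measure" where "N = PiM (UNIV - {i}) (\<lambda>_. PiM {0..} (\<lambda>_. borel))"
  have n: "?n > 0" using q by simp
  have inc: "\<xi> \<in> M \<rightarrow>\<^sub>M PiM I (\<lambda>_. borel)" "Y \<in> M \<rightarrow>\<^sub>M N"
    "distr M (PiM I (\<lambda>_. borel) \<Otimes>\<^sub>M N) (\<lambda>\<omega>. (\<xi> \<omega>, Y \<omega>)) = distr M (PiM I (\<lambda>_. borel)) \<xi> \<Otimes>\<^sub>M distr M N Y"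
    "distr M (PiM I (\<lambda>_. borel)) \<xi> = PiM I (\<lambda>_. gauss (sqrt \<tau>))"
    unfolding \<xi>_def Y_def N_def I_def by (rule brownian_increments_coordinate[OF W \<tau> n, of i])+
  have s: "?s > 0" using q \<tau> by simp
  define wr :: "(nat \<Rightarrow> real) \<times> ('d \<Rightarrow> real \<Rightarrow> real) \<Rightarrow> nat \<Rightarrow> real ^ 'd" where
    "wr xy k = (\<chi> j. if j = i then fst xy k else snd xy j (real (Suc k) * \<tau>) - snd xy j (real k * \<tau>))" for xy k
  define en where "en xy = euler b \<kappa> \<tau> z (wr xy) ?n" for xy
  have wr_meas: "(\<lambda>xy. wr xy k) \<in> borel_measurable (PiM I (\<lambda>_. borel) \<Otimes>\<^sub>M N)" if k: "k < ?n" for k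
    unfolding wr_def
  proof (rule borel_measurable_vec_lambda)
    fix j :: 'd
    have 1: "(\<lambda>xy. fst xy k) \<in> borel_measurable (PiM I (\<lambda>_. borel) \<Otimes>\<^sub>M N)"
      by (rule measurable_compose[OF measurable_fst measurable_component_singleton]) (use k in \<open>simp add: I_def\<close>)
    have 2: "(\<lambda>xy. snd xy j t) \<in> borel_measurable (PiM I (\<lambda>_. borel) \<Otimes>\<^sub>M N)" if "j \<noteq> i" "t \<ge> 0" for t
      unfolding N_def
      by (rule measurable_compose[OF measurable_snd measurable_compose[OF measurable_component_singleton[of j] measurable_component_singleton]])
         (use that in auto)
    have 3: "(\<lambda>xy. snd xy j (real (Suc k) * \<tau>) - snd xy j (real k * \<tau>)) \<in> borel_measurable (PiM I (\<lambda>_. borel) \<Otimes>\<^sub>M N)" if "j \<noteq> i"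
      by (intro borel_measurable_diff 2 that) (use \<tau> in auto)
    show "(\<lambda>xy. if j = i then fst xy k else snd xy j (real (Suc k) * \<tau>) - snd xy j (real k * \<tau>))
       \<in> borel_measurable (PiM I (\<lambda>_. borel) \<Otimes>\<^sub>M N)"
      using 1 3 by (cases "j = i") auto
  qed
  have [measurable]: "en \<in> borel_measurable (PiM I (\<lambda>_. borel) \<Otimes>\<^sub>M N)"
    unfolding en_def by (intro borel_measurable_euler b wr_meas)
  have sums: "(\<lambda>xy. \<Sum>k\<in>A. fst xy k :: real) \<in> borel_measurable (PiM I (\<lambda>_. borel) \<Otimes>\<^sub>M N)" if "A \<subseteq> I" for A
  proof (rule borel_measurable_sum)
    fix k assume "k \<in> A"
    then have "k \<in> I" using that by auto
    then show "(\<lambda>xy. fst xy k :: real) \<in> borel_measurable (PiM I (\<lambda>_. borel) \<Otimes>\<^sub>M N)"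
      by (intro measurable_compose[OF measurable_fst measurable_component_singleton])
  qed
  have [measurable]: "(\<lambda>x::'d state. snd (snd x) $ i) \<in> borel_measurable borel"
    by (intro borel_measurable_continuous_onI continuous_intros)
  note [measurable] = V \<phi>
  \<comment> \<open>The bounds on \<open>W\<close> survive only as bounds on the two half-window
    sums: these are functions of the Gaussian vector, and they are all that the exponent
    requires.\<close>
  define H where "H = {xy\<in>space (PiM I (\<lambda>_. borel) \<Otimes>\<^sub>M N). en xy \<in> V \<and> \<bar>\<phi> (en xy)\<bar> \<le> h \<and> \<bar>snd (snd (en xy)) $ i\<bar> \<le> \<beta> \<and>
      \<bar>\<Sum>k\<in>{m..<m+q}. fst xy k\<bar> \<le> 2 * B \<and> \<bar>\<Sum>k\<in>{m+q..<m+2*q}. fst xy k\<bar> \<le> 2 * B}"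
  have sub: "{m..<m+q} \<subseteq> I" "{m+q..<m+2*q} \<subseteq> I" by (auto simp: I_def)
  note [measurable] = sums[OF sub(1)] sums[OF sub(2)]
  have H: "H \<in> sets (PiM I (\<lambda>_. borel) \<Otimes>\<^sub>M N)"
    unfolding H_def by measurable
  have \<xi>Y: "(\<lambda>\<omega>. (\<xi> \<omega>, Y \<omega>)) \<in> M \<rightarrow>\<^sub>M PiM I (\<lambda>_. borel) \<Otimes>\<^sub>M N"
    by (intro measurable_Pair inc(1,2))
  have wr_inc: "wr (\<xi> \<omega>, Y \<omega>) k = increments W \<tau> \<omega> k" if "k < ?n" for k \<omega>
    using that \<tau> by (auto simp: wr_def \<xi>_def Y_def vec_eq_iff increments_def)
  have en_inc: "en (\<xi> \<omega>, Y \<omega>) = euler b \<kappa> \<tau> z (increments W \<tau> \<omega>) ?n" for \<omega>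
    unfolding en_def using wr_inc by (intro euler_cong)
  have Wm: "(\<lambda>\<omega>. W t \<omega> $ i) \<in> borel_measurable M" if "t \<ge> 0" for t
    using W that by (auto simp: brownian_motion_def brownian_motion_1d_def)
  have incsum: "(\<Sum>k\<in>{c..<d}. \<xi> \<omega> k) = W (real d * \<tau>) \<omega> $ i - W (real c * \<tau>) \<omega> $ i" if "c \<le> d" "d \<le> ?n" for c d \<omega>
  proof -
    have "(\<Sum>k\<in>{c..<d}. \<xi> \<omega> k) = (\<Sum>k\<in>{c..<d}. W (real (Suc k) * \<tau>) \<omega> $ i - W (real k * \<tau>) \<omega> $ i)"
      using that by (intro sum.cong) (auto simp: \<xi>_def increments_def)
    also have "\<dots> = W (real d * \<tau>) \<omega> $ i - W (real c * \<tau>) \<omega> $ i"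
      using that by (intro sum_Suc_diff')
    finally show ?thesis .
  qed
  show E: "E \<in> events"
  proof -
    have [measurable]: "(\<lambda>\<omega>. euler b \<kappa> \<tau> z (increments W \<tau> \<omega>) ?n) \<in> borel_measurable M"
      unfolding en_inc[symmetric] by (rule measurable_compose[OF \<xi>Y]) measurable
    have [measurable]: "(\<lambda>\<omega>. W (real l * \<tau>) \<omega> $ i) \<in> borel_measurable M" for l
      using \<tau> by (intro Wm) simp
    show ?thesis unfolding E_def by measurable
  qed
  have EH: "E \<subseteq> {\<omega>\<in>space M. (\<xi> \<omega>, Y \<omega>) \<in> H}"
  proof
    fix \<omega> assume \<omega>: "\<omega> \<in> E"
    have "\<bar>\<Sum>k\<in>{m..<m+q}. \<xi> \<omega> k\<bar> \<le> 2 * B" "\<bar>\<Sum>k\<in>{m+q..<m+2*q}. \<xi> \<omega> k\<bar> \<le> 2 * B"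
      using \<omega> by (auto simp: incsum E_def)
    then show "\<omega> \<in> {\<omega>\<in>space M. (\<xi> \<omega>, Y \<omega>) \<in> H}"
      using \<omega> measurable_space[OF \<xi>Y, of \<omega>] by (auto simp: E_def H_def en_inc)
  qed
  define Sh where "Sh a\<^sub>1 a\<^sub>2 x = (\<lambda>k\<in>I. x k + delayed_tent m q a\<^sub>1 a\<^sub>2 k)" for a\<^sub>1 a\<^sub>2 and x :: "nat \<Rightarrow> real"
  define A where "A a\<^sub>1 a\<^sub>2 = {\<omega>\<in>space M. (Sh a\<^sub>1 a\<^sub>2 (\<xi> \<omega>), Y \<omega>) \<in> H}" for a\<^sub>1 a\<^sub>2
  have A_ev: "A a\<^sub>1 a\<^sub>2 \<in> events" for a\<^sub>1 a\<^sub>2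
  proof -
    note [measurable] = inc(1,2) H
    have [measurable]: "Sh a\<^sub>1 a\<^sub>2 \<in> PiM I (\<lambda>_. borel) \<rightarrow>\<^sub>M PiM I (\<lambda>_. borel)" unfolding Sh_def by measurable
    show ?thesis unfolding A_def by measurable
  qed
  have shift: "prob E \<le> exp ((8 * B + 2) / ?s) * prob (A a\<^sub>1 a\<^sub>2)"
    if a: "0 \<le> a\<^sub>1" "a\<^sub>1 \<le> 1" "0 \<le> a\<^sub>2" "a\<^sub>2 \<le> 1" for a\<^sub>1 a\<^sub>2
  proof -
    have "prob E \<le> prob {\<omega>\<in>space M. (\<xi> \<omega>, Y \<omega>) \<in> H}"
      using measurable_sets[OF \<xi>Y H] by (intro finite_measure_mono EH) (simp add: vimage_def Int_def conj_commute)
    also have "\<dots> \<le> exp ((8 * B + 2) / ?s) * prob (A a\<^sub>1 a\<^sub>2)"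
      unfolding A_def Sh_def
    proof (rule gauss_shift_quasi_invariance[OF _ _ inc(1,2,3,4) H])
      fix x y assume "(x, y) \<in> H"
      then have "\<bar>\<Sum>k\<in>{m..<m+q}. x k\<bar> \<le> 2 * B" "\<bar>\<Sum>k\<in>{m+q..<m+2*q}. x k\<bar> \<le> 2 * B"
        by (auto simp: H_def)
      from delayed_tent_exponent[OF q \<tau> a this]
      show "- ((8 * B + 2) / ?s) \<le> (\<Sum>k\<in>I. x k * delayed_tent m q a\<^sub>1 a\<^sub>2 k / (sqrt \<tau>)\<^sup>2
           - (delayed_tent m q a\<^sub>1 a\<^sub>2 k)\<^sup>2 / (2 * (sqrt \<tau>)\<^sup>2))"
        using \<tau> by (simp add: I_def)
    qed (use \<tau> in \<open>auto simp: I_def\<close>)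
    finally show ?thesis .
  qed
  have wr_shift: "wr (Sh a\<^sub>1 a\<^sub>2 x, y) k = wr (x, y) k + delayed_tent m q a\<^sub>1 a\<^sub>2 k *\<^sub>R axis i 1" if "k < ?n" for a\<^sub>1 a\<^sub>2 x y k
    using that by (auto simp: wr_def Sh_def vec_eq_iff axis_def I_def)
  have disj: "\<bar>a\<^sub>1' - a\<^sub>1\<bar> \<le> C\<^sub>1 * \<beta> \<and> (a\<^sub>1' = a\<^sub>1 \<longrightarrow> \<bar>a\<^sub>2' - a\<^sub>2\<bar> \<le> C\<^sub>1 * h / ?s)"
    if \<omega>: "\<omega> \<in> A a\<^sub>1 a\<^sub>2" "\<omega> \<in> A a\<^sub>1' a\<^sub>2'" for a\<^sub>1 a\<^sub>2 a\<^sub>1' a\<^sub>2' \<omega>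
  proof -
    \<comment> \<open>Both shifts vanish before step \<open>m\<close>, so the two schemes agree
      there. Tent rates are linear in the parameters, so the two noises differ on the window by a
      tent with parameters \<open>a\<^sub>1' - a\<^sub>1\<close> and
      \<open>a\<^sub>2' - a\<^sub>2\<close>.\<close>
    define w where "w a\<^sub>1 a\<^sub>2 k = wr (\<xi> \<omega>, Y \<omega>) k + delayed_tent m q a\<^sub>1 a\<^sub>2 k *\<^sub>R axis i 1" for a\<^sub>1 a\<^sub>2 k
    define x where "x k = euler b \<kappa> \<tau> z (w a\<^sub>1 a\<^sub>2) (m + k)" for k
    define y where "y k = euler b \<kappa> \<tau> z (w a\<^sub>1' a\<^sub>2') (m + k)" for k
    have en: "en (Sh a\<^sub>1 a\<^sub>2 (\<xi> \<omega>), Y \<omega>) = euler b \<kappa> \<tau> z (w a\<^sub>1 a\<^sub>2) ?n" for a\<^sub>1 a\<^sub>2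
      unfolding en_def w_def by (intro euler_cong wr_shift)
    have "\<bar>a\<^sub>1' - a\<^sub>1\<bar> \<le> C\<^sub>1 * \<beta> \<and> (a\<^sub>1' - a\<^sub>1 = 0 \<longrightarrow> \<bar>a\<^sub>2' - a\<^sub>2\<bar> \<le> C\<^sub>1 * h / ?s)"
    proof (rule sep[unfolded euler_separated_def, rule_format, of x y "\<lambda>k. w a\<^sub>1 a\<^sub>2 (m + k)"])
      show "x 0 = y 0" unfolding x_def y_def
        by (intro euler_cong) (simp add: w_def delayed_tent_def)
      show "x (Suc k) = x k + \<tau> *\<^sub>R b (x k) + (0, 0, \<kappa> *\<^sub>R w a\<^sub>1 a\<^sub>2 (m + k))" for k
        by (simp add: x_def)
      have "w a\<^sub>1' a\<^sub>2' (m + k) = w a\<^sub>1 a\<^sub>2 (m + k) + tent_rate q (a\<^sub>1' - a\<^sub>1) (a\<^sub>2' - a\<^sub>2) k *\<^sub>R axis i 1" for k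
        using tent_rate_add[of q a\<^sub>1 "a\<^sub>1' - a\<^sub>1" a\<^sub>2 "a\<^sub>2' - a\<^sub>2" k]
        by (simp add: w_def delayed_tent_def scaleR_add_left[symmetric] del: scaleR_add_left)
      then show "y (Suc k) = y k + \<tau> *\<^sub>R b (y k) + (0, 0, \<kappa> *\<^sub>R (w a\<^sub>1 a\<^sub>2 (m + k) + tent_rate q (a\<^sub>1' - a\<^sub>1) (a\<^sub>2' - a\<^sub>2) k *\<^sub>R axis i 1))" for k
        by (simp add: y_def)
    qed (use \<omega> in \<open>simp_all add: A_def H_def en x_def y_def\<close>)
    then show ?thesis by auto
  qed
  \<comment> \<open>Twice the separation radii in \<open>disj\<close>, so that two different
    multiples of the mesh always violate them.\<close>
  define c1 where "c1 = 2 * C\<^sub>1 * \<beta>"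
  define c2 where "c2 = 2 * C\<^sub>1 * h / ?s"
  have c: "c1 > 0" "c2 > 0"
    unfolding c1_def c2_def using C1 h by (auto intro!: divide_pos_pos mult_pos_pos q \<tau>)
  \<comment> \<open>Index 0 is included: the floor plus one points in each direction number at least
    \<open>1 / c1\<close> and \<open>1 / c2\<close>, even when a mesh exceeds 1.\<close>
  define J where "J = {..nat \<lfloor>1 / c1\<rfloor>} \<times> {..nat \<lfloor>1 / c2\<rfloor>}"
  have lattice: "real l * c' \<le> 1" if "l \<le> nat \<lfloor>1 / c'\<rfloor>" "c' > 0" for l c'
  proof -
    have "real l \<le> 1 / c'" using that by (simp add: le_nat_floor le_nat_iff le_floor_iff)
    then show ?thesis using that by (simp add: field_simps)
  qed
  have df: "disjoint_family_on (\<lambda>(l\<^sub>1, l\<^sub>2). A (real l\<^sub>1 * c1) (real l\<^sub>2 * c2)) J"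
  unfolding disjoint_family_on_def
  proof (intro ballI impI)
    fix l l' :: "nat \<times> nat" assume ll: "l \<noteq> l'"
    obtain l\<^sub>1 l\<^sub>2 l\<^sub>1' l\<^sub>2' where l: "l = (l\<^sub>1, l\<^sub>2)" "l' = (l\<^sub>1', l\<^sub>2')" by (cases l, cases l')
    then have ne: "\<not> (l\<^sub>1 = l\<^sub>1' \<and> l\<^sub>2 = l\<^sub>2')" using ll by simp
    have eqI: "l = l'" if "\<bar>real l' * c' - real l * c'\<bar> \<le> c' / 2" "c' > 0" for l l' :: nat and c' :: real
    proof -
      have "\<bar>real l' - real l\<bar> * c' \<le> 1 / 2 * c'" using that by (simp add: abs_mult left_diff_distrib[symmetric])
      then have "\<bar>real l' - real l\<bar> \<le> 1 / 2" using that(2) by (simp only: mult_le_cancel_right_pos)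
      then show ?thesis by linarith
    qed
    have "l\<^sub>1 = l\<^sub>1' \<and> l\<^sub>2 = l\<^sub>2'"
      if \<omega>: "\<omega> \<in> A (real l\<^sub>1 * c1) (real l\<^sub>2 * c2)" "\<omega> \<in> A (real l\<^sub>1' * c1) (real l\<^sub>2' * c2)" for \<omega>
    proof -
      have "\<bar>real l\<^sub>1' * c1 - real l\<^sub>1 * c1\<bar> \<le> c1 / 2" using disj[OF \<omega>] by (simp add: c1_def)
      then have 1: "l\<^sub>1 = l\<^sub>1'" using c by (intro eqI)
      then have "\<bar>real l\<^sub>2' * c2 - real l\<^sub>2 * c2\<bar> \<le> c2 / 2" using disj[OF \<omega>] by (simp add: c2_def)
      then have 2: "l\<^sub>2 = l\<^sub>2'" using c by (intro eqI)
      show ?thesis using 1 2 by blast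
    qed
    then show "(case l of (l\<^sub>1, l\<^sub>2) \<Rightarrow> A (real l\<^sub>1 * c1) (real l\<^sub>2 * c2))
        \<inter> (case l' of (l\<^sub>1, l\<^sub>2) \<Rightarrow> A (real l\<^sub>1 * c1) (real l\<^sub>2 * c2)) = {}"
      using ne by (auto simp: l)
  qed
  let ?c = "exp ((8 * B + 2) / ?s)"
  have "real (card J) * prob E = (\<Sum>l\<in>J. prob E)" by simp
  also have "\<dots> \<le> (\<Sum>l\<in>J. ?c * prob ((\<lambda>(l\<^sub>1, l\<^sub>2). A (real l\<^sub>1 * c1) (real l\<^sub>2 * c2)) l))"
    using lattice c by (intro sum_mono) (auto simp: J_def intro!: shift)
  also have "\<dots> = ?c * (\<Sum>l\<in>J. prob ((\<lambda>(l\<^sub>1, l\<^sub>2). A (real l\<^sub>1 * c1) (real l\<^sub>2 * c2)) l))"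
    by (simp add: sum_distrib_left)
  also have "(\<Sum>l\<in>J. prob ((\<lambda>(l\<^sub>1, l\<^sub>2). A (real l\<^sub>1 * c1) (real l\<^sub>2 * c2)) l)) = prob (\<Union>l\<in>J. (\<lambda>(l\<^sub>1, l\<^sub>2). A (real l\<^sub>1 * c1) (real l\<^sub>2 * c2)) l)"
    using df A_ev by (intro finite_measure_finite_Union[symmetric]) (auto simp: J_def)
  also have "?c * \<dots> \<le> ?c * 1" by (intro mult_left_mono) auto
  finally have 1: "real (card J) * prob E \<le> ?c" by simp
  have "(1 / c1) * (1 / c2) \<le> real (card J)"
  proof -
    have "1 / c' \<le> real (Suc (nat \<lfloor>1 / c'\<rfloor>))" if "c' > 0" for c' :: real
      using that by linarith
    then have "(1 / c1) * (1 / c2) \<le> real (Suc (nat \<lfloor>1 / c1\<rfloor>)) * real (Suc (nat \<lfloor>1 / c2\<rfloor>))"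
      using c by (intro mult_mono) auto
    then show ?thesis unfolding J_def by (simp only: card_cartesian_product card_atMost of_nat_mult)
  qed
  then have "(1 / c1) * (1 / c2) * prob E \<le> ?c"
    using 1 mult_right_mono[of "(1 / c1) * (1 / c2)" "real (card J)" "prob E"] by simp
  then have "prob E \<le> ?c * (c1 * c2)" using c by (simp add: field_simps)
  also have "\<dots> = ?c * 4 * C\<^sub>1\<^sup>2 / ?s * (\<beta> * h)" by (simp add: c1_def c2_def power2_eq_square mult_ac)
  finally show "prob E \<le> ?c * 4 * C\<^sub>1\<^sup>2 / ?s * (\<beta> * h)" .
qed

section \<open>Convergence and stability of integral equations\<close>

lemma has_integral_increment:
  fixes X f :: "real \<Rightarrow> 'v::euclidean_space"
  assumes X: "\<And>u. u \<in> {0..t} \<Longrightarrow> ((\<lambda>s. b (X s)) has_integral (X u - x\<^sub>0 - f u)) {0..u}"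
    and uv: "0 \<le> u" "u \<le> v" "v \<le> t"
  shows "((\<lambda>s. b (X s)) has_integral (X v - X u - (f v - f u))) {u..v}"
proof -
  have i: "(\<lambda>s. b (X s)) integrable_on {0..v}" using X[of v] uv by auto
  then have "(\<lambda>s. b (X s)) integrable_on {u..v}"
    by (rule integrable_on_subinterval) (use uv in auto)
  moreover have "integral {u..v} (\<lambda>s. b (X s)) = X v - X u - (f v - f u)"
  proof -
    have "integral {0..u} (\<lambda>s. b (X s)) + integral {u..v} (\<lambda>s. b (X s)) = integral {0..v} (\<lambda>s. b (X s))"
      using uv i by (intro Henstock_Kurzweil_Integration.integral_combine) auto
    moreover have "integral {0..u} (\<lambda>s. b (X s)) = X u - x\<^sub>0 - f u"
      using X[of u] uv by (intro integral_unique) auto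
    moreover have "integral {0..v} (\<lambda>s. b (X s)) = X v - x\<^sub>0 - f v"
      using X[of v] uv by (intro integral_unique) auto
    ultimately show ?thesis by (simp add: algebra_simps)
  qed
  ultimately show ?thesis by (simp add: has_integral_integral)
qed

text \<open>The increments reproduce additive noise exactly, so the local error is only the
  variation of the drift along \<open>X\<close> over one step, which uniform continuity of
  \<open>X\<close> makes small. The path \<open>w\<close> enters with no modulus of
  continuity.\<close>

lemma euler_convergence:
  fixes X :: "real \<Rightarrow> 'd::finite state" and w :: "real \<Rightarrow> real ^ 'd"
  assumes b: "\<And>x y. norm (b x - b y) \<le> \<Lambda> * norm (x - y)" and \<Lambda>: "\<Lambda> \<ge> 0" and t: "t > 0"
    and cont: "continuous_on {0..t} X" and w0: "w 0 = 0"
    and X: "\<And>u. u \<in> {0..t} \<Longrightarrow> ((\<lambda>s. b (X s)) has_integral (X u - z - (0, 0, \<kappa> *\<^sub>R w u))) {0..u}"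
  shows "(\<lambda>n. euler b \<kappa> (t / real n) z (\<lambda>k. w (real (Suc k) * (t / real n)) - w (real k * (t / real n))) n) \<longlonglongrightarrow> X t"
proof (rule LIMSEQ_I)
  fix e :: real assume e: "e > 0"
  define e' where "e' = e / (2 * exp (\<Lambda> * t))"
  have e': "e' > 0" using e by (simp add: e'_def)
  have "uniformly_continuous_on {0..t} X" by (rule compact_uniformly_continuous[OF cont]) simp
  then obtain d where d: "d > 0" "\<And>u v. u \<in> {0..t} \<Longrightarrow> v \<in> {0..t} \<Longrightarrow> dist v u < d \<Longrightarrow> dist (X v) (X u) < e'"
    using e' unfolding uniformly_continuous_on_def by metis
  have X0: "X 0 = z" using integral_unique[OF X[of 0]] t w0 by (simp add: zero_prod_def[symmetric])
  obtain n0 where n0: "t / d < real n0" using reals_Archimedean2 by blast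
  show "\<exists>no. \<forall>n\<ge>no. norm (euler b \<kappa> (t / real n) z (\<lambda>k. w (real (Suc k) * (t / real n)) - w (real k * (t / real n))) n - X t) < e"
  proof (intro exI[of _ n0] allI impI)
    fix n assume n: "n \<ge> n0"
    have "t / d > 0" using t d by simp
    then have npos: "real n > 0" using n n0 by linarith
    define \<tau> where "\<tau> = t / real n"
    have \<tau>: "\<tau> > 0" "real n * \<tau> = t" using t npos by (auto simp: \<tau>_def)
    have "t / d < real n" using n n0 by linarith
    then have \<tau>d: "\<tau> < d" using d npos by (simp add: \<tau>_def field_simps)
    let ?E = "euler b \<kappa> \<tau> z (\<lambda>k. w (real (Suc k) * \<tau>) - w (real k * \<tau>))"
    \<comment> \<open>The right-hand side solves the recursion with factor
      \<open>1 + \<Lambda> * \<tau>\<close> and source \<open>\<Lambda> * e' * \<tau>\<close> from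
      zero. At \<open>k = n\<close> it is at most \<open>e' * exp (\<Lambda> * t)\<close>, that is
      \<open>e / 2\<close>.\<close>
    have "norm (?E k - X (real k * \<tau>)) \<le> e' * ((1 + \<Lambda> * \<tau>) ^ k - 1)" if "k \<le> n" for k
      using that
    proof (induction k)
      case 0 then show ?case by (simp add: X0)
    next
      case (Suc k)
      let ?u = "real k * \<tau>" and ?v = "real (Suc k) * \<tau>"
      have uv: "0 \<le> ?u" "?u \<le> ?v" "?v \<le> t" "?v - ?u = \<tau>"
      proof -
        show "?v \<le> t" unfolding \<tau>(2)[symmetric] using Suc.prems \<tau> by (intro mult_right_mono) auto
      qed (use \<tau> in \<open>auto simp: algebra_simps\<close>)
      define J where "J = X ?v - X ?u - (0, 0, \<kappa> *\<^sub>R (w ?v - w ?u))"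
      have "((\<lambda>s. b (X s)) has_integral J) {?u..?v}"
        using has_integral_increment[OF X uv(1-3)] by (simp add: J_def scaleR_diff_right)
      then have "((\<lambda>s. b (X s) - b (X ?u)) has_integral (J - \<tau> *\<^sub>R b (X ?u))) {?u..?v}"
        using has_integral_diff[OF _ has_integral_const_real[of "b (X ?u)" ?u ?v]] uv by simp
      then have J: "norm (J - \<tau> *\<^sub>R b (X ?u)) \<le> \<Lambda> * e' * \<tau>"
      proof -
        assume *: "((\<lambda>s. b (X s) - b (X ?u)) has_integral (J - \<tau> *\<^sub>R b (X ?u))) {?u..?v}"
        have "norm (b (X s) - b (X ?u)) \<le> \<Lambda> * e'" if "s \<in> {?u..?v}" for s
        proof -
          have us: "?u \<le> s" "s \<le> ?v" using that by auto
          have s: "0 \<le> s" "s \<le> t" "\<bar>s - ?u\<bar> \<le> \<tau>"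
            using us uv(3,4) order_trans[OF uv(1) us(1)] by linarith+
          then have "dist (X s) (X ?u) < e'"
            using uv \<tau>d by (intro d(2)) (auto simp: dist_real_def)
          then have "\<Lambda> * norm (X s - X ?u) \<le> \<Lambda> * e'" using \<Lambda> by (intro mult_left_mono) (auto simp: dist_norm)
          then show ?thesis using b[of "X s" "X ?u"] by linarith
        qed
        then have "norm (J - \<tau> *\<^sub>R b (X ?u)) \<le> \<Lambda> * e' * measure lborel {?u..?v}"
          using * \<Lambda> e' by (intro has_integral_bound_real) auto
        then show ?thesis using uv by simp
      qed
      have "?E (Suc k) - X ?v = (?E k - X ?u) + (\<tau> *\<^sub>R (b (?E k) - b (X ?u)) - (J - \<tau> *\<^sub>R b (X ?u)))"
        by (simp add: J_def algebra_simps)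
      then have "norm (?E (Suc k) - X ?v) \<le> norm (?E k - X ?u) + (norm (\<tau> *\<^sub>R (b (?E k) - b (X ?u))) + norm (J - \<tau> *\<^sub>R b (X ?u)))"
        by (simp only:) (intro norm_triangle_mono norm_triangle_ineq4 order_refl)
      also have "norm (\<tau> *\<^sub>R (b (?E k) - b (X ?u))) \<le> \<tau> * (\<Lambda> * norm (?E k - X ?u))"
        using \<tau> b by (simp add: mult_left_mono)
      finally have "norm (?E (Suc k) - X ?v) \<le> (1 + \<Lambda> * \<tau>) * norm (?E k - X ?u) + \<Lambda> * e' * \<tau>"
        using J by (simp add: algebra_simps)
      also have "\<dots> \<le> (1 + \<Lambda> * \<tau>) * (e' * ((1 + \<Lambda> * \<tau>) ^ k - 1)) + \<Lambda> * e' * \<tau>"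
        using Suc \<Lambda> \<tau> by (intro add_right_mono mult_left_mono) auto
      also have "\<dots> = e' * ((1 + \<Lambda> * \<tau>) ^ Suc k - 1)" by (simp add: algebra_simps)
      finally show ?case .
    qed
    from this[of n] have "norm (?E n - X t) \<le> e' * ((1 + \<Lambda> * \<tau>) ^ n - 1)" using \<tau> by simp
    also have "\<dots> \<le> e' * exp (\<Lambda> * t)"
    proof -
      have "(1 + \<Lambda> * \<tau>) ^ n \<le> exp (\<Lambda> * \<tau>) ^ n"
        using \<Lambda> \<tau> by (intro power_mono) (auto simp: add_nonneg_nonneg)
      also have "\<dots> = exp (\<Lambda> * t)" unfolding \<tau>(2)[symmetric] by (simp add: exp_of_nat_mult[symmetric] mult_ac)
      finally show ?thesis using e' by (intro mult_left_mono) auto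
    qed
    also have "\<dots> < e" using e by (simp add: e'_def)
    finally show "norm (euler b \<kappa> (t / real n) z (\<lambda>k. w (real (Suc k) * (t / real n)) - w (real k * (t / real n))) n - X t) < e"
      by (simp add: \<tau>_def)
  qed
qed

section \<open>Stability under perturbation of drift, noise and starting point\<close>

lemma gronwall_const:
  fixes D :: "real \<Rightarrow> real"
  assumes cont: "continuous_on {0..T} D" and T: "T \<ge> 0" and \<Lambda>: "\<Lambda> > 0"
    and D: "\<And>t. t \<in> {0..T} \<Longrightarrow> D t \<le> c + \<Lambda> * integral {0..t} D"
    and c: "c \<ge> 0"
  shows "t \<in> {0..T} \<Longrightarrow> D t \<le> 2 * c * exp (2 * \<Lambda> * t)"
proof -
  assume t: "t \<in> {0..T}"
  \<comment> \<open>With the weight of rate \<open>2 * \<Lambda>\<close> the integral gives back at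
    most half of the weighted maximum \<open>J\<close>, which is absorbed on the left. This is where
    the factor 2 and the doubled rate of the bound come from.\<close>
  have "continuous_on {0..T} (\<lambda>t. D t * exp (- (2 * \<Lambda> * t)))"
    by (intro continuous_intros cont)
  then obtain u where u: "u \<in> {0..T}" "\<And>t. t \<in> {0..T} \<Longrightarrow> D t * exp (- (2 * \<Lambda> * t)) \<le> D u * exp (- (2 * \<Lambda> * u))"
    using continuous_attains_sup[of "{0..T}" "\<lambda>t. D t * exp (- (2 * \<Lambda> * t))"] T by auto
  define J where "J = D u * exp (- (2 * \<Lambda> * u))"
  have DJ: "D t \<le> J * exp (2 * \<Lambda> * t)" if "t \<in> {0..T}" for t
    using u(2)[OF that] by (simp add: J_def exp_minus field_simps)
  have int: "((\<lambda>s. J * exp (2 * \<Lambda> * s)) has_integral (J * exp (2 * \<Lambda> * u) / (2 * \<Lambda>) - J * exp (2 * \<Lambda> * 0) / (2 * \<Lambda>))) {0..u}"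
    using u(1) \<Lambda> by (intro fundamental_theorem_of_calculus)
      (auto intro!: derivative_eq_intros simp: has_real_derivative_iff_has_vector_derivative[symmetric])
  have J: "J \<le> 2 * c"
  proof (cases "J \<le> 0")
    case True then show ?thesis using c by linarith
  next
    case False
    have "integral {0..u} D \<le> integral {0..u} (\<lambda>s. J * exp (2 * \<Lambda> * s))"
      using u(1) DJ int
      by (intro integral_le integrable_continuous_real continuous_on_subset[OF cont] has_integral_integrable[OF int]) auto
    also have "\<dots> \<le> J * exp (2 * \<Lambda> * u) / (2 * \<Lambda>)"
      using integral_unique[OF int] False \<Lambda> by simp
    finally have "\<Lambda> * integral {0..u} D \<le> \<Lambda> * (J * exp (2 * \<Lambda> * u) / (2 * \<Lambda>))"
      using \<Lambda> by (intro mult_left_mono) auto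
    then have "D u \<le> c + J * exp (2 * \<Lambda> * u) / 2" using D[OF u(1)] \<Lambda> by simp
    then have "D u * exp (- (2 * \<Lambda> * u)) \<le> (c + J * exp (2 * \<Lambda> * u) / 2) * exp (- (2 * \<Lambda> * u))"
      by (intro mult_right_mono) auto
    moreover have "(c + J * exp (2 * \<Lambda> * u) / 2) * exp (- (2 * \<Lambda> * u)) = c * exp (- (2 * \<Lambda> * u)) + J / 2"
      by (simp add: exp_minus field_simps)
    ultimately have "J \<le> c * exp (- (2 * \<Lambda> * u)) + J / 2" unfolding J_def by linarith
    moreover have "c * exp (- (2 * \<Lambda> * u)) \<le> c * 1"
      using c u(1) \<Lambda> by (intro mult_left_mono) auto
    ultimately show ?thesis by linarith
  qed
  have "D t \<le> J * exp (2 * \<Lambda> * t)" by (rule DJ[OF t])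
  also have "\<dots> \<le> 2 * c * exp (2 * \<Lambda> * t)" using J by (intro mult_right_mono) auto
  finally show ?thesis .
qed

text \<open>The drift is only locally Lipschitz, so a continuation argument is needed. Up to the
  first time \<open>u\<close> at which the distance reaches \<open>e'\<close>, the path
  \<open>Y n\<close> stays in a ball with a known Lipschitz constant; there Gronwall gives a bound
  strictly below \<open>e'\<close>, so no such \<open>u\<close> exists. This also prevents
  \<open>Y n\<close> from leaving the ball without any a priori bound on it.\<close>

lemma integral_equation_stability:
  fixes X :: "real \<Rightarrow> 'v::euclidean_space" and Y :: "nat \<Rightarrow> real \<Rightarrow> 'v"
  assumes T: "T \<ge> 0" and contX: "continuous_on {0..T} X" and contY: "\<And>n. continuous_on {0..T} (Y n)"
    and X: "\<And>t. t \<in> {0..T} \<Longrightarrow> ((\<lambda>s. b (X s)) has_integral (X t - x\<^sub>0 - f t)) {0..t}"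
    and Y: "\<And>n t. t \<in> {0..T} \<Longrightarrow> ((\<lambda>s. b\<^sub>n n (Y n s)) has_integral (Y n t - y\<^sub>0 n - g n t)) {0..t}"
    and lip: "\<And>R. \<exists>\<Lambda>. \<forall>x\<in>cball 0 R. \<forall>y\<in>cball 0 R. norm (b x - b y) \<le> \<Lambda> * norm (x - y)"
    and close: "\<And>R. \<exists>C. \<forall>n. \<forall>x\<in>cball 0 R. norm (b\<^sub>n n x - b x) \<le> C * \<delta> n"
    and lim: "y\<^sub>0 \<longlonglongrightarrow> x\<^sub>0" "\<delta> \<longlonglongrightarrow> 0"
    and noise: "\<And>n t. t \<in> {0..T} \<Longrightarrow> norm (g n t - f t) \<le> \<nu> n" "\<nu> \<longlonglongrightarrow> 0"
  shows "uniform_limit {0..T} Y X sequentially"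
proof -
  have "compact (X ` {0..T})" using contX by (intro compact_continuous_image) auto
  then have "bounded (X ` {0..T})" by (rule compact_imp_bounded)
  then obtain R where R: "\<And>t. t \<in> {0..T} \<Longrightarrow> norm (X t) \<le> R"
    unfolding bounded_iff by blast
  obtain \<Lambda>' where \<Lambda>': "\<And>x y. x \<in> cball 0 (R + 1) \<Longrightarrow> y \<in> cball 0 (R + 1) \<Longrightarrow> norm (b x - b y) \<le> \<Lambda>' * norm (x - y)"
    using lip by blast
  define \<Lambda> where "\<Lambda> = \<bar>\<Lambda>'\<bar> + 1"
  have \<Lambda>: "\<Lambda> > 0" by (simp add: \<Lambda>_def)
  have lipR: "norm (b x - b y) \<le> \<Lambda> * norm (x - y)" if "x \<in> cball 0 (R + 1)" "y \<in> cball 0 (R + 1)" for x y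
  proof -
    have "\<Lambda>' * norm (x - y) \<le> \<Lambda> * norm (x - y)" by (intro mult_right_mono) (auto simp: \<Lambda>_def)
    then show ?thesis using \<Lambda>'[OF that] by linarith
  qed
  obtain C where C: "\<And>n x. x \<in> cball 0 (R + 1) \<Longrightarrow> norm (b\<^sub>n n x - b x) \<le> C * \<delta> n"
    using close by blast
  define c where "c n = norm (y\<^sub>0 n - x\<^sub>0) + \<nu> n + \<bar>C * \<delta> n\<bar> * T" for n
  have c_lim: "(\<lambda>n. 2 * c n * exp (2 * \<Lambda> * T)) \<longlonglongrightarrow> 0"
  proof -
    have "c \<longlonglongrightarrow> norm (x\<^sub>0 - x\<^sub>0) + 0 + \<bar>C * 0\<bar> * T"
      unfolding c_def by (intro tendsto_intros lim noise)
    then have "(\<lambda>n. 2 * c n * exp (2 * \<Lambda> * T)) \<longlonglongrightarrow> 2 * 0 * exp (2 * \<Lambda> * T)"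
      by (intro tendsto_intros) auto
    then show ?thesis by simp
  qed
  show ?thesis
  proof (rule uniform_limitI)
    fix e :: real assume e: "e > 0"
    \<comment> \<open>The cap 1 keeps \<open>Y n\<close> in the ball of radius \<open>R + 1\<close>
      for which \<Lambda> and \<open>C\<close> were chosen.\<close>
    define e' where "e' = min e 1"
    have e': "e' > 0" "e' \<le> 1" "e' \<le> e" using e by (auto simp: e'_def)
    have "\<forall>\<^sub>F n in sequentially. 2 * c n * exp (2 * \<Lambda> * T) < e'"
      using c_lim e' by (auto simp: order_tendsto_iff)
    then show "\<forall>\<^sub>F n in sequentially. \<forall>t\<in>{0..T}. dist (Y n t) (X t) < e"
    proof eventually_elim
      case (elim n)
      have nn: "\<nu> n \<ge> 0" using order_trans[OF norm_ge_zero noise(1)[of 0 n]] T by simp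
      have c0: "c n \<ge> 0" using nn T by (simp add: c_def)
      define D where "D t = norm (Y n t - X t)" for t
      have contD: "continuous_on {0..T} D" unfolding D_def by (intro continuous_intros contX contY)
      have step: "D t \<le> c n + \<Lambda> * integral {0..t} D" if t: "t \<in> {0..T}" and small: "\<And>s. s \<in> {0..t} \<Longrightarrow> D s \<le> 1" for t
      proof -
        have I: "((\<lambda>s. b\<^sub>n n (Y n s) - b (X s)) has_integral ((Y n t - y\<^sub>0 n - g n t) - (X t - x\<^sub>0 - f t))) {0..t}"
          by (intro has_integral_diff X Y t)
        then have "(\<lambda>s. b\<^sub>n n (Y n s) - b (X s)) integrable_on {0..t}" by (rule has_integral_integrable)
        moreover have "(\<lambda>s. \<bar>C * \<delta> n\<bar> + \<Lambda> * D s) integrable_on {0..t}"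
          using t by (intro integrable_continuous_real continuous_intros continuous_on_subset[OF contD]) auto
        moreover have "norm (b\<^sub>n n (Y n s) - b (X s)) \<le> \<bar>C * \<delta> n\<bar> + \<Lambda> * D s" if s: "s \<in> {0..t}" for s
        proof -
          have sT: "s \<in> {0..T}" using s t by auto
          have inX: "X s \<in> cball 0 (R + 1)" using R[OF sT] by simp
          have inY: "Y n s \<in> cball 0 (R + 1)"
            using R[OF sT] small[OF s] norm_triangle_sub[of "Y n s" "X s"] by (simp add: D_def)
          have "norm (b\<^sub>n n (Y n s) - b (X s)) \<le> norm (b\<^sub>n n (Y n s) - b (Y n s)) + norm (b (Y n s) - b (X s))"
            using norm_triangle_ineq[of "b\<^sub>n n (Y n s) - b (Y n s)" "b (Y n s) - b (X s)"] by simp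
          then show ?thesis using C[OF inY, of n] lipR[OF inY inX] by (simp add: D_def)
        qed
        ultimately have "norm (integral {0..t} (\<lambda>s. b\<^sub>n n (Y n s) - b (X s))) \<le> integral {0..t} (\<lambda>s. \<bar>C * \<delta> n\<bar> + \<Lambda> * D s)"
          by (intro integral_norm_bound_integral)
        then have "norm ((Y n t - y\<^sub>0 n - g n t) - (X t - x\<^sub>0 - f t)) \<le> integral {0..t} (\<lambda>s. \<bar>C * \<delta> n\<bar> + \<Lambda> * D s)"
          unfolding integral_unique[OF I] .
        also have "\<dots> = \<bar>C * \<delta> n\<bar> * t + \<Lambda> * integral {0..t} D"
        proof -
          have "D integrable_on {0..t}"
            using t by (intro integrable_continuous_real continuous_on_subset[OF contD]) auto
          moreover from this have "(\<lambda>s. \<Lambda> * D s) integrable_on {0..t}" by (rule integrable_on_mult_right)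
          ultimately show ?thesis using t by (subst integral_add) auto
        qed
        also have "\<bar>C * \<delta> n\<bar> * t \<le> \<bar>C * \<delta> n\<bar> * T" using t by (intro mult_left_mono) auto
        finally have "norm ((Y n t - y\<^sub>0 n - g n t) - (X t - x\<^sub>0 - f t)) \<le> \<bar>C * \<delta> n\<bar> * T + \<Lambda> * integral {0..t} D" by simp
        moreover have "D t \<le> norm ((Y n t - y\<^sub>0 n - g n t) - (X t - x\<^sub>0 - f t)) + (norm (y\<^sub>0 n - x\<^sub>0) + norm (g n t - f t))"
        proof -
          have "Y n t - X t = ((Y n t - y\<^sub>0 n - g n t) - (X t - x\<^sub>0 - f t)) + ((y\<^sub>0 n - x\<^sub>0) + (g n t - f t))" by simp
          then show ?thesis unfolding D_def
            by (simp only:) (intro norm_triangle_mono norm_triangle_ineq order_refl)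
        qed
        ultimately show ?thesis using noise(1)[OF t, of n] by (simp add: c_def)
      qed
      have "D t < e'" if t: "t \<in> {0..T}" for t
      proof (rule ccontr)
        assume "\<not> D t < e'"
        then have Dt: "e' \<le> D t" by simp
        have D0: "D 0 < e'"
        proof -
          have "Y n 0 - X 0 = (y\<^sub>0 n - x\<^sub>0) + (g n 0 - f 0)"
            using integral_unique[OF X[of 0]] integral_unique[OF Y[of 0 n]] T by (simp add: algebra_simps)
          then have "D 0 \<le> norm (y\<^sub>0 n - x\<^sub>0) + norm (g n 0 - f 0)"
            unfolding D_def by (simp only: norm_triangle_ineq)
          also have "\<dots> \<le> c n"
          proof -
            have "norm (g n 0 - f 0) \<le> \<nu> n" "0 \<le> \<bar>C * \<delta> n\<bar> * T" using noise(1)[of 0 n] T by auto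
            then show ?thesis unfolding c_def by linarith
          qed
          also have "\<dots> \<le> 2 * c n * exp (2 * \<Lambda> * T)"
            using mult_left_mono[of 1 "exp (2 * \<Lambda> * T)" "2 * c n"] c0 \<Lambda> T by simp
          also have "\<dots> < e'" by (rule elim)
          finally show ?thesis .
        qed
        have cont_sub: "continuous_on {0..s} D" if "s \<le> t" for s
          using that t by (intro continuous_on_subset[OF contD]) auto
        let ?S = "{0..t} \<inter> D -` {e'}"
        have "compact ?S"
          using continuous_closed_preimage[OF cont_sub[OF order_refl], of "{e'}"]
          by (simp add: compact_eq_bounded_closed bounded_Int)
        moreover have "?S \<noteq> {}"
          using IVT'[of D 0 e' t] D0 Dt t cont_sub[of t] by auto
        ultimately have "\<exists>u\<in>?S. \<forall>s\<in>?S. u \<le> s" by (rule compact_attains_inf)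
        then obtain u where uS: "u \<in> ?S" and umin: "\<forall>s\<in>?S. u \<le> s" by (rule bexE)
        have u: "0 \<le> u" "u \<le> t" "D u = e'" using uS by auto
        have u4: "D s < e'" if "0 \<le> s" "s < u" for s
        proof (rule ccontr)
          assume "\<not> D s < e'"
          then have "\<exists>v\<ge>0. v \<le> s \<and> D v = e'"
            using D0 that u(2) by (intro IVT' cont_sub) auto
          then obtain v where v: "0 \<le> v" "v \<le> s" "D v = e'" by blast
          then have "u \<le> v" using that u(2) by (intro bspec[OF umin]) auto
          then show False using v that by linarith
        qed
        have uT: "u \<in> {0..T}" using u t by auto
        have small: "D s \<le> 1" if "s \<in> {0..u}" for s
          using u(3) u4[of s] that e' by (cases "s = u") auto
        have "D u \<le> 2 * c n * exp (2 * \<Lambda> * u)"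
        proof (rule gronwall_const[OF continuous_on_subset[OF contD] u(1) _ _ c0])
          fix s assume s: "s \<in> {0..u}"
          show "D s \<le> c n + \<Lambda> * integral {0..s} D"
            using s uT by (intro step small) auto
        qed (use \<Lambda> uT in auto)
        also have "\<dots> \<le> 2 * c n * exp (2 * \<Lambda> * T)"
          using uT c0 by (intro mult_left_mono) (use \<Lambda> in auto)
        also have "\<dots> < e'" by (rule elim)
        finally show False using u(3) by simp
      qed
      then have "D t < e" if "t \<in> {0..T}" for t using e' that by fastforce
      then show ?case by (simp add: D_def dist_norm)
    qed
  qed
qed

section \<open>Local Lipschitz bounds for the gradient and the drift\<close>

lemma smooth_partial_lipschitz:
  fixes U :: "real ^ 'd::finite \<Rightarrow> real"
  assumes U: "smooth U"
  shows "\<exists>B\<ge>0. \<forall>x\<in>cball 0 R. \<forall>y\<in>cball 0 R. norm (partial_deriv i U x - partial_deriv i U y) \<le> B * norm (x - y)"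
proof -
  let ?g = "partial_deriv i U"
  have diff: "multi_deriv \<alpha> U differentiable (at x)" for \<alpha> x using U by (auto simp: smooth_def)
  have g: "?g differentiable (at x)" for x using diff[of "[i]" x] by (simp add: multi_deriv_def)
  have gj: "partial_deriv j ?g differentiable (at x)" for j x using diff[of "[j, i]" x] by (simp add: multi_deriv_def)
  define S where "S x = (\<Sum>j\<in>UNIV. \<bar>partial_deriv j ?g x\<bar>)" for x
  have "continuous_on (cball 0 R) S"
    unfolding S_def
    by (intro continuous_intros continuous_at_imp_continuous_on ballI differentiable_imp_continuous_within gj)
  then have "bounded (S ` cball 0 R)"
    by (intro compact_imp_bounded compact_continuous_image compact_cball)
  then obtain B where "\<forall>y\<in>S ` cball 0 R. norm y \<le> B" unfolding bounded_iff by blast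
  then have B: "\<bar>S x\<bar> \<le> B" if "x \<in> cball 0 R" for x using that by simp
  have "norm (?g x - ?g y) \<le> max B 0 * norm (x - y)" if xy: "x \<in> cball 0 R" "y \<in> cball 0 R" for x y
  proof (rule differentiable_bound[OF convex_cball _ _ xy])
    fix z :: "real ^ 'd" assume z: "z \<in> cball 0 R"
    let ?D = "frechet_derivative ?g (at z)"
    have D: "(?g has_derivative ?D) (at z)" using g frechet_derivative_works by blast
    then show "(?g has_derivative ?D) (at z within cball 0 R)" by (rule has_derivative_at_withinI)
    have lin: "linear ?D" using D has_derivative_linear by blast
    show "onorm ?D \<le> max B 0"
    proof (rule onorm_le)
      fix v :: "real ^ 'd"
      have "?D v = ?D (\<Sum>j\<in>UNIV. v $ j *\<^sub>R axis j 1)"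
        by (subst basis_expansion[of v, symmetric]) (simp add: scalar_mult_eq_scaleR)
      also have "\<dots> = (\<Sum>j\<in>UNIV. v $ j *\<^sub>R partial_deriv j ?g z)"
        using lin by (simp add: linear_sum linear_scale partial_deriv_def)
      finally have "norm (?D v) \<le> (\<Sum>j\<in>UNIV. norm (v $ j *\<^sub>R partial_deriv j ?g z))"
        by (simp add: sum_norm_le)
      also have "\<dots> \<le> (\<Sum>j\<in>UNIV. norm v * \<bar>partial_deriv j ?g z\<bar>)"
        by (intro sum_mono) (auto simp: abs_mult component_le_norm_cart intro!: mult_right_mono)
      also have "\<dots> = S z * norm v" by (simp add: S_def sum_distrib_left mult.commute)
      also have "\<dots> \<le> max B 0 * norm v" using B[OF z] by (intro mult_right_mono) auto
      finally show "norm (?D v) \<le> max B 0 * norm v" .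
    qed
  qed
  then show ?thesis by (intro exI[of _ "max B 0"]) auto
qed

lemma smooth_grad_lipschitz:
  fixes U :: "real ^ 'd::finite \<Rightarrow> real"
  assumes U: "smooth U"
  obtains B where "B \<ge> 0" "\<And>x y. x \<in> cball 0 R \<Longrightarrow> y \<in> cball 0 R \<Longrightarrow> norm (grad U x - grad U y) \<le> B * norm (x - y)"
proof -
  obtain B where B: "\<And>i. B i \<ge> 0" "\<And>i x y. x \<in> cball 0 R \<Longrightarrow> y \<in> cball 0 R \<Longrightarrow>
      norm (partial_deriv i U x - partial_deriv i U y) \<le> B i * norm (x - y)"
    using smooth_partial_lipschitz[OF U, of R] by metis
  show thesis
  proof (rule that)
    show "(\<Sum>i\<in>UNIV. B i) \<ge> 0" using B(1) by (intro sum_nonneg) auto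
    fix x y :: "real ^ 'd" assume xy: "x \<in> cball 0 R" "y \<in> cball 0 R"
    have "norm (grad U x - grad U y) \<le> (\<Sum>i\<in>UNIV. \<bar>(grad U x - grad U y) $ i\<bar>)" by (rule norm_le_l1_cart)
    also have "\<dots> \<le> (\<Sum>i\<in>UNIV. B i * norm (x - y))"
      using B(2)[OF xy] by (intro sum_mono) (simp add: grad_def)
    finally show "norm (grad U x - grad U y) \<le> (\<Sum>i\<in>UNIV. B i) * norm (x - y)" by (simp add: sum_distrib_right)
  qed
qed

lemma norm_fst_snd_le:
  "norm (fst z) \<le> norm z" "norm (fst (snd z)) \<le> norm z" "norm (snd (snd z)) \<le> norm (z :: 'd::finite state)"
  using norm_fst_le[of "fst z" "snd z"] norm_snd_le[of "snd z" "fst z"] norm_fst_le[of "fst (snd z)" "snd (snd z)"]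
    norm_snd_le[of "snd (snd z)" "fst (snd z)"] by (auto intro: order_trans)

lemma norm_triple_le: "norm (a, b, c) \<le> norm a + norm b + norm c"
  using norm_Pair_le[of a "(b, c)"] norm_Pair_le[of b c] by linarith

lemma kinetic_drift_lipschitz:
  fixes G :: "real ^ 'd::finite \<Rightarrow> real ^ 'd"
  assumes \<sigma>: "\<bar>\<sigma>\<bar> = 1" and pos: "\<gamma> > 0" "L > 0" "\<Lambda> \<ge> 0"
    and G: "norm (G (fst x) - G (fst y)) \<le> \<Lambda> * norm (fst x - fst y)"
  shows "norm (kinetic_drift \<gamma> L \<sigma> G x - kinetic_drift \<gamma> L \<sigma> G y) \<le> (1 + \<Lambda> * inverse L + 3 * \<gamma>) * norm (x - y)"
proof -
  obtain t p r where d: "fst x - fst y = t" "fst (snd x) - fst (snd y) = p" "snd (snd x) - snd (snd y) = r" by blast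
  have n: "norm t \<le> norm (x - y)" "norm p \<le> norm (x - y)" "norm r \<le> norm (x - y)"
    using norm_fst_snd_le[of "x - y"] by (auto simp: d[symmetric])
  have "kinetic_drift \<gamma> L \<sigma> G x - kinetic_drift \<gamma> L \<sigma> G y
    = (\<sigma> *\<^sub>R p, - (\<sigma> * inverse L) *\<^sub>R (G (fst x) - G (fst y)) + (\<sigma> * \<gamma>) *\<^sub>R r, - (\<sigma> * \<gamma>) *\<^sub>R p - \<gamma> *\<^sub>R r)"
    by (simp add: kinetic_drift_def case_prod_beta d[symmetric] algebra_simps)
  also have "norm \<dots> \<le> norm (\<sigma> *\<^sub>R p) + norm (- (\<sigma> * inverse L) *\<^sub>R (G (fst x) - G (fst y)) + (\<sigma> * \<gamma>) *\<^sub>R r)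
      + norm (- (\<sigma> * \<gamma>) *\<^sub>R p - \<gamma> *\<^sub>R r)" by (rule norm_triple_le)
  also have "\<dots> \<le> norm (\<sigma> *\<^sub>R p) + (norm (- (\<sigma> * inverse L) *\<^sub>R (G (fst x) - G (fst y))) + norm ((\<sigma> * \<gamma>) *\<^sub>R r))
      + (norm (- (\<sigma> * \<gamma>) *\<^sub>R p) + norm (\<gamma> *\<^sub>R r))"
    by (intro add_mono norm_triangle_ineq norm_triangle_ineq4 order_refl)
  also have "\<dots> = norm p + (inverse L * norm (G (fst x) - G (fst y)) + \<gamma> * norm r) + (\<gamma> * norm p + \<gamma> * norm r)"
    using \<sigma> pos by (simp add: abs_mult)
  also have "\<dots> \<le> norm (x - y) + (inverse L * (\<Lambda> * norm (x - y)) + \<gamma> * norm (x - y)) + (\<gamma> * norm (x - y) + \<gamma> * norm (x - y))"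
  proof -
    have "norm (G (fst x) - G (fst y)) \<le> \<Lambda> * norm (x - y)"
      using G n(1) pos(3) mult_left_mono[OF n(1) pos(3)] by (simp add: d)
    then show ?thesis using n pos by (intro add_mono mult_left_mono) auto
  qed
  also have "\<dots> = (1 + \<Lambda> * inverse L + 3 * \<gamma>) * norm (x - y)" by (simp add: algebra_simps)
  finally show ?thesis .
qed

lemma drift_0: "drift \<gamma> L U 0 \<sigma> = kinetic_drift \<gamma> L \<sigma> (grad U)"
  by (simp add: drift_def kinetic_drift_def fun_eq_iff)

section \<open>The limiting process avoids the locus \<open>r = 0\<close> of a sphere\<close>

text \<open>Probability of the lower limit of events. It serves twice, to pass from Euler schemes to
  the solution and from grids to continuous time; an inclusion into \<open>S\<close> is all that is
  claimed, so the limiting event itself need not be measurable.\<close>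

lemma (in prob_space) liminf_event:
  assumes A: "\<And>n. A n \<in> events" and c: "\<And>n. n \<ge> n\<^sub>0 \<Longrightarrow> prob (A n) \<le> c"
  obtains S where "S \<in> events" "prob S \<le> c" "\<And>\<omega>. \<forall>\<^sub>F n in sequentially. \<omega> \<in> A n \<Longrightarrow> \<omega> \<in> S"
proof -
  define B where "B m = (\<Inter>n\<in>{m..}. A n)" for m :: nat
  have B: "B m \<in> events" for m unfolding B_def using A by (intro sets.countable_INT') auto
  have "incseq B" by (auto simp: incseq_def B_def)
  then have "(\<lambda>m. prob (B m)) \<longlonglongrightarrow> prob (\<Union>m. B m)"
    using B by (intro finite_Lim_measure_incseq) auto
  moreover have "prob (B m) \<le> c" for m
  proof -
    have "prob (B m) \<le> prob (A (max m n\<^sub>0))" using A by (intro finite_measure_mono) (auto simp: B_def)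
    then show ?thesis using c[of "max m n\<^sub>0"] by simp
  qed
  ultimately have "prob (\<Union>m. B m) \<le> c" by (intro LIMSEQ_le_const2) auto
  moreover have "\<omega> \<in> (\<Union>m. B m)" if "\<forall>\<^sub>F n in sequentially. \<omega> \<in> A n" for \<omega>
    using that by (auto simp: eventually_sequentially B_def)
  ultimately show thesis using B by (intro that[of "\<Union>m. B m"]) auto
qed

text \<open>\<open>P\<close> will involve an existential quantifier over a continuum of times, so it
  is handled by outer measure: the intersection of covers with probability at most
  \<open>1 / (n + 1)\<close> is a null event.\<close>

lemma (in prob_space) AE_not_if_small_covers:
  assumes "\<And>e. e > 0 \<Longrightarrow> \<exists>S\<in>events. prob S \<le> e \<and> {\<omega>\<in>space M. P \<omega>} \<subseteq> S"
  shows "AE \<omega> in M. \<not> P \<omega>"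
proof -
  have "\<exists>S. \<forall>n::nat. S n \<in> events \<and> prob (S n) \<le> inverse (Suc n) \<and> {\<omega>\<in>space M. P \<omega>} \<subseteq> S n"
    using assms by (intro choice allI) (metis inverse_positive_iff_positive of_nat_0_less_iff zero_less_Suc)
  then obtain S where S: "\<And>n::nat. S n \<in> events" "\<And>n. prob (S n) \<le> inverse (Suc n)" "\<And>n. {\<omega>\<in>space M. P \<omega>} \<subseteq> S n"
    by blast
  have ev: "(\<Inter>n. S n) \<in> events" using S(1) by auto
  have "prob (\<Inter>n. S n) \<le> 0"
  proof (rule LIMSEQ_le_const[OF LIMSEQ_inverse_real_of_nat])
    have "prob (\<Inter>n. S n) \<le> inverse (Suc n)" for n
      using finite_measure_mono[of "\<Inter>n. S n" "S n"] S(1,2)[of n] by (intro order_trans[OF _ S(2)[of n]]) auto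
    then show "\<exists>N. \<forall>n\<ge>N. prob (\<Inter>n. S n) \<le> inverse (real (Suc n))" by auto
  qed
  then have "emeasure M (\<Inter>n. S n) = 0" by (simp add: emeasure_eq_measure measure_le_0_iff)
  then show ?thesis using S(3) ev by (intro AE_I[of _ _ "\<Inter>n. S n"]) auto
qed

text \<open>Noise enters the third component only; the first two are integrals of a bounded drift.
  This is the time regularity that allows a grid of mesh O(h).\<close>

lemma kinetic_path_lipschitz:
  fixes X :: "real \<Rightarrow> 'd::finite state"
  assumes X: "\<And>u. u \<in> {0..t} \<Longrightarrow> ((\<lambda>s. b (X s)) has_integral (X u - z - (0, 0, \<kappa> *\<^sub>R w u))) {0..u}"
    and C: "\<And>s. s \<in> {0..t} \<Longrightarrow> norm (b (X s)) \<le> C" and uv: "0 \<le> u" "u \<le> v" "v \<le> t"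
  shows "norm (fst (X v) - fst (X u)) \<le> C * (v - u)" "norm (fst (snd (X v)) - fst (snd (X u))) \<le> C * (v - u)"
proof -
  have C0: "C \<ge> 0" using C[of 0] uv order_trans[OF norm_ge_zero] by (metis atLeastAtMost_iff order_refl order_trans)
  define J where "J = X v - X u - ((0, 0, \<kappa> *\<^sub>R w v) - (0, 0, \<kappa> *\<^sub>R w u))"
  have "((\<lambda>s. b (X s)) has_integral J) {u..v}"
    unfolding J_def by (rule has_integral_increment[OF X uv])
  then have "norm J \<le> C * measure lborel {u..v}"
    using C uv C0 by (intro has_integral_bound_real) auto
  then have J: "norm J \<le> C * (v - u)" using uv by simp
  have e: "fst (X v) - fst (X u) = fst J" "fst (snd (X v)) - fst (snd (X u)) = fst (snd J)" by (simp_all add: J_def)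
  show "norm (fst (X v) - fst (X u)) \<le> C * (v - u)"
    unfolding e by (rule order_trans[OF norm_fst_snd_le(1) J])
  show "norm (fst (snd (X v)) - fst (snd (X u))) \<le> C * (v - u)"
    unfolding e by (rule order_trans[OF norm_fst_snd_le(2) J])
qed

text \<open>At \<delta> = 0 only the Brownian motion driving \<open>r\<close> remains, hence the
  single \<open>W\<close>. The condition on the modulus of \<sigma> covers the forward and the
  adjoint dynamics together.\<close>

locale kinetic_solution = prob_space M for M :: "'a measure" +
  fixes W :: "real \<Rightarrow> 'a \<Rightarrow> real ^ 'd::finite" and \<sigma> \<gamma> \<kappa> L :: real and U :: "real ^ 'd \<Rightarrow> real"
    and X :: "real \<Rightarrow> 'a \<Rightarrow> 'd state" and z :: "'d state"
  assumes W: "brownian_motion M W" and \<sigma>: "\<bar>\<sigma>\<bar> = 1" and pos: "\<gamma> > 0" "\<kappa> > 0" "L > 0" and U: "smooth U"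
    and cont: "\<And>\<omega>. \<omega> \<in> space M \<Longrightarrow> continuous_on {0..} (\<lambda>t. X t \<omega>)"
    and eq: "AE \<omega> in M. \<forall>t\<ge>0. ((\<lambda>s. kinetic_drift \<gamma> L \<sigma> (grad U) (X s \<omega>)) has_integral
          (X t \<omega> - z - (0, 0, \<kappa> *\<^sub>R W t \<omega>))) {0..t}"
begin

definition solves :: "'a \<Rightarrow> bool" where
  "solves \<omega> \<longleftrightarrow> (\<forall>t\<ge>0. ((\<lambda>s. kinetic_drift \<gamma> L \<sigma> (grad U) (X s \<omega>)) has_integral
          (X t \<omega> - z - (0, 0, \<kappa> *\<^sub>R W t \<omega>))) {0..t})"

text \<open>The bound on \<open>X\<close> is strict so that Euler endpoints close to
  \<open>X t\<close> satisfy it too. The bound on \<open>W\<close> concerns the path that drives the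
  scheme as well, so a weak inequality is enough.\<close>

definition bounded_by :: "'d \<Rightarrow> real \<Rightarrow> real \<Rightarrow> 'a \<Rightarrow> bool" where
  "bounded_by i R T \<omega> \<longleftrightarrow> (\<forall>t\<in>{0..T}. norm (X t \<omega>) < R \<and> \<bar>W t \<omega> $ i\<bar> \<le> R)"

lemma W0: "\<omega> \<in> space M \<Longrightarrow> W 0 \<omega> = 0"
  using W by (auto simp: brownian_motion_def brownian_motion_1d_def vec_eq_iff)

lemma W_cont: "\<omega> \<in> space M \<Longrightarrow> continuous_on {0..} (\<lambda>t. W t \<omega> $ i)"
  using W by (auto simp: brownian_motion_def brownian_motion_1d_def)

lemma bounded_by_exists:
  assumes \<omega>: "\<omega> \<in> space M"
  obtains n :: nat where "bounded_by i (real n) T \<omega>"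
proof -
  have "compact ((\<lambda>t. X t \<omega>) ` {0..T})" "compact ((\<lambda>t. W t \<omega> $ i) ` {0..T})"
    by (intro compact_continuous_image continuous_on_subset[OF cont[OF \<omega>]] continuous_on_subset[OF W_cont[OF \<omega>]]; auto)+
  then have "bounded ((\<lambda>t. X t \<omega>) ` {0..T})" "bounded ((\<lambda>t. W t \<omega> $ i) ` {0..T})"
    by (auto intro: compact_imp_bounded)
  then obtain a b where ab: "\<forall>x\<in>(\<lambda>t. X t \<omega>) ` {0..T}. norm x \<le> a" "\<forall>x\<in>(\<lambda>t. W t \<omega> $ i) ` {0..T}. norm x \<le> b"
    unfolding bounded_iff by blast
  obtain n where n: "real n > max a b" using reals_Archimedean2 by blast
  have "bounded_by i (real n) T \<omega>"
    unfolding bounded_by_def using ab n by force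
  then show thesis by (rule that)
qed

text \<open>The Euler estimate is uniform in the step size. Openness of \<open>V\<close> and the
  strict inequalities carry over from \<open>X t\<close> to all sufficiently fine schemes, so a path
  in the box lies in all but finitely many Euler events, and \<open>liminf_event\<close> keeps the
  bound. Paths with \<open>bounded_by\<close> do not feel the truncation of the gradient.\<close>

lemma box_cover:
  fixes V :: "'d state set" and \<phi> :: "'d state \<Rightarrow> real" and i :: 'd
  assumes V: "open V" and \<eta>: "\<eta> > 0" and R: "R > 0" and t0: "t\<^sub>0 > 0" "t\<^sub>0 \<le> T" and C: "C \<ge> 0"
    and coercive: "\<And>x y l. \<lbrakk>x \<in> V; y \<in> V; norm x < R; norm y < R\<rbrakk> \<Longrightarrow> \<bar>\<phi> y - \<phi> x\<bar> \<ge> \<eta> * \<bar>l\<bar> -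
           C * (norm (fst y - fst x) + norm (fst (snd y) - fst (snd x) - l *\<^sub>R axis i 1))"
    and \<phi>: "continuous_on UNIV \<phi>"
  obtains K where "K > 0" "\<And>t h \<beta>. \<lbrakk>t\<^sub>0 \<le> t; t \<le> T; 0 < h; h \<le> \<beta>\<rbrakk> \<Longrightarrow> \<exists>F\<in>events. prob F \<le> K * (\<beta> * h) \<and>
     (\<forall>\<omega>\<in>space M. solves \<omega> \<longrightarrow> bounded_by i R T \<omega> \<longrightarrow> X t \<omega> \<in> V \<longrightarrow> \<bar>\<phi> (X t \<omega>)\<bar> < h \<longrightarrow> \<bar>snd (snd (X t \<omega>)) $ i\<bar> < \<beta> \<longrightarrow> \<omega> \<in> F)"
proof -
  obtain \<Lambda> where \<Lambda>: "\<Lambda> \<ge> 0" "\<And>x y. x \<in> cball 0 R \<Longrightarrow> y \<in> cball 0 R \<Longrightarrow> norm (grad U x - grad U y) \<le> \<Lambda> * norm (x - y)"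
    by (rule smooth_grad_lipschitz[OF U, where R = R]) (rule that)
  \<comment> \<open>Truncating only the gradient makes the drift globally Lipschitz but keeps the linear coupling
    between \<open>p\<close> and \<open>r\<close>, on which the sensitivity estimate relies.\<close>
  define G where "G = grad U \<circ> closest_point (cball 0 R)"
  have cb: "cball (0::real ^ 'd) R \<noteq> {}" using R by simp
  have G: "norm (G x - G y) \<le> \<Lambda> * norm (x - y)" for x y
  proof -
    have "norm (G x - G y) \<le> \<Lambda> * norm (closest_point (cball 0 R) x - closest_point (cball 0 R) y)"
      unfolding G_def comp_def by (intro \<Lambda>(2) closest_point_in_set cb closed_cball)
    also have "\<dots> \<le> \<Lambda> * norm (x - y)"
      using closest_point_lipschitz[OF convex_cball closed_cball cb, of x y] \<Lambda>(1)
      by (intro mult_left_mono) (auto simp: dist_norm)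
    finally show ?thesis .
  qed
  have G_eq: "G x = grad U x" if "norm x \<le> R" for x
    using that by (simp add: G_def closest_point_self)
  let ?b = "kinetic_drift \<gamma> L \<sigma> G"
  define \<Lambda>' where "\<Lambda>' = 1 + \<Lambda> * inverse L + 3 * \<gamma>"
  have \<Lambda>': "\<Lambda>' \<ge> 0" using \<Lambda>(1) pos by (simp add: \<Lambda>'_def)
  have b: "norm (?b x - ?b y) \<le> \<Lambda>' * norm (x - y)" for x y
    unfolding \<Lambda>'_def by (intro kinetic_drift_lipschitz \<sigma> pos \<Lambda>(1) G)
  have b_meas: "?b \<in> borel_measurable borel"
  proof (rule borel_measurable_continuous_onI)
    have "\<Lambda>'-lipschitz_on UNIV ?b" using b \<Lambda>' by (intro lipschitz_onI) (auto simp: dist_norm)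
    then show "continuous_on UNIV ?b" by (rule lipschitz_on_continuous_on)
  qed
  define VR where "VR = V \<inter> ball 0 R"
  have VR: "open VR" using V by (auto simp: VR_def)
  have coer: "\<bar>\<phi> y - \<phi> x\<bar> \<ge> \<eta> * \<bar>l\<bar> - C * (norm (fst y - fst x) + norm (fst (snd y) - fst (snd x) - l *\<^sub>R axis i 1))"
    if "x \<in> VR" "y \<in> VR" for x y l
    using that by (intro coercive) (auto simp: VR_def)
  obtain s\<^sub>0 C\<^sub>1 where s0: "s\<^sub>0 > 0" and C1: "C\<^sub>1 > 0" and sep:
    "\<And>q \<tau> h \<beta>. \<lbrakk>q > 0; \<tau> > 0; 2 * real q * \<tau> \<le> s\<^sub>0; 0 < h; h \<le> \<beta>\<rbrakk>
     \<Longrightarrow> euler_separated ?b \<kappa> VR \<phi> i q \<tau> h \<beta> C\<^sub>1"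
    by (rule euler_separation[where V = VR, OF \<sigma> pos \<eta> C \<Lambda>(1) G coer]) (assumption, assumption, rule that)
  \<comment> \<open>The window is the last of \<open>P\<close> equal pieces of the time interval up
    to \<open>t\<close>: short enough for the separation as t \<le> T, and no shorter than
    \<open>s'\<close> as \<open>t\<close> is at least \<open>t\<^sub>0\<close>, which keeps the
    exponential factor bounded.\<close>
  obtain P' :: nat where P': "T / s\<^sub>0 < real P'" using reals_Archimedean2 by blast
  define P where "P = Suc P'"
  have P: "P > 0" "T / real P \<le> s\<^sub>0"
  proof -
    have "T / s\<^sub>0 < real P" using P' by (simp add: P_def)
    then show "T / real P \<le> s\<^sub>0" using s0 by (simp add: P_def field_simps)
  qed (simp add: P_def)
  define s' where "s' = t\<^sub>0 / real P"
  have s': "s' > 0" using t0 P by (simp add: s'_def)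
  define K where "K = exp ((8 * R + 2) / s') * 4 * C\<^sub>1\<^sup>2 / s'"
  have K: "K > 0" using C1 s' by (simp add: K_def)
  have "\<exists>F\<in>events. prob F \<le> K * (\<beta> * h) \<and>
     (\<forall>\<omega>\<in>space M. solves \<omega> \<longrightarrow> bounded_by i R T \<omega> \<longrightarrow> X t \<omega> \<in> V \<longrightarrow> \<bar>\<phi> (X t \<omega>)\<bar> < h \<longrightarrow> \<bar>snd (snd (X t \<omega>)) $ i\<bar> < \<beta> \<longrightarrow> \<omega> \<in> F)"
    if t: "t\<^sub>0 \<le> t" "t \<le> T" and h: "0 < h" "h \<le> \<beta>" for t h \<beta>
  proof -
    have tpos: "t > 0" using t t0 by linarith
    \<comment> \<open>Of these steps the first \<open>2 * q * (P - 1)\<close> are left alone and the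
      last \<open>2 * q\<close> carry the shift. The window length \<open>t / P\<close> does not
      depend on \<open>q\<close>; only the step size shrinks.\<close>
    define n where "n q = 2 * q * (P - 1) + 2 * q" for q
    define \<tau> where "\<tau> q = t / real (n q)" for q
    have n: "n q = 2 * q * P" for q using P by (cases P) (auto simp: n_def)
    define EE where "EE q \<omega> = euler ?b \<kappa> (\<tau> q) z (increments W (\<tau> q) \<omega>) (n q)" for q \<omega>
    define A where "A q = {\<omega>\<in>space M. EE q \<omega> \<in> VR \<and> \<bar>\<phi> (EE q \<omega>)\<bar> \<le> h \<and> \<bar>snd (snd (EE q \<omega>)) $ i\<bar> \<le> \<beta> \<and>
       (\<forall>l\<in>{2 * q * (P - 1), 2 * q * (P - 1) + q, 2 * q * (P - 1) + 2 * q}. \<bar>W (real l * \<tau> q) \<omega> $ i\<bar> \<le> R)}" for q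
    have A: "A q \<in> events" "prob (A q) \<le> K * (\<beta> * h)" if q: "q > 0" for q
    proof -
      have \<tau>: "\<tau> q > 0" using tpos q P by (simp add: \<tau>_def n)
      have s: "2 * real q * \<tau> q = t / real P" using q P by (simp add: \<tau>_def n)
      have s_le: "2 * real q * \<tau> q \<le> s\<^sub>0"
        using P t divide_right_mono[of t T "real P"] by (simp add: s)
      have s_ge: "s' \<le> 2 * real q * \<tau> q" unfolding s s'_def using t P by (intro divide_right_mono) auto
      have meas: "VR \<in> sets borel" "\<phi> \<in> borel_measurable borel"
        using VR \<phi> by (auto intro: borel_measurable_continuous_onI)
      note E = euler_box_probability[OF W \<tau> q b_meas meas C1 h sep[OF q \<tau> s_le h], where z = z and m = "2 * q * (P - 1)" and B = R,
          folded n_def EE_def A_def]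
      show "A q \<in> events" using E(1) by (simp add: A_def EE_def n_def)
      have "prob (A q) \<le> exp ((8 * R + 2) / (2 * real q * \<tau> q)) * 4 * C\<^sub>1\<^sup>2 / (2 * real q * \<tau> q) * (\<beta> * h)"
        using E(2) by (simp add: A_def EE_def n_def)
      also have "\<dots> \<le> K * (\<beta> * h)"
      proof (rule mult_right_mono)
        have "exp ((8 * R + 2) / (2 * real q * \<tau> q)) \<le> exp ((8 * R + 2) / s')"
          using s_ge s' R q \<tau> by (auto intro!: divide_left_mono mult_pos_pos)
        then show "exp ((8 * R + 2) / (2 * real q * \<tau> q)) * 4 * C\<^sub>1\<^sup>2 / (2 * real q * \<tau> q) \<le> K"
          unfolding K_def using s_ge s' by (intro frac_le mult_right_mono mult_nonneg_nonneg) auto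
      qed (use h in simp)
      finally show "prob (A q) \<le> K * (\<beta> * h)" .
    qed
    \<comment> \<open>The index \<open>Suc q\<close> skips the degenerate scheme without
      steps.\<close>
    obtain F where F: "F \<in> events" "prob F \<le> K * (\<beta> * h)" "\<And>\<omega>. \<forall>\<^sub>F q in sequentially. \<omega> \<in> A (Suc q) \<Longrightarrow> \<omega> \<in> F"
      using A by (rule liminf_event[of "\<lambda>q. A (Suc q)" 0]) auto
    have "\<omega> \<in> F" if \<omega>: "\<omega> \<in> space M" "solves \<omega>" "bounded_by i R T \<omega>" "X t \<omega> \<in> V"
       "\<bar>\<phi> (X t \<omega>)\<bar> < h" "\<bar>snd (snd (X t \<omega>)) $ i\<bar> < \<beta>" for \<omega>
    proof (rule F(3))
      have lim: "(\<lambda>n. euler ?b \<kappa> (t / real n) z (\<lambda>k. W (real (Suc k) * (t / real n)) \<omega> - W (real k * (t / real n)) \<omega>) n) \<longlonglongrightarrow> X t \<omega>"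
      proof (rule euler_convergence[OF b \<Lambda>' tpos])
        show "continuous_on {0..t} (\<lambda>t. X t \<omega>)" by (rule continuous_on_subset[OF cont[OF \<omega>(1)]]) auto
        show "W 0 \<omega> = 0" by (rule W0[OF \<omega>(1)])
        fix u assume u: "u \<in> {0..t}"
        have "((\<lambda>s. kinetic_drift \<gamma> L \<sigma> (grad U) (X s \<omega>)) has_integral (X u \<omega> - z - (0, 0, \<kappa> *\<^sub>R W u \<omega>))) {0..u}"
          using \<omega>(2) u by (simp add: solves_def)
        then show "((\<lambda>s. ?b (X s \<omega>)) has_integral (X u \<omega> - z - (0, 0, \<kappa> *\<^sub>R W u \<omega>))) {0..u}"
        proof (rule has_integral_eq[rotated])
          fix s assume "s \<in> {0..u}"
          then have "norm (X s \<omega>) < R" using u t \<omega>(3) by (auto simp: bounded_by_def)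
          then have "norm (fst (X s \<omega>)) \<le> R" using norm_fst_snd_le(1)[of "X s \<omega>"] by linarith
          then show "kinetic_drift \<gamma> L \<sigma> (grad U) (X s \<omega>) = ?b (X s \<omega>)"
            by (simp add: kinetic_drift_def case_prod_beta G_eq)
        qed
      qed
      have "strict_mono (\<lambda>q. n (Suc q))" using P by (auto simp: n strict_mono_def)
      from LIMSEQ_subseq_LIMSEQ[OF lim this]
      have lim': "(\<lambda>q. EE (Suc q) \<omega>) \<longlonglongrightarrow> X t \<omega>"
        by (simp add: EE_def \<tau>_def comp_def increments_def[abs_def])
      have Xt: "X t \<omega> \<in> VR" using \<omega>(3,4) t tpos by (auto simp: VR_def bounded_by_def)
      have 1: "\<forall>\<^sub>F q in sequentially. EE (Suc q) \<omega> \<in> VR"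
        by (rule topological_tendstoD[OF lim' VR Xt])
      have "(\<lambda>q. \<bar>\<phi> (EE (Suc q) \<omega>)\<bar>) \<longlonglongrightarrow> \<bar>\<phi> (X t \<omega>)\<bar>"
        by (intro tendsto_intros continuous_on_tendsto_compose[OF \<phi> lim']) auto
      then have 2: "\<forall>\<^sub>F q in sequentially. \<bar>\<phi> (EE (Suc q) \<omega>)\<bar> < h" using \<omega>(5) by (rule order_tendstoD)
      have "(\<lambda>q. \<bar>snd (snd (EE (Suc q) \<omega>)) $ i\<bar>) \<longlonglongrightarrow> \<bar>snd (snd (X t \<omega>)) $ i\<bar>"
        by (intro tendsto_intros lim')
      then have 3: "\<forall>\<^sub>F q in sequentially. \<bar>snd (snd (EE (Suc q) \<omega>)) $ i\<bar> < \<beta>" using \<omega>(6) by (rule order_tendstoD)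
      have 4: "\<bar>W (real l * \<tau> (Suc q)) \<omega> $ i\<bar> \<le> R" if "l \<le> n (Suc q)" for l q
      proof -
        have "real l * \<tau> (Suc q) \<le> real (n (Suc q)) * \<tau> (Suc q)"
          using that tpos by (intro mult_right_mono) (auto simp: \<tau>_def)
        also have "\<dots> = t"
        proof -
          have "n (Suc q) \<noteq> 0" using P by (simp add: n)
          then show ?thesis by (simp add: \<tau>_def)
        qed
        finally have "real l * \<tau> (Suc q) \<le> T" using t by linarith
        moreover have "0 \<le> real l * \<tau> (Suc q)" using tpos by (simp add: \<tau>_def)
        ultimately show ?thesis using \<omega>(3) by (auto simp: bounded_by_def)
      qed
      show "\<forall>\<^sub>F q in sequentially. \<omega> \<in> A (Suc q)"
        using 1 2 3
      proof eventually_elim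
        case (elim q)
        have "l \<le> n (Suc q)" if "l \<in> {2 * Suc q * (P - 1), 2 * Suc q * (P - 1) + Suc q, 2 * Suc q * (P - 1) + 2 * Suc q}" for l
          using that unfolding n_def by (elim insertE emptyE; simp)
        then have "\<forall>l\<in>{2 * Suc q * (P - 1), 2 * Suc q * (P - 1) + Suc q, 2 * Suc q * (P - 1) + 2 * Suc q}.
            \<bar>W (real l * \<tau> (Suc q)) \<omega> $ i\<bar> \<le> R"
          using 4 by blast
        then show ?case unfolding A_def using elim \<omega>(1) by (blast intro: less_imp_le)
      qed
    qed
    then show ?thesis using F(1,2) by blast
  qed
  then show thesis by (rule that[OF K])
qed

lemma drift_bound:
  obtains C where "C \<ge> 0" "\<And>x. norm x \<le> R \<Longrightarrow> norm (kinetic_drift \<gamma> L \<sigma> (grad U) x) \<le> C"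
proof (cases "R \<ge> 0")
  case True
  obtain \<Lambda> where \<Lambda>: "\<Lambda> \<ge> 0" "\<And>x y. x \<in> cball 0 R \<Longrightarrow> y \<in> cball 0 R \<Longrightarrow> norm (grad U x - grad U y) \<le> \<Lambda> * norm (x - y)"
    by (rule smooth_grad_lipschitz[OF U, where R = R]) (rule that)
  let ?b = "kinetic_drift \<gamma> L \<sigma> (grad U)"
  define C where "C = norm (?b 0) + (1 + \<Lambda> * inverse L + 3 * \<gamma>) * R"
  show thesis
  proof (rule that)
    show "C \<ge> 0" using True \<Lambda>(1) pos by (simp add: C_def)
    fix x :: "'d state" assume x: "norm x \<le> R"
    have "norm (grad U (fst x) - grad U (fst (0 :: 'd state))) \<le> \<Lambda> * norm (fst x - fst (0 :: 'd state))"
      using norm_fst_snd_le(1)[of x] x True by (intro \<Lambda>(2)) auto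
    then have "norm (?b x - ?b 0) \<le> (1 + \<Lambda> * inverse L + 3 * \<gamma>) * norm (x - 0)"
      by (intro kinetic_drift_lipschitz \<sigma> pos \<Lambda>(1))
    also have "\<dots> \<le> (1 + \<Lambda> * inverse L + 3 * \<gamma>) * R"
      using x \<Lambda>(1) pos by (intro mult_left_mono) auto
    finally show "norm (?b x) \<le> C" using norm_triangle_sub[of "?b x" "?b 0"] by (simp add: C_def)
  qed
next
  case False
  then have "\<not> norm x \<le> R" for x :: "'d state" using norm_ge_zero[of x] by linarith
  then show thesis by (intro that[of 0]) auto
qed

text \<open>Discretization in time. If the path is in the bad set at \<open>t\<close>, then at the
  preceding grid time \<phi> is small by the Lipschitz bound and \<open>r\<close> has small
  component \<open>i\<close> by mere continuity. For that reason \<beta> is fixed first and the grid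
  refined afterwards, with a threshold depending on the path; \<open>liminf_event\<close> absorbs
  this dependence.\<close>

lemma avoidance_cover:
  fixes V :: "'d state set" and \<phi> :: "'d state \<Rightarrow> real" and i :: 'd
  assumes V: "open V" and \<eta>: "\<eta> > 0" and R: "R > 0" and t0: "t\<^sub>0 > 0" "t\<^sub>0 \<le> T" and e: "e > 0"
    and coercive: "\<exists>C\<ge>0. \<forall>x y l. x \<in> V \<longrightarrow> y \<in> V \<longrightarrow> norm x < R \<longrightarrow> norm y < R \<longrightarrow> \<bar>\<phi> y - \<phi> x\<bar> \<ge> \<eta> * \<bar>l\<bar> -
           C * (norm (fst y - fst x) + norm (fst (snd y) - fst (snd x) - l *\<^sub>R axis i 1))"
    and \<phi>: "continuous_on UNIV \<phi>"
    and lip: "\<exists>C. \<forall>x y. norm x \<le> R \<longrightarrow> norm y \<le> R \<longrightarrow> \<bar>\<phi> y - \<phi> x\<bar> \<le> C * (norm (fst y - fst x) + norm (fst (snd y) - fst (snd x)))"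
  shows "\<exists>S\<in>events. prob S \<le> e \<and> {\<omega>\<in>space M. solves \<omega> \<and> bounded_by i R T \<omega> \<and>
     (\<exists>t\<in>{t\<^sub>0..T}. X t \<omega> \<in> V \<and> \<phi> (X t \<omega>) = 0 \<and> snd (snd (X t \<omega>)) $ i = 0)} \<subseteq> S"
proof -
  let ?r = "\<lambda>x::'d state. snd (snd x) $ i"
  have T: "T > 0" using t0 by linarith
  obtain C where C: "C \<ge> 0" "\<And>x y l. \<lbrakk>x \<in> V; y \<in> V; norm x < R; norm y < R\<rbrakk> \<Longrightarrow> \<bar>\<phi> y - \<phi> x\<bar> \<ge> \<eta> * \<bar>l\<bar> -
           C * (norm (fst y - fst x) + norm (fst (snd y) - fst (snd x) - l *\<^sub>R axis i 1))"
    using coercive by blast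
  obtain Cl where Cl: "\<And>x y. norm x \<le> R \<Longrightarrow> norm y \<le> R \<Longrightarrow> \<bar>\<phi> y - \<phi> x\<bar> \<le> Cl * (norm (fst y - fst x) + norm (fst (snd y) - fst (snd x)))"
    using lip by blast
  obtain Cb where Cb: "Cb \<ge> 0" "\<And>x. norm x \<le> R \<Longrightarrow> norm (kinetic_drift \<gamma> L \<sigma> (grad U) x) \<le> Cb"
    by (rule drift_bound[where R = R]) (rule that)
  define c where "c = \<bar>Cl\<bar> * (2 * Cb) + 1"
  have c: "c \<ge> 1" using Cb by (simp add: c_def)
  have time_lip: "\<bar>\<phi> (X v \<omega>) - \<phi> (X u \<omega>)\<bar> \<le> c * (v - u)"
    if \<omega>: "solves \<omega>" "bounded_by i R T \<omega>" and uv: "0 \<le> u" "u \<le> v" "v \<le> T" for u v \<omega>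
  proof -
    have R_le: "norm (X s \<omega>) \<le> R" if "s \<in> {0..T}" for s using \<omega>(2) that by (auto simp: bounded_by_def less_imp_le)
    have "norm (fst (X v \<omega>) - fst (X u \<omega>)) \<le> Cb * (v - u)" "norm (fst (snd (X v \<omega>)) - fst (snd (X u \<omega>))) \<le> Cb * (v - u)"
      by (rule kinetic_path_lipschitz[where t = T and b = "kinetic_drift \<gamma> L \<sigma> (grad U)" and z = z and \<kappa> = \<kappa> and w = "\<lambda>t. W t \<omega>"];
          use \<omega>(1) uv Cb(2) R_le in \<open>auto simp: solves_def\<close>)+
    then have "\<bar>Cl\<bar> * (norm (fst (X v \<omega>) - fst (X u \<omega>)) + norm (fst (snd (X v \<omega>)) - fst (snd (X u \<omega>)))) \<le> \<bar>Cl\<bar> * (2 * Cb * (v - u))"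
      by (intro mult_left_mono) auto
    moreover have "\<bar>\<phi> (X v \<omega>) - \<phi> (X u \<omega>)\<bar> \<le> Cl * (norm (fst (X v \<omega>) - fst (X u \<omega>)) + norm (fst (snd (X v \<omega>)) - fst (snd (X u \<omega>))))"
      using uv by (intro Cl R_le) auto
    moreover have "\<dots> \<le> \<bar>Cl\<bar> * (norm (fst (X v \<omega>) - fst (X u \<omega>)) + norm (fst (snd (X v \<omega>)) - fst (snd (X u \<omega>))))"
      by (intro mult_right_mono) auto
    moreover have "\<bar>Cl\<bar> * (2 * Cb * (v - u)) \<le> c * (v - u)" using uv by (simp add: c_def algebra_simps)
    ultimately show ?thesis by linarith
  qed
  \<comment> \<open>The grid time preceding a hit may lie before \<open>t\<^sub>0\<close>, but not
    before half of it once the mesh is small.\<close>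
  have t02: "t\<^sub>0 / 2 > 0" "t\<^sub>0 / 2 \<le> T" using t0 by auto
  obtain K where K: "K > 0" and cover: "\<And>t h \<beta>. \<lbrakk>t\<^sub>0 / 2 \<le> t; t \<le> T; 0 < h; h \<le> \<beta>\<rbrakk> \<Longrightarrow> \<exists>F\<in>events. prob F \<le> K * (\<beta> * h) \<and>
     (\<forall>\<omega>\<in>space M. solves \<omega> \<longrightarrow> bounded_by i R T \<omega> \<longrightarrow> X t \<omega> \<in> V \<longrightarrow> \<bar>\<phi> (X t \<omega>)\<bar> < h \<longrightarrow> \<bar>?r (X t \<omega>)\<bar> < \<beta> \<longrightarrow> \<omega> \<in> F)"
    by (rule box_cover[where V = V and i = i, OF V \<eta> R t02 C(1) C(2) \<phi>]) (assumption, assumption, assumption, assumption, rule that)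
  \<comment> \<open>At most \<open>n + 1 \<le> 2 * n\<close> grid events of probability
    \<open>K * (\<beta> * h n)\<close> add up to \<open>4 * K * c * T * \<beta>\<close>, which is
    set equal to \<open>e\<close>. The 2 in \<open>h n\<close> makes the Lipschitz bound
    \<open>c * T / n\<close> strictly smaller than \<open>h n\<close>.\<close>
  define \<beta> where "\<beta> = e / (4 * K * c * T)"
  have \<beta>: "\<beta> > 0" using e K c T by (simp add: \<beta>_def)
  define h where "h n = 2 * c * T / real n" for n :: nat
  define tt where "tt n j = real j * T / real n" for n j :: nat
  obtain N where N: "2 * c * T / \<beta> < real N" using reals_Archimedean2 by blast
  have "2 * c * T / \<beta> > 0" using c T \<beta> by simp
  then have npos: "real n > 0" if "n \<ge> N" for n using N that by linarith
  have h: "h n > 0" "h n \<le> \<beta>" if "n \<ge> N" for n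
  proof -
    have "2 * c * T / \<beta> < real n" using N that by linarith
    then show "h n > 0" "h n \<le> \<beta>" using npos[OF that] c T \<beta> by (auto simp: h_def field_simps)
  qed
  \<comment> \<open>Empty for small \<open>n\<close>, so that \<open>A n\<close> is an event for
    every \<open>n\<close>, although the covering events are available only from \<open>N\<close>
    on.\<close>
  define J where "J n = (if n \<ge> N then {j. j \<le> n \<and> t\<^sub>0 / 2 \<le> tt n j} else {})" for n
  have J: "finite (J n)" "card (J n) \<le> n + 1" for n
  proof -
    have "J n \<subseteq> {..n}" by (auto simp: J_def)
    then show "finite (J n)" "card (J n) \<le> n + 1" using card_mono[of "{..n}" "J n"] finite_subset by auto
  qed
  have "\<forall>n j. \<exists>F. j \<in> J n \<longrightarrow> F \<in> events \<and> prob F \<le> K * (\<beta> * h n) \<and>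
     (\<forall>\<omega>\<in>space M. solves \<omega> \<longrightarrow> bounded_by i R T \<omega> \<longrightarrow> X (tt n j) \<omega> \<in> V \<longrightarrow> \<bar>\<phi> (X (tt n j) \<omega>)\<bar> < h n \<longrightarrow> \<bar>?r (X (tt n j) \<omega>)\<bar> < \<beta> \<longrightarrow> \<omega> \<in> F)"
  proof (intro allI)
    fix n j
    show "\<exists>F. j \<in> J n \<longrightarrow> F \<in> events \<and> prob F \<le> K * (\<beta> * h n) \<and>
     (\<forall>\<omega>\<in>space M. solves \<omega> \<longrightarrow> bounded_by i R T \<omega> \<longrightarrow> X (tt n j) \<omega> \<in> V \<longrightarrow> \<bar>\<phi> (X (tt n j) \<omega>)\<bar> < h n \<longrightarrow> \<bar>?r (X (tt n j) \<omega>)\<bar> < \<beta> \<longrightarrow> \<omega> \<in> F)"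
    proof (cases "j \<in> J n")
      case True
      then have n: "n \<ge> N" "j \<le> n" "t\<^sub>0 / 2 \<le> tt n j" by (auto simp: J_def split: if_splits)
      have "tt n j \<le> T" using n(2) npos[OF n(1)] T by (simp add: tt_def field_simps)
      from cover[OF n(3) this h[OF n(1)]] show ?thesis by blast
    qed simp
  qed
  then obtain F where F: "\<And>n j. j \<in> J n \<Longrightarrow> F n j \<in> events" "\<And>n j. j \<in> J n \<Longrightarrow> prob (F n j) \<le> K * (\<beta> * h n)"
     and F3: "\<And>n j \<omega>. \<lbrakk>j \<in> J n; \<omega>\<in>space M; solves \<omega>; bounded_by i R T \<omega>; X (tt n j) \<omega> \<in> V;
         \<bar>\<phi> (X (tt n j) \<omega>)\<bar> < h n; \<bar>?r (X (tt n j) \<omega>)\<bar> < \<beta>\<rbrakk> \<Longrightarrow> \<omega> \<in> F n j"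
    by (subst (asm) choice_iff, subst (asm) choice_iff) blast
  define A where "A n = (\<Union>j\<in>J n. F n j)" for n
  have A: "A n \<in> events" for n unfolding A_def using F(1) J(1) by (intro sets.finite_UN) auto
  have "prob (A n) \<le> e" if n: "n \<ge> N" for n
  proof -
    have "prob (A n) \<le> (\<Sum>j\<in>J n. prob (F n j))"
      unfolding A_def using F(1) J(1) by (intro finite_measure_subadditive_finite) auto
    also have "\<dots> \<le> (\<Sum>j\<in>J n. K * (\<beta> * h n))" by (intro sum_mono F(2))
    also have "\<dots> = real (card (J n)) * (K * (\<beta> * h n))" by simp
    also have "\<dots> \<le> (2 * real n) * (K * (\<beta> * h n))"
      using J(2)[of n] npos[OF n] K \<beta> h[OF n] by (intro mult_right_mono) auto
    also have "\<dots> = e" using npos[OF n] K c T by (simp add: h_def \<beta>_def)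
    finally show ?thesis .
  qed
  then obtain S where S: "S \<in> events" "prob S \<le> e" "\<And>\<omega>. \<forall>\<^sub>F n in sequentially. \<omega> \<in> A n \<Longrightarrow> \<omega> \<in> S"
    using A liminf_event[of A N e] by metis
  have "\<omega> \<in> S" if \<omega>: "\<omega> \<in> space M" "solves \<omega>" "bounded_by i R T \<omega>" and t: "t \<in> {t\<^sub>0..T}"
      and hit: "X t \<omega> \<in> V" "\<phi> (X t \<omega>) = 0" "?r (X t \<omega>) = 0" for \<omega> t
  proof (rule S(3))
    have "open (V \<inter> {x. \<bar>?r x\<bar> < \<beta>})"
      by (intro open_Int V open_Collect_less continuous_intros)
    moreover have "X t \<omega> \<in> V \<inter> {x. \<bar>?r x\<bar> < \<beta>}" using hit \<beta> by simp
    moreover have "t \<in> {0..}" using t t0 by auto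
    ultimately obtain B where B: "open B" "t \<in> B" "\<forall>y\<in>{0..}. y \<in> B \<longrightarrow> X y \<omega> \<in> V \<inter> {x. \<bar>?r x\<bar> < \<beta>}"
      using cont[OF \<omega>(1), unfolded continuous_on_topological, rule_format, of t "V \<inter> {x. \<bar>?r x\<bar> < \<beta>}"] by blast
    obtain d where d: "d > 0" "ball t d \<subseteq> B" using B open_contains_ball by blast
    obtain N' where N': "T / min d (t\<^sub>0 / 2) < real N'" using reals_Archimedean2 by blast
    show "\<forall>\<^sub>F n in sequentially. \<omega> \<in> A n"
      unfolding eventually_sequentially
    proof (intro exI[of _ "max N N'"] allI impI)
      fix n assume "n \<ge> max N N'"
      then have n: "n \<ge> N" "n \<ge> N'" by auto
      note np = npos[OF n(1)]
      have "T / min d (t\<^sub>0 / 2) < real n" using N' n by linarith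
      moreover have "min d (t\<^sub>0 / 2) > 0" using d t0 by simp
      ultimately have small: "T / real n < min d (t\<^sub>0 / 2)"
        using np by (simp only: pos_divide_less_eq mult.commute)
      define j where "j = nat \<lfloor>t * real n / T\<rfloor>"
      have "t * real n / T \<ge> 0" using t t0 T by simp
      then have j: "real j \<le> t * real n / T" "t * real n / T < real j + 1" unfolding j_def by linarith+
      have tt1: "tt n j \<le> t" using j(1) np T by (simp add: tt_def field_simps)
      have "t * real n < (real j + 1) * T" using j(2) T by (simp only: pos_divide_less_eq)
      then have "t < (real j + 1) * T / real n" using np by (simp only: pos_less_divide_eq)
      also have "\<dots> = tt n j + T / real n" by (simp add: tt_def ring_distribs add_divide_distrib)
      finally have tt2: "t - tt n j < T / real n" by simp
      have "T / real n < t\<^sub>0 / 2" using small by (simp only: min_less_iff_conj)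
      moreover have "t\<^sub>0 \<le> t" using t by simp
      ultimately have tt0: "t\<^sub>0 / 2 \<le> tt n j" using tt2 by linarith
      have "t * real n / T \<le> T * real n / T" using t T by (intro divide_right_mono mult_right_mono) auto
      then have "real j \<le> real n" using j(1) T by simp
      then have jJ: "j \<in> J n" using tt0 n by (simp add: J_def)
      have "tt n j \<in> B" using d(2) tt1 tt2 small by (auto simp: dist_real_def)
      then have XB: "X (tt n j) \<omega> \<in> V" "\<bar>?r (X (tt n j) \<omega>)\<bar> < \<beta>" using B(3) tt0 t0 by auto
      have "\<bar>\<phi> (X t \<omega>) - \<phi> (X (tt n j) \<omega>)\<bar> \<le> c * (t - tt n j)"
        using \<omega> tt1 tt0 t0 t by (intro time_lip) auto
      also have "\<dots> \<le> c * (T / real n)" using tt2 c by (intro mult_left_mono) auto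
      also have "\<dots> < h n" using c T np by (simp add: h_def divide_strict_right_mono)
      finally have "\<bar>\<phi> (X (tt n j) \<omega>)\<bar> < h n" using hit by simp
      then have "\<omega> \<in> F n j" using jJ \<omega> XB by (intro F3)
      then show "\<omega> \<in> A n" using jJ by (auto simp: A_def)
    qed
  qed
  then show ?thesis using S(1,2) by (intro bexI[of _ S]) auto
qed

lemma avoidance:
  fixes V :: "'d state set" and \<phi> :: "'d state \<Rightarrow> real" and i :: 'd
  assumes V: "open V" and \<eta>: "\<eta> > 0"
    and coercive: "\<And>R. R > 0 \<Longrightarrow> \<exists>C\<ge>0. \<forall>x y l. x \<in> V \<longrightarrow> y \<in> V \<longrightarrow> norm x < R \<longrightarrow> norm y < R \<longrightarrow> \<bar>\<phi> y - \<phi> x\<bar> \<ge> \<eta> * \<bar>l\<bar> -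
           C * (norm (fst y - fst x) + norm (fst (snd y) - fst (snd x) - l *\<^sub>R axis i 1))"
    and \<phi>: "continuous_on UNIV \<phi>"
    and lip: "\<And>R. R > 0 \<Longrightarrow> \<exists>C. \<forall>x y. norm x \<le> R \<longrightarrow> norm y \<le> R \<longrightarrow> \<bar>\<phi> y - \<phi> x\<bar> \<le> C * (norm (fst y - fst x) + norm (fst (snd y) - fst (snd x)))"
  shows "AE \<omega> in M. \<forall>t>0. X t \<omega> \<in> V \<longrightarrow> \<phi> (X t \<omega>) = 0 \<longrightarrow> snd (snd (X t \<omega>)) $ i \<noteq> 0"
proof -
  let ?P = "\<lambda>n k T \<omega>. solves \<omega> \<and> bounded_by i (real (Suc n)) (real (Suc T)) \<omega> \<and>
     (\<exists>t\<in>{inverse (real (Suc k))..real (Suc T)}. X t \<omega> \<in> V \<and> \<phi> (X t \<omega>) = 0 \<and> snd (snd (X t \<omega>)) $ i = 0)"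
  have "AE \<omega> in M. \<not> ?P n k T \<omega>" for n k T
  proof (rule AE_not_if_small_covers)
    fix e :: real assume e: "e > 0"
    have "inverse (real (Suc k)) \<le> 1" by (simp add: field_simps)
    then have "inverse (real (Suc k)) \<le> real (Suc T)" by linarith
    then show "\<exists>S\<in>events. prob S \<le> e \<and> {\<omega>\<in>space M. ?P n k T \<omega>} \<subseteq> S"
      by (intro avoidance_cover[OF V \<eta> _ _ _ e coercive \<phi> lip]) auto
  qed
  then have "AE \<omega> in M. \<forall>n k T. \<not> ?P n k T \<omega>" unfolding AE_all_countable by blast
  moreover have "AE \<omega> in M. solves \<omega>" unfolding solves_def by (rule eq)
  moreover have "AE \<omega> in M. \<omega> \<in> space M" by simp
  ultimately show ?thesis
  proof eventually_elim
    case (elim \<omega>)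
    show ?case
    proof (intro allI impI notI)
      fix t assume t: "t > 0" "X t \<omega> \<in> V" "\<phi> (X t \<omega>) = 0" "snd (snd (X t \<omega>)) $ i = 0"
      obtain k where k: "inverse (real (Suc k)) < t" using reals_Archimedean[OF t(1)] by blast
      obtain T where T: "t < real T" using reals_Archimedean2 by blast
      obtain n where "bounded_by i (real n) (real (Suc T)) \<omega>" by (rule bounded_by_exists[OF elim(3)])
      then have "bounded_by i (real (Suc n)) (real (Suc T)) \<omega>" by (fastforce simp: bounded_by_def)
      then have "?P n k T \<omega>" using elim(2) t k T by (intro conjI bexI[of _ t]) auto
      then show False using elim(1) by blast
    qed
  qed
qed

text \<open>\<phi> is the equation of the sphere with \<open>r = 0\<close> inserted. Being
  quadratic, it has an increment equal to an inner product with the sum of the two points, up to the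
  centre. On the half-space \<open>V s n i\<close> both momenta have component \<open>i\<close> of
  the same sign and of modulus above \<open>1 / (n + 1)\<close>, so the sum stays away from zero;
  without the split by the sign \<open>s\<close> it could cancel.\<close>

lemma sphere_avoidance:
  fixes c :: "real ^ 'd" and \<rho> :: real
  assumes \<rho>: "\<rho> > 0"
  shows "AE \<omega> in M. \<forall>t>0. X t \<omega> \<in> sphere (c, 0, 0) \<rho> \<longrightarrow> snd (snd (X t \<omega>)) \<noteq> 0"
proof -
  define \<phi> :: "'d state \<Rightarrow> real" where "\<phi> x = (norm (fst x - c))\<^sup>2 + (norm (fst (snd x)))\<^sup>2 - \<rho>\<^sup>2" for x
  define V :: "real \<Rightarrow> nat \<Rightarrow> 'd \<Rightarrow> 'd state set" where "V s n i = {x. inverse (real (Suc n)) < s * (fst (snd x) $ i)}" for s n i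
  have \<phi>_diff: "\<phi> y - \<phi> x = (fst y + fst x - 2 *\<^sub>R c) \<bullet> (fst y - fst x) + (fst (snd y) + fst (snd x)) \<bullet> (fst (snd y) - fst (snd x))" for x y
    by (simp add: \<phi>_def power2_norm_eq_inner inner_diff_left inner_diff_right inner_add_left inner_add_right algebra_simps inner_commute)
  have bnd: "norm (fst y + fst x - 2 *\<^sub>R c) \<le> 2 * (R + norm c)" "norm (fst (snd y) + fst (snd x)) \<le> 2 * (R + norm c)"
    if "norm x \<le> R" "norm y \<le> R" for x y :: "'d state" and R
  proof -
    have "norm (fst y + fst x - 2 *\<^sub>R c) \<le> norm (fst y) + norm (fst x) + norm (2 *\<^sub>R c)"
      using norm_triangle_ineq4[of "fst y + fst x" "2 *\<^sub>R c"] norm_triangle_ineq[of "fst y" "fst x"] by linarith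
    then show "norm (fst y + fst x - 2 *\<^sub>R c) \<le> 2 * (R + norm c)"
      using norm_fst_snd_le(1)[of x] norm_fst_snd_le(1)[of y] that by simp
    have "norm (fst (snd y) + fst (snd x)) \<le> norm y + norm x"
      using norm_triangle_ineq[of "fst (snd y)" "fst (snd x)"] norm_fst_snd_le(2)[of x] norm_fst_snd_le(2)[of y] by linarith
    also have "\<dots> \<le> 2 * R" using that by simp
    also have "\<dots> \<le> 2 * (R + norm c)" by simp
    finally show "norm (fst (snd y) + fst (snd x)) \<le> 2 * (R + norm c)" .
  qed
  have \<phi>_cont: "continuous_on UNIV \<phi>" unfolding \<phi>_def[abs_def] by (intro continuous_intros)
  have \<phi>_lip: "\<exists>C. \<forall>x y. norm x \<le> R \<longrightarrow> norm y \<le> R \<longrightarrow> \<bar>\<phi> y - \<phi> x\<bar> \<le> C * (norm (fst y - fst x) + norm (fst (snd y) - fst (snd x)))" for R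
  proof (intro exI[of _ "2 * (R + norm c)"] allI impI)
    fix x y :: "'d state" assume xy: "norm x \<le> R" "norm y \<le> R"
    have "\<bar>\<phi> y - \<phi> x\<bar> \<le> norm (fst y + fst x - 2 *\<^sub>R c) * norm (fst y - fst x) + norm (fst (snd y) + fst (snd x)) * norm (fst (snd y) - fst (snd x))"
      unfolding \<phi>_diff by (intro order_trans[OF abs_triangle_ineq] add_mono Cauchy_Schwarz_ineq2)
    also have "\<dots> \<le> 2 * (R + norm c) * norm (fst y - fst x) + 2 * (R + norm c) * norm (fst (snd y) - fst (snd x))"
      by (intro add_mono mult_right_mono bnd xy) auto
    finally show "\<bar>\<phi> y - \<phi> x\<bar> \<le> 2 * (R + norm c) * (norm (fst y - fst x) + norm (fst (snd y) - fst (snd x)))"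
      by (simp add: algebra_simps)
  qed
  have 1: "AE \<omega> in M. \<forall>t>0. X t \<omega> \<in> V s n i \<longrightarrow> \<phi> (X t \<omega>) = 0 \<longrightarrow> snd (snd (X t \<omega>)) $ i \<noteq> 0"
    if s: "\<bar>s\<bar> = 1" for s n i
  proof (rule avoidance[OF _ _ _ \<phi>_cont \<phi>_lip])
    show "open (V s n i)" unfolding V_def by (intro open_Collect_less continuous_intros)
    show "2 * inverse (real (Suc n)) > 0" by simp
    fix R :: real assume R: "R > 0"
    show "\<exists>C\<ge>0. \<forall>x y l. x \<in> V s n i \<longrightarrow> y \<in> V s n i \<longrightarrow> norm x < R \<longrightarrow> norm y < R \<longrightarrow>
       \<bar>\<phi> y - \<phi> x\<bar> \<ge> 2 * inverse (real (Suc n)) * \<bar>l\<bar> - C * (norm (fst y - fst x) + norm (fst (snd y) - fst (snd x) - l *\<^sub>R axis i 1))"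
    proof (intro exI[of _ "2 * (R + norm c)"] conjI allI impI)
      show "0 \<le> 2 * (R + norm c)" using R by simp
      fix x y :: "'d state" and l :: real
      assume xy: "x \<in> V s n i" "y \<in> V s n i" "norm x < R" "norm y < R"
      define p where "p = fst (snd y) + fst (snd x)"
      define d where "d = fst (snd y) - fst (snd x) - l *\<^sub>R axis i 1"
      have "2 * inverse (real (Suc n)) \<le> s * p $ i" using xy by (simp add: V_def p_def algebra_simps)
      also have "\<dots> \<le> \<bar>p $ i\<bar>" using s abs_ge_self[of "s * p $ i"] by (simp add: abs_mult)
      finally have "2 * inverse (real (Suc n)) * \<bar>l\<bar> \<le> \<bar>p $ i\<bar> * \<bar>l\<bar>" by (intro mult_right_mono) auto
      moreover have "\<phi> y - \<phi> x = p $ i * l + ((fst y + fst x - 2 *\<^sub>R c) \<bullet> (fst y - fst x) + p \<bullet> d)"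
        unfolding \<phi>_diff by (simp add: p_def d_def inner_diff_right inner_axis algebra_simps)
      moreover have "\<bar>(fst y + fst x - 2 *\<^sub>R c) \<bullet> (fst y - fst x) + p \<bullet> d\<bar> \<le> norm (fst y + fst x - 2 *\<^sub>R c) * norm (fst y - fst x) + norm p * norm d"
        by (intro order_trans[OF abs_triangle_ineq] add_mono Cauchy_Schwarz_ineq2)
      moreover have "\<dots> \<le> 2 * (R + norm c) * norm (fst y - fst x) + 2 * (R + norm c) * norm d"
        unfolding p_def using xy by (intro add_mono mult_right_mono bnd) auto
      moreover have "\<bar>p $ i * l\<bar> = \<bar>p $ i\<bar> * \<bar>l\<bar>" by (rule abs_mult)
      ultimately show "\<bar>\<phi> y - \<phi> x\<bar> \<ge> 2 * inverse (real (Suc n)) * \<bar>l\<bar> - 2 * (R + norm c) * (norm (fst y - fst x) + norm (fst (snd y) - fst (snd x) - l *\<^sub>R axis i 1))"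
        unfolding d_def[symmetric] distrib_left by linarith
    qed
  qed
  \<comment> \<open>Near vanishing component \<open>i\<close> of \<open>p\<close> the sphere
    equation degenerates in that direction, but the component itself is then an admissible \<phi>,
    coercive on the whole space.\<close>
  have 2: "AE \<omega> in M. \<forall>t>0. X t \<omega> \<in> UNIV \<longrightarrow> fst (snd (X t \<omega>)) $ i = 0 \<longrightarrow> snd (snd (X t \<omega>)) $ i \<noteq> 0" for i
  proof (rule avoidance[where V = UNIV and \<eta> = 1 and \<phi> = "\<lambda>x. fst (snd x) $ i"])
    show "continuous_on UNIV (\<lambda>x::'d state. fst (snd x) $ i)" by (intro continuous_intros)
    fix R :: real
    show "\<exists>C\<ge>0. \<forall>x y l. x \<in> (UNIV :: 'd state set) \<longrightarrow> y \<in> (UNIV :: 'd state set) \<longrightarrow> norm x < R \<longrightarrow> norm y < R \<longrightarrow>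
       \<bar>fst (snd y) $ i - fst (snd x) $ i\<bar> \<ge> 1 * \<bar>l\<bar> - C * (norm (fst y - fst x) + norm (fst (snd y) - fst (snd x) - l *\<^sub>R axis i 1))"
    proof (intro exI[of _ 1] conjI allI impI)
      fix x y :: "'d state" and l :: real
      have "\<bar>(fst (snd y) - fst (snd x) - l *\<^sub>R axis i 1) $ i\<bar> \<le> norm (fst (snd y) - fst (snd x) - l *\<^sub>R axis i 1)"
        by (rule component_le_norm_cart)
      then have "\<bar>fst (snd y) $ i - fst (snd x) $ i - l\<bar> \<le> norm (fst (snd y) - fst (snd x) - l *\<^sub>R axis i 1)"
        by (simp add: axis_def)
      moreover have "\<bar>l\<bar> \<le> \<bar>fst (snd y) $ i - fst (snd x) $ i\<bar> + \<bar>fst (snd y) $ i - fst (snd x) $ i - l\<bar>"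
        by linarith
      ultimately show "\<bar>fst (snd y) $ i - fst (snd x) $ i\<bar> \<ge> 1 * \<bar>l\<bar> - 1 * (norm (fst y - fst x) + norm (fst (snd y) - fst (snd x) - l *\<^sub>R axis i 1))"
        using norm_ge_zero[of "fst y - fst x"] unfolding mult_1 by linarith
    qed simp
    show "\<exists>C. \<forall>(x :: 'd state) (y :: 'd state). norm x \<le> R \<longrightarrow> norm y \<le> R \<longrightarrow> \<bar>fst (snd y) $ i - fst (snd x) $ i\<bar> \<le> C * (norm (fst y - fst x) + norm (fst (snd y) - fst (snd x)))"
    proof (intro exI[of _ 1] allI impI)
      fix x y :: "'d state"
      show "\<bar>fst (snd y) $ i - fst (snd x) $ i\<bar> \<le> 1 * (norm (fst y - fst x) + norm (fst (snd y) - fst (snd x)))"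
        using component_le_norm_cart[of "fst (snd y) - fst (snd x)" i] by (simp add: add_increasing)
    qed
  qed simp_all
  have 3: "AE \<omega> in M. \<forall>n i. \<forall>t>0. X t \<omega> \<in> V s n i \<longrightarrow> \<phi> (X t \<omega>) = 0 \<longrightarrow> snd (snd (X t \<omega>)) $ i \<noteq> 0"
    if s: "\<bar>s\<bar> = 1" for s
    using 1[OF s] by (simp add: AE_all_countable)
  have 4: "AE \<omega> in M. \<forall>i. \<forall>t>0. fst (snd (X t \<omega>)) $ i = 0 \<longrightarrow> snd (snd (X t \<omega>)) $ i \<noteq> 0"
    using 2 by (simp add: AE_all_countable)
  have "\<bar>1::real\<bar> = 1" "\<bar>-1::real\<bar> = 1" by auto
  from 3[OF this(1)] 3[OF this(2)] 4 show ?thesis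
  proof eventually_elim
    case (elim \<omega>)
    show ?case
    proof (intro allI impI notI)
      fix t assume t: "t > 0" "X t \<omega> \<in> sphere (c, 0, 0) \<rho>" "snd (snd (X t \<omega>)) = 0"
      obtain \<theta> p r where x: "X t \<omega> = (\<theta>, p, r)" by (metis prod.collapse)
      have r: "r = 0" using t(3) x by simp
      have "sqrt ((norm (\<theta> - c))\<^sup>2 + (norm p)\<^sup>2) = \<rho>"
        using t(2) by (simp add: x r dist_norm norm_Pair norm_minus_commute)
      then have "(norm (\<theta> - c))\<^sup>2 + (norm p)\<^sup>2 = \<rho>\<^sup>2"
        by (metis real_sqrt_pow2 add_nonneg_nonneg zero_le_power2)
      then have \<phi>0: "\<phi> (X t \<omega>) = 0" by (simp add: \<phi>_def x)
      \<comment> \<open>Any index will do: component \<open>i\<close> of \<open>p\<close> and of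
        \<open>r\<close> never vanish together, so \<open>r = 0\<close> already forces
        \<open>p $ i\<close> to be nonzero.\<close>
      obtain i :: 'd where True by simp
      have "p $ i \<noteq> 0"
      proof
        assume "p $ i = 0"
        then have "fst (snd (X t \<omega>)) $ i = 0" by (simp add: x)
        then have "snd (snd (X t \<omega>)) $ i \<noteq> 0" using elim(3) t(1) by blast
        then show False using t(3) by simp
      qed
      then obtain n where n: "inverse (real (Suc n)) < \<bar>p $ i\<bar>" using reals_Archimedean[of "\<bar>p $ i\<bar>"] by auto
      show False
      proof (cases "p $ i > 0")
        case True
        then have "X t \<omega> \<in> V 1 n i" using n by (simp add: V_def x)
        then have "snd (snd (X t \<omega>)) $ i \<noteq> 0" using elim(1) t(1) \<phi>0 by blast
        then show False using t(3) by simp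
      next
        case False
        then have "X t \<omega> \<in> V (-1) n i" using n by (simp add: V_def x)
        then have "snd (snd (X t \<omega>)) $ i \<noteq> 0" using elim(2) t(1) \<phi>0 by blast
        then show False using t(3) by simp
      qed
    qed
  qed
qed

end

section \<open>Hitting probabilities\<close>

text \<open>The first hitting time is not a continuous function of the path. What is retained is
  only some time in the interval at which the path lies in \<open>E\<close> with small
  \<open>r\<close>, a property that passes to uniform limits.\<close>

lemma hit_with_small_rD:
  fixes X :: "real \<Rightarrow> 'w \<Rightarrow> 'd::finite state"
  assumes hit: "\<omega> \<in> hit_with_small_r \<mu> X E b M" and E: "closed E"
    and cont: "continuous_on {0..} (\<lambda>t. X t \<omega>)"
  obtains t where "0 \<le> t" "t \<le> M" "X t \<omega> \<in> E" "norm (snd (snd (X t \<omega>))) \<le> b"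
proof -
  define S where "S = {t. 0 \<le> t \<and> X t \<omega> \<in> E}"
  have ht: "hitting_time X E \<omega> = Inf (ereal ` S)"
    by (auto simp: hitting_time_def S_def intro: arg_cong[where f = Inf])
  have le: "hitting_time X E \<omega> \<le> ereal M" using hit by (simp add: hit_with_small_r_def)
  have "S \<noteq> {}"
  proof
    assume "S = {}"
    then have "hitting_time X E \<omega> = \<infinity>" unfolding ht by (simp add: top_ereal_def)
    then show False using le by simp
  qed
  moreover have bdd: "bdd_below S" by (auto simp: S_def bdd_below_def)
  moreover have "closed S"
  proof -
    have "S = {0..} \<inter> (\<lambda>t. X t \<omega>) -` E" by (auto simp: S_def)
    then show ?thesis using continuous_closed_preimage[OF cont closed_atLeast E] by simp
  qed
  ultimately have t: "Inf S \<in> S" by (rule closed_contains_Inf)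
  have eq: "hitting_time X E \<omega> = ereal (Inf S)"
    unfolding ht
  proof (rule antisym)
    show "Inf (ereal ` S) \<le> ereal (Inf S)" using t by (intro Inf_lower imageI)
    show "ereal (Inf S) \<le> Inf (ereal ` S)" using cInf_lower[OF _ bdd] by (intro Inf_greatest) auto
  qed
  show thesis
  proof (rule that[of "Inf S"])
    show "0 \<le> Inf S" "X (Inf S) \<omega> \<in> E" using t by (auto simp: S_def)
    show "Inf S \<le> M" using le by (simp add: eq)
    show "norm (snd (snd (X (Inf S) \<omega>))) \<le> b"
      using hit by (simp add: hit_with_small_r_def eq case_prod_beta)
  qed
qed

text \<open>The hitting times have an accumulation point by compactness of the time interval;
  uniform convergence and continuity of the limit path identify the limit of the positions.\<close>

lemma uniform_limit_hit:
  fixes X :: "real \<Rightarrow> 'd::finite state" and Y :: "nat \<Rightarrow> real \<Rightarrow> 'd state"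
  assumes lim: "uniform_limit {0..M} Y X sequentially" and cont: "continuous_on {0..M} X"
    and E: "closed E" and b: "b \<longlonglongrightarrow> 0"
    and freq: "\<exists>\<^sub>F n in sequentially. \<exists>t\<in>{0..M}. Y n t \<in> E \<and> norm (snd (snd (Y n t))) \<le> b n"
  shows "\<exists>t\<in>{0..M}. X t \<in> E \<and> snd (snd (X t)) = 0"
proof -
  let ?P = "\<lambda>n. \<exists>t\<in>{0..M}. Y n t \<in> E \<and> norm (snd (snd (Y n t))) \<le> b n"
  have "infinite {n. ?P n}" using freq by (simp add: cofinite_eq_sequentially[symmetric] frequently_cofinite)
  from infinite_enumerate[OF this] obtain r :: "nat \<Rightarrow> nat" where r: "strict_mono r" "\<forall>n. r n \<in> {n. ?P n}"
    by blast
  then have "\<forall>n. \<exists>t. t \<in> {0..M} \<and> Y (r n) t \<in> E \<and> norm (snd (snd (Y (r n) t))) \<le> b (r n)" by blast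
  from choice[OF this] obtain t where t: "\<And>n. t n \<in> {0..M}" "\<And>n. Y (r n) (t n) \<in> E"
    "\<And>n. norm (snd (snd (Y (r n) (t n)))) \<le> b (r n)"
    by blast
  have "seq_compact {0..M}" by (intro compact_imp_seq_compact compact_Icc)
  from seq_compactE[OF this, of t] t(1) obtain l q where l: "l \<in> {0..M}" and q: "strict_mono q" "(t \<circ> q) \<longlonglongrightarrow> l"
    by blast
  have rq: "strict_mono (r \<circ> q)" using r(1) q(1) by (rule strict_mono_o)
  have Xt: "(\<lambda>n. X (t (q n))) \<longlonglongrightarrow> X l"
    using continuous_on_tendsto_compose[OF cont q(2) l] t(1) by (simp add: comp_def)
  have "(\<lambda>n. Y (r (q n)) (t (q n)) - X (t (q n))) \<longlonglongrightarrow> 0"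
  proof (rule tendstoI)
    fix e :: real assume "e > 0"
    then have "\<forall>\<^sub>F n in sequentially. \<forall>s\<in>{0..M}. dist (Y n s) (X s) < e"
      using uniform_limitD[OF lim] by blast
    then have "\<forall>\<^sub>F n in sequentially. \<forall>s\<in>{0..M}. dist (Y ((r \<circ> q) n) s) (X s) < e"
      by (rule eventually_subseq[OF rq])
    then show "\<forall>\<^sub>F n in sequentially. dist (Y (r (q n)) (t (q n)) - X (t (q n))) 0 < e"
      by eventually_elim (use t(1) in \<open>auto simp: dist_norm\<close>)
  qed
  from tendsto_add[OF this Xt] have Yt: "(\<lambda>n. Y (r (q n)) (t (q n))) \<longlonglongrightarrow> X l" by simp
  have "X l \<in> E" using closed_sequentially[OF E _ Yt] t(2) by blast
  moreover have "norm (snd (snd (X l))) \<le> 0"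
  proof (rule LIMSEQ_le)
    show "(\<lambda>n. norm (snd (snd (Y (r (q n)) (t (q n)))))) \<longlonglongrightarrow> norm (snd (snd (X l)))"
      by (intro tendsto_intros Yt)
    show "(\<lambda>n. b (r (q n))) \<longlonglongrightarrow> 0" using LIMSEQ_subseq_LIMSEQ[OF b rq] by (simp add: comp_def)
    show "\<exists>N. \<forall>n\<ge>N. norm (snd (snd (Y (r (q n)) (t (q n))))) \<le> b (r (q n))" using t(3) by blast
  qed
  ultimately show ?thesis using l by auto
qed

section \<open>Pathwise dependence on \<delta> and on the starting point\<close>

lemma drift_stability:
  fixes U :: "real ^ 'd::finite \<Rightarrow> real"
  assumes U: "smooth U" and \<sigma>: "\<bar>\<sigma>\<bar> = 1" and pos: "\<gamma> > 0" "L > 0"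
  shows "\<exists>\<Lambda>. \<forall>x\<in>cball 0 R. \<forall>y\<in>cball 0 R. norm (drift \<gamma> L U 0 \<sigma> x - drift \<gamma> L U 0 \<sigma> y) \<le> \<Lambda> * norm (x - y)"
    and "\<exists>C. \<forall>\<delta>\<ge>0. \<forall>x\<in>cball 0 R. norm (drift \<gamma> L U \<delta> \<sigma> x - drift \<gamma> L U 0 \<sigma> x) \<le> C * \<delta>"
proof -
  obtain \<Lambda> where \<Lambda>: "\<Lambda> \<ge> 0" "\<And>x y. x \<in> cball 0 R \<Longrightarrow> y \<in> cball 0 R \<Longrightarrow> norm (grad U x - grad U y) \<le> \<Lambda> * norm (x - y)"
    by (rule smooth_grad_lipschitz[OF U, where R = R]) (rule that)
  have in_ball: "fst x \<in> cball 0 R" if "x \<in> cball 0 R" for x :: "'d state"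
    using norm_fst_snd_le(1)[of x] that by simp
  show "\<exists>\<Lambda>. \<forall>x\<in>cball 0 R. \<forall>y\<in>cball 0 R. norm (drift \<gamma> L U 0 \<sigma> x - drift \<gamma> L U 0 \<sigma> y) \<le> \<Lambda> * norm (x - y)"
    unfolding drift_0
    by (intro exI[of _ "1 + \<Lambda> * inverse L + 3 * \<gamma>"] ballI kinetic_drift_lipschitz[OF \<sigma> pos \<Lambda>(1)] \<Lambda>(2) in_ball)
  show "\<exists>C. \<forall>\<delta>\<ge>0. \<forall>x\<in>cball 0 R. norm (drift \<gamma> L U \<delta> \<sigma> x - drift \<gamma> L U 0 \<sigma> x) \<le> C * \<delta>"
  proof (intro exI[of _ "norm (grad U 0) + \<Lambda> * R + L * R"] allI impI ballI)
    fix \<delta> :: real and x :: "'d state" assume \<delta>: "\<delta> \<ge> 0" and x: "x \<in> cball 0 R"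
    have R: "norm x \<le> R" using x by simp
    then have R0: "0 \<le> R" using norm_ge_zero order_trans by blast
    have "drift \<gamma> L U \<delta> \<sigma> x - drift \<gamma> L U 0 \<sigma> x = (- \<delta> *\<^sub>R grad U (fst x), - (\<delta> * L) *\<^sub>R fst (snd x), 0)"
      by (simp add: drift_def case_prod_beta)
    also have "norm \<dots> \<le> norm (- \<delta> *\<^sub>R grad U (fst x)) + norm (- (\<delta> * L) *\<^sub>R fst (snd x)) + norm (0 :: real ^ 'd)"
      by (rule norm_triple_le)
    also have "\<dots> = \<delta> * (norm (grad U (fst x)) + L * norm (fst (snd x)))"
      using \<delta> pos by (simp add: abs_mult algebra_simps)
    also have "\<dots> \<le> \<delta> * (norm (grad U 0) + \<Lambda> * R + L * R)"
    proof (intro mult_left_mono add_mono \<delta>)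
      have "norm (grad U (fst x) - grad U 0) \<le> \<Lambda> * norm (fst x - 0)"
        using R0 by (intro \<Lambda>(2) in_ball x) auto
      also have "\<dots> \<le> \<Lambda> * R" using norm_fst_snd_le(1)[of x] R by (intro mult_left_mono \<Lambda>(1)) auto
      finally show "norm (grad U (fst x)) \<le> norm (grad U 0) + \<Lambda> * R"
        using norm_triangle_sub[of "grad U (fst x)" "grad U 0"] by linarith
      show "norm (fst (snd x)) \<le> R" using norm_fst_snd_le(2)[of x] R by linarith
    qed (use pos in simp)
    finally show "norm (drift \<gamma> L U \<delta> \<sigma> x - drift \<gamma> L U 0 \<sigma> x) \<le> (norm (grad U 0) + \<Lambda> * R + L * R) * \<delta>"
      by (simp add: mult.commute)
  qed
qed

text \<open>Uniform convergence over \<open>K\<close> is tested along arbitrary sequences of points.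
  This turns the supremum into a sequential statement to which compactness of \<open>K\<close>
  applies.\<close>

lemma SUP_tendsto_at_right_0:
  fixes f :: "real \<Rightarrow> 'z \<Rightarrow> ennreal"
  assumes f: "\<And>x z. \<lbrakk>\<And>n. x n > 0; x \<longlonglongrightarrow> 0; \<And>n. z n \<in> K\<rbrakk> \<Longrightarrow> (\<lambda>n. f (x n) (z n)) \<longlonglongrightarrow> 0"
  shows "((\<lambda>x. SUP z\<in>K. f x z) \<longlongrightarrow> 0) (at_right 0)"
proof (cases "K = {}")
  case True then show ?thesis by (simp add: bot_ennreal)
next
  case False
  then obtain z\<^sub>0 where z0: "z\<^sub>0 \<in> K" by blast
  show ?thesis
    unfolding tendsto_at_iff_sequentially
  proof (intro allI impI)
    fix x :: "nat \<Rightarrow> real" assume x: "\<forall>i. x i \<in> {0<..} - {0}" "x \<longlonglongrightarrow> 0"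
    show "((\<lambda>x. SUP z\<in>K. f x z) \<circ> x) \<longlonglongrightarrow> 0"
    proof (rule order_tendstoI)
      fix e :: ennreal assume "0 < e"
      then obtain e' where e': "0 < e'" "e' < e" using dense by blast
      \<comment> \<open>A point violating the bound \<open>e'\<close>, whenever there is one. The
        room between \<open>e'\<close> and \<open>e\<close> is needed because a supremum of values
        at most \<open>e'\<close> may equal \<open>e'\<close>.\<close>
      define z where "z n = (if \<exists>z\<in>K. e' < f (x n) z then SOME z. z \<in> K \<and> e' < f (x n) z else z\<^sub>0)" for n
      have z: "z n \<in> K \<and> ((\<exists>z\<in>K. e' < f (x n) z) \<longrightarrow> e' < f (x n) (z n))" for n
      proof (cases "\<exists>z\<in>K. e' < f (x n) z")
        case True
        then have "\<exists>z. z \<in> K \<and> e' < f (x n) z" by blast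
        from someI_ex[OF this] show ?thesis using True by (simp add: z_def)
      qed (simp add: z_def z0)
      have "(\<lambda>n. f (x n) (z n)) \<longlonglongrightarrow> 0" using x z by (intro f) auto
      then have "\<forall>\<^sub>F n in sequentially. f (x n) (z n) < e'" using e'(1) by (rule order_tendstoD)
      then show "\<forall>\<^sub>F n in sequentially. ((\<lambda>x. SUP z\<in>K. f x z) \<circ> x) n < e"
      proof eventually_elim
        case (elim n)
        then have "\<not> (\<exists>z\<in>K. e' < f (x n) z)" using z[of n] by (meson less_asym)
        then have "(SUP z\<in>K. f (x n) z) \<le> e'" by (intro SUP_least) (auto simp: not_less)
        then show ?case using e'(2) by (simp add: order_le_less_trans)
      qed
    qed simp
  qed
qed

lemma continuous_norm_bounded:
  fixes f :: "real \<Rightarrow> 'v::real_normed_vector"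
  assumes "continuous_on {0..} f"
  obtains B where "\<And>t. t \<in> {0..M} \<Longrightarrow> norm (f t) \<le> B"
proof -
  have "bounded (f ` {0..M})"
    by (intro compact_imp_bounded compact_continuous_image continuous_on_subset[OF assms] compact_Icc) auto
  then obtain B where "\<forall>x\<in>f ` {0..M}. norm x \<le> B" unfolding bounded_iff by blast
  then show thesis by (intro that[of B]) auto
qed

lemma brownian_motion_continuous:
  assumes "brownian_motion \<mu> W" "\<omega> \<in> space \<mu>"
  shows "continuous_on {0..} (\<lambda>t. W t \<omega>)"
proof -
  have "continuous_on {0..} (\<lambda>t. \<chi> i. W t \<omega> $ i)"
    using assms by (intro continuous_on_vec_lambda) (auto simp: brownian_motion_def brownian_motion_1d_def)
  then show ?thesis by simp
qed

definition solves_sde where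
  "solves_sde \<gamma> L \<epsilon> U W\<^sub>\<theta> W\<^sub>p W\<^sub>r \<delta> \<sigma> z X \<omega> \<longleftrightarrow> (\<forall>t\<ge>0.
       ((\<lambda>s. drift \<gamma> L U \<delta> \<sigma> (X s \<omega>)) has_integral
          (X t \<omega> - z - noise \<gamma> L \<epsilon> W\<^sub>\<theta> W\<^sub>p W\<^sub>r \<delta> t \<omega>)) {0..t})"

text \<open>All processes are driven by the same paths. The noise of \<open>r\<close> does not
  depend on \<delta> and cancels; what remains of the noise difference is of order
  \<open>sqrt \<delta>\<close>, uniformly on the compact time interval.\<close>

lemma sde_uniform_limit:
  fixes U :: "real ^ 'd::finite \<Rightarrow> real" and Y :: "nat \<Rightarrow> real \<Rightarrow> 'w \<Rightarrow> 'd state"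
  assumes pos: "\<gamma> > 0" "L > 0" "\<epsilon> > 0" and U: "smooth U" and \<sigma>: "\<bar>\<sigma>\<bar> = 1" and M: "M \<ge> 0"
    and W: "continuous_on {0..} (\<lambda>t. W\<^sub>\<theta> t \<omega>)" "continuous_on {0..} (\<lambda>t. W\<^sub>p t \<omega>)"
    and X: "solves_sde \<gamma> L \<epsilon> U W\<^sub>\<theta> W\<^sub>p W\<^sub>r 0 \<sigma> z X \<omega>" "continuous_on {0..} (\<lambda>t. X t \<omega>)"
    and Y: "\<And>n. solves_sde \<gamma> L \<epsilon> U W\<^sub>\<theta> W\<^sub>p W\<^sub>r (\<delta> n) \<sigma> (y n) (Y n) \<omega>" "\<And>n. continuous_on {0..} (\<lambda>t. Y n t \<omega>)"
    and \<delta>: "\<And>n. \<delta> n \<ge> 0" "\<delta> \<longlonglongrightarrow> 0" and y: "y \<longlonglongrightarrow> z"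
  shows "uniform_limit {0..M} (\<lambda>n t. Y n t \<omega>) (\<lambda>t. X t \<omega>) sequentially"
proof -
  obtain B\<^sub>1 where B1: "\<And>t. t \<in> {0..M} \<Longrightarrow> norm (W\<^sub>\<theta> t \<omega>) \<le> B\<^sub>1"
    by (rule continuous_norm_bounded[OF W(1)]) (rule that)
  obtain B\<^sub>2 where B2: "\<And>t. t \<in> {0..M} \<Longrightarrow> norm (W\<^sub>p t \<omega>) \<le> B\<^sub>2"
    by (rule continuous_norm_bounded[OF W(2)]) (rule that)
  let ?\<nu> = "\<lambda>n. sqrt (2 * \<epsilon> * \<delta> n) * (B\<^sub>1 + B\<^sub>2)"
  show ?thesis
  proof (rule integral_equation_stability[where b = "drift \<gamma> L U 0 \<sigma>" and b\<^sub>n = "\<lambda>n. drift \<gamma> L U (\<delta> n) \<sigma>"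
      and f = "\<lambda>t. noise \<gamma> L \<epsilon> W\<^sub>\<theta> W\<^sub>p W\<^sub>r 0 t \<omega>" and g = "\<lambda>n t. noise \<gamma> L \<epsilon> W\<^sub>\<theta> W\<^sub>p W\<^sub>r (\<delta> n) t \<omega>"
      and \<delta> = \<delta> and \<nu> = ?\<nu> and y\<^sub>0 = y and x\<^sub>0 = z])
    show "continuous_on {0..M} (\<lambda>t. X t \<omega>)" by (rule continuous_on_subset[OF X(2)]) auto
    show "continuous_on {0..M} (\<lambda>t. Y n t \<omega>)" for n by (rule continuous_on_subset[OF Y(2)]) auto
    show "((\<lambda>s. drift \<gamma> L U 0 \<sigma> (X s \<omega>)) has_integral X t \<omega> - z - noise \<gamma> L \<epsilon> W\<^sub>\<theta> W\<^sub>p W\<^sub>r 0 t \<omega>) {0..t}"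
      if "t \<in> {0..M}" for t using X(1) that by (simp add: solves_sde_def)
    show "((\<lambda>s. drift \<gamma> L U (\<delta> n) \<sigma> (Y n s \<omega>)) has_integral Y n t \<omega> - y n - noise \<gamma> L \<epsilon> W\<^sub>\<theta> W\<^sub>p W\<^sub>r (\<delta> n) t \<omega>) {0..t}"
      if "t \<in> {0..M}" for n t using Y(1) that by (simp add: solves_sde_def)
    show "\<exists>\<Lambda>. \<forall>x\<in>cball 0 R. \<forall>y\<in>cball 0 R. norm (drift \<gamma> L U 0 \<sigma> x - drift \<gamma> L U 0 \<sigma> y) \<le> \<Lambda> * norm (x - y)" for R
      by (rule drift_stability(1)[OF U \<sigma> pos(1,2)])
    show "\<exists>C. \<forall>n. \<forall>x\<in>cball 0 R. norm (drift \<gamma> L U (\<delta> n) \<sigma> x - drift \<gamma> L U 0 \<sigma> x) \<le> C * \<delta> n" for R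
      using drift_stability(2)[OF U \<sigma> pos(1,2), of R] \<delta>(1) by meson
    show "norm (noise \<gamma> L \<epsilon> W\<^sub>\<theta> W\<^sub>p W\<^sub>r (\<delta> n) t \<omega> - noise \<gamma> L \<epsilon> W\<^sub>\<theta> W\<^sub>p W\<^sub>r 0 t \<omega>) \<le> ?\<nu> n" if "t \<in> {0..M}" for n t
    proof -
      have "noise \<gamma> L \<epsilon> W\<^sub>\<theta> W\<^sub>p W\<^sub>r (\<delta> n) t \<omega> - noise \<gamma> L \<epsilon> W\<^sub>\<theta> W\<^sub>p W\<^sub>r 0 t \<omega>
          = (sqrt (2 * \<epsilon> * \<delta> n) *\<^sub>R W\<^sub>\<theta> t \<omega>, sqrt (2 * \<epsilon> * \<delta> n) *\<^sub>R W\<^sub>p t \<omega>, 0)"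
        by (simp add: noise_def)
      also have "norm \<dots> \<le> norm (sqrt (2 * \<epsilon> * \<delta> n) *\<^sub>R W\<^sub>\<theta> t \<omega>) + norm (sqrt (2 * \<epsilon> * \<delta> n) *\<^sub>R W\<^sub>p t \<omega>) + norm (0 :: real ^ 'd)"
        by (rule norm_triple_le)
      also have "\<dots> = sqrt (2 * \<epsilon> * \<delta> n) * (norm (W\<^sub>\<theta> t \<omega>) + norm (W\<^sub>p t \<omega>))"
        using pos \<delta>(1)[of n] by (simp add: distrib_left)
      also have "\<dots> \<le> ?\<nu> n" using B1[OF that] B2[OF that] pos \<delta>(1)[of n] by (intro mult_left_mono add_mono) auto
      finally show ?thesis .
    qed
    have "?\<nu> \<longlonglongrightarrow> sqrt (2 * \<epsilon> * 0) * (B\<^sub>1 + B\<^sub>2)" by (intro tendsto_intros \<delta>)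
    then show "?\<nu> \<longlonglongrightarrow> 0" by simp
  qed (use M y \<delta> in auto)
qed

section \<open>From almost sure statements to probabilities\<close>

lemma (in prob_space) emeasure_not_ge_if_AE_finitely_often:
  fixes e :: ennreal
  assumes "AE \<omega> in M. \<not> (\<exists>\<^sub>F n in sequentially. \<omega> \<in> E n)" and E: "\<And>n. E n \<in> events" and e: "e > 0"
  shows "\<not> (\<forall>n. e \<le> emeasure M (E n))"
proof
  assume ge: "\<forall>n. e \<le> emeasure M (E n)"
  define A where "A m = (\<Union>n\<in>{m..}. E n)" for m :: nat
  have A: "A m \<in> events" for m unfolding A_def using E by auto
  have "decseq A" unfolding decseq_def A_def by (intro allI impI UN_mono) auto
  then have "(\<lambda>m. emeasure M (A m)) \<longlonglongrightarrow> emeasure M (\<Inter>m. A m)"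
    using A by (intro Lim_emeasure_decseq) (auto simp: emeasure_eq_measure)
  moreover have "e \<le> emeasure M (A m)" for m
    using ge A by (intro order_trans[OF spec[OF ge, of m] emeasure_mono]) (auto simp: A_def)
  ultimately have "e \<le> emeasure M (\<Inter>m. A m)" by (intro LIMSEQ_le_const) auto
  moreover have "emeasure M (\<Inter>m. A m) = 0"
  proof -
    have "(\<Inter>m. A m) \<subseteq> space M" using sets.sets_into_space[OF A[of 0]] by auto
    then have "(\<Inter>m. A m) = {\<omega>\<in>space M. \<exists>\<^sub>F n in sequentially. \<omega> \<in> E n}"
      by (auto simp: A_def frequently_sequentially)
    then show ?thesis using emeasure_eq_0_AE[OF assms(1)] by simp
  qed
  ultimately show False using e by simp
qed

text \<open>Argument by contradiction: along a subsequence the probabilities stay above some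
  \<open>e\<close> and the starting points converge. Infinitely many of the events would then occur
  with positive probability, and on such a path the uniform limit, the process at \<delta> = 0,
  touches the sphere with \<open>r = 0\<close>. Constant \<delta> = 0 is allowed, so this covers
  both claims of the theorem.\<close>

lemma hitting_probability_tendsto_0:
  fixes U :: "real ^ 'd::finite \<Rightarrow> real" and Z :: "real \<Rightarrow> real \<Rightarrow> 'd state \<Rightarrow> real \<Rightarrow> 'w \<Rightarrow> 'd state"
  assumes pos: "\<gamma> > 0" "L > 0" "\<epsilon> > 0" and \<mu>: "prob_space \<mu>"
    and W: "independent_brownian_motions \<mu> W\<^sub>\<theta> W\<^sub>p W\<^sub>r" and U: "smooth U" and \<sigma>: "\<bar>\<sigma>\<bar> = 1"
    and Z: "\<And>\<delta> z. \<delta> \<in> {0..1} \<Longrightarrow> strong_solution \<gamma> L \<epsilon> U \<mu> W\<^sub>\<theta> W\<^sub>p W\<^sub>r \<delta> \<sigma> z (Z \<delta> \<sigma> z)"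
    and \<rho>: "\<rho> > 0" and K: "compact K" "K \<inter> sphere (c, 0, 0) \<rho> = {}"
    and \<delta>: "\<And>n. \<delta> n \<in> {0..1}" "\<delta> \<longlonglongrightarrow> 0" and b: "b \<longlonglongrightarrow> 0" and z: "\<And>n. z n \<in> K"
  shows "(\<lambda>n. emeasure \<mu> (hit_with_small_r \<mu> (Z (\<delta> n) \<sigma> (z n)) (sphere (c, 0, 0) \<rho>) (b n) M)) \<longlonglongrightarrow> 0"
proof (rule ccontr)
  interpret prob_space \<mu> by (rule \<mu>)
  let ?S = "sphere (c, 0, 0) \<rho> :: 'd state set"
  let ?E = "\<lambda>n. hit_with_small_r \<mu> (Z (\<delta> n) \<sigma> (z n)) ?S (b n) M"
  let ?\<kappa> = "sqrt (2 * \<gamma> * \<epsilon> / L)"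
  assume "\<not> (\<lambda>n. emeasure \<mu> (?E n)) \<longlonglongrightarrow> 0"
  then obtain e where e: "e > 0" "\<not> (\<forall>\<^sub>F n in sequentially. emeasure \<mu> (?E n) < e)"
    unfolding order_tendsto_iff by auto
  then have "infinite {n. e \<le> emeasure \<mu> (?E n)}"
    by (simp add: not_eventually not_less cofinite_eq_sequentially[symmetric] frequently_cofinite)
  from infinite_enumerate[OF this] obtain r\<^sub>1 :: "nat \<Rightarrow> nat" where r1: "strict_mono r\<^sub>1" "\<And>n. e \<le> emeasure \<mu> (?E (r\<^sub>1 n))"
    by blast
  have "seq_compact K" using K(1) by (rule compact_imp_seq_compact)
  from seq_compactE[OF this, of "z \<circ> r\<^sub>1"] z obtain z\<^sub>0 r\<^sub>2 where z0: "z\<^sub>0 \<in> K" and r2: "strict_mono r\<^sub>2" "((z \<circ> r\<^sub>1) \<circ> r\<^sub>2) \<longlonglongrightarrow> z\<^sub>0"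
    by (metis comp_apply)
  define r where "r = r\<^sub>1 \<circ> r\<^sub>2"
  have r: "strict_mono r" using r1(1) r2(1) by (simp add: r_def strict_mono_o)
  have lims: "(\<lambda>n. z (r n)) \<longlonglongrightarrow> z\<^sub>0" "(\<lambda>n. \<delta> (r n)) \<longlonglongrightarrow> 0" "(\<lambda>n. b (r n)) \<longlonglongrightarrow> 0"
    using r2(2) LIMSEQ_subseq_LIMSEQ[OF \<delta>(2) r] LIMSEQ_subseq_LIMSEQ[OF b r] by (simp_all add: r_def comp_def)
  have ge: "e \<le> emeasure \<mu> (?E (r n))" for n using r1(2) by (simp add: r_def)
  \<comment> \<open>A non-measurable set has \<open>emeasure\<close> zero, so measurability of the hitting events comes for free.\<close>
  have ev: "?E (r n) \<in> events" for n
  proof (rule ccontr)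
    assume "?E (r n) \<notin> events"
    then show False using ge[of n] e(1) by (simp add: emeasure_notin_sets)
  qed
  have BM: "brownian_motion \<mu> W\<^sub>\<theta>" "brownian_motion \<mu> W\<^sub>p" "brownian_motion \<mu> W\<^sub>r"
    using W by (auto simp: independent_brownian_motions_def)
  have cont: "continuous_on {0..} (\<lambda>t. Z d \<sigma> x t \<omega>)" if "d \<in> {0..1}" "\<omega> \<in> space \<mu>" for d x \<omega>
    using Z[OF that(1), of x] that(2) by (simp add: strong_solution_def)
  have sol: "AE \<omega> in \<mu>. solves_sde \<gamma> L \<epsilon> U W\<^sub>\<theta> W\<^sub>p W\<^sub>r d \<sigma> x (Z d \<sigma> x) \<omega>" if "d \<in> {0..1}" for d x
    using Z[OF that, of x] by (simp add: strong_solution_def solves_sde_def)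
  interpret Z: kinetic_solution \<mu> W\<^sub>r \<sigma> \<gamma> ?\<kappa> L U "Z 0 \<sigma> z\<^sub>0" z\<^sub>0
  proof
    show "?\<kappa> > 0" using pos by simp
    show "AE \<omega> in \<mu>. \<forall>t\<ge>0. ((\<lambda>s. kinetic_drift \<gamma> L \<sigma> (grad U) (Z 0 \<sigma> z\<^sub>0 s \<omega>)) has_integral
          (Z 0 \<sigma> z\<^sub>0 t \<omega> - z\<^sub>0 - (0, 0, ?\<kappa> *\<^sub>R W\<^sub>r t \<omega>))) {0..t}"
      using sol[of 0 z\<^sub>0] by (simp add: solves_sde_def drift_0 noise_def)
  qed (use BM \<sigma> pos U cont in auto)
  have "AE \<omega> in \<mu>. \<forall>n. solves_sde \<gamma> L \<epsilon> U W\<^sub>\<theta> W\<^sub>p W\<^sub>r (\<delta> (r n)) \<sigma> (z (r n)) (Z (\<delta> (r n)) \<sigma> (z (r n))) \<omega>"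
    unfolding AE_all_countable using sol \<delta>(1) by blast
  moreover have "AE \<omega> in \<mu>. solves_sde \<gamma> L \<epsilon> U W\<^sub>\<theta> W\<^sub>p W\<^sub>r 0 \<sigma> z\<^sub>0 (Z 0 \<sigma> z\<^sub>0) \<omega>" by (rule sol) simp
  moreover have "AE \<omega> in \<mu>. \<omega> \<in> space \<mu>" by simp
  moreover note Z.sphere_avoidance[OF \<rho>, of c]
  ultimately have "AE \<omega> in \<mu>. \<not> (\<exists>\<^sub>F n in sequentially. \<omega> \<in> ?E (r n))"
  proof eventually_elim
    case (elim \<omega>)
    show ?case
    proof
      assume freq: "\<exists>\<^sub>F n in sequentially. \<omega> \<in> ?E (r n)"
      have hit: "\<exists>t\<in>{0..M}. Z (\<delta> (r n)) \<sigma> (z (r n)) t \<omega> \<in> ?S \<and> norm (snd (snd (Z (\<delta> (r n)) \<sigma> (z (r n)) t \<omega>))) \<le> b (r n)"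
        if "\<omega> \<in> ?E (r n)" for n
      proof -
        have "continuous_on {0..} (\<lambda>t. Z (\<delta> (r n)) \<sigma> (z (r n)) t \<omega>)" by (rule cont[OF \<delta>(1) elim(3)])
        from hit_with_small_rD[OF that closed_sphere this] show ?thesis by (metis atLeastAtMost_iff)
      qed
      obtain n where "\<omega> \<in> ?E (r n)" using frequently_ex[OF freq] by blast
      from hit[OF this] have M: "M \<ge> 0" by auto
      have "uniform_limit {0..M} (\<lambda>n t. Z (\<delta> (r n)) \<sigma> (z (r n)) t \<omega>) (\<lambda>t. Z 0 \<sigma> z\<^sub>0 t \<omega>) sequentially"
        using elim(1) \<delta>(1) cont elim(3)
        by (intro sde_uniform_limit[OF pos U \<sigma> M brownian_motion_continuous[OF BM(1) elim(3)]
              brownian_motion_continuous[OF BM(2) elim(3)] elim(2) _ _ _ _ lims(2,1)]) auto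
      moreover have "continuous_on {0..M} (\<lambda>t. Z 0 \<sigma> z\<^sub>0 t \<omega>)"
        by (rule continuous_on_subset[OF cont[OF _ elim(3)]]) auto
      moreover have "\<exists>\<^sub>F n in sequentially. \<exists>t\<in>{0..M}. Z (\<delta> (r n)) \<sigma> (z (r n)) t \<omega> \<in> ?S
          \<and> norm (snd (snd (Z (\<delta> (r n)) \<sigma> (z (r n)) t \<omega>))) \<le> b (r n)"
        by (rule frequently_elim1[OF freq]) (rule hit)
      ultimately obtain t where t: "t \<in> {0..M}" "Z 0 \<sigma> z\<^sub>0 t \<omega> \<in> ?S" "snd (snd (Z 0 \<sigma> z\<^sub>0 t \<omega>)) = 0"
        using uniform_limit_hit[OF _ _ closed_sphere lims(3)] by blast
      have "Z 0 \<sigma> z\<^sub>0 0 \<omega> = z\<^sub>0"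
      proof -
        have "((\<lambda>s. drift \<gamma> L U 0 \<sigma> (Z 0 \<sigma> z\<^sub>0 s \<omega>)) has_integral
          (Z 0 \<sigma> z\<^sub>0 0 \<omega> - z\<^sub>0 - noise \<gamma> L \<epsilon> W\<^sub>\<theta> W\<^sub>p W\<^sub>r 0 0 \<omega>)) {0..0}"
          using elim(2) unfolding solves_sde_def by blast
        from integral_unique[OF this] show ?thesis
          using Z.W0[OF elim(3)] by (simp add: noise_def zero_prod_def[symmetric])
      qed
      \<comment> \<open>Avoidance is known for positive times only; time 0 is excluded because the
        limit of the starting points stays in \<open>K\<close>, off the sphere.\<close>
      then have "t \<noteq> 0" using t(2) z0 K(2) by auto
      then show False using elim(4) t by auto
    qed
  qed
  from emeasure_not_ge_if_AE_finitely_often[OF this ev e(1)] ge show False by blast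
qed

theorem proposition2p31:
  fixes \<gamma> L \<epsilon> \<rho> N M :: real
    and U :: "(real ^ 'd::finite) \<Rightarrow> real"
    and \<mu> :: "'w measure"
    and W\<^sub>\<theta> W\<^sub>p W\<^sub>r :: "real \<Rightarrow> 'w \<Rightarrow> real ^ 'd"
    and Z :: "real \<Rightarrow> real \<Rightarrow> 'd state \<Rightarrow> real \<Rightarrow> 'w \<Rightarrow> 'd state"
    and m s :: "real ^ 'd"
    and A B D \<Sigma> K :: "'d state set"
  assumes "\<gamma> > 0" and "L > 0" and "\<epsilon> > 0"
    and "prob_space \<mu>"
    and "independent_brownian_motions \<mu> W\<^sub>\<theta> W\<^sub>p W\<^sub>r"
    and "potential_assumption U"
    and "controlled_coefficients \<gamma> L \<epsilon> U \<mu> W\<^sub>\<theta> W\<^sub>p W\<^sub>r Z"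
    and "\<forall>\<^sub>F \<theta> in nhds m. U m \<le> U \<theta>"
    and "\<forall>\<^sub>F \<theta> in nhds s. U s \<le> U \<theta>"
    and "\<rho> > 0" and "N > 0"
    and "A = ball (m, 0, 0) \<rho>" and "B = ball (s, 0, 0) \<rho>" and "D = ball 0 N"
    and "closure A \<inter> closure B = {}"
    and "closure A \<union> closure B \<subseteq> D"
    and "\<Sigma> \<in> {frontier A, frontier B, frontier D}"
    and "compact K" and "K \<subseteq> closure D - \<Sigma>"
  shows "\<forall>\<sigma>\<in>{1, -1}.
    ((\<lambda>b. SUP z\<in>K. emeasure \<mu> (hit_with_small_r \<mu> (Z 0 \<sigma> z) \<Sigma> b M)) \<longlongrightarrow> 0) (at_right 0) \<and>
    (\<forall>l\<in>{0<..<1/2}. \<forall>K\<^sub>0>0.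
      ((\<lambda>\<delta>. SUP z\<in>K. emeasure \<mu> (hit_with_small_r \<mu> (Z \<delta> \<sigma> z) \<Sigma> (K\<^sub>0 * \<delta> powr (l / 4)) M))
         \<longlongrightarrow> 0) (at_right 0))"
proof -
  obtain c R where \<Sigma>: "\<Sigma> = sphere (c, 0, 0) R" and R: "R > 0"
  proof -
    have "frontier A = sphere (m, 0, 0) \<rho>" "frontier B = sphere (s, 0, 0) \<rho>" "frontier D = sphere (0, 0, 0) N"
      using assms(10-14) by (simp_all add: zero_prod_def)
    then show thesis using that assms(10,11,17) by blast
  qed
  have U: "smooth U" using assms(6) by (simp add: potential_assumption_def)
  have K: "K \<inter> sphere (c, 0, 0) R = {}" using assms(19) \<Sigma> by auto
  have hit: "(\<lambda>n. emeasure \<mu> (hit_with_small_r \<mu> (Z (\<delta> n) \<sigma> (z n)) \<Sigma> (b n) M)) \<longlonglongrightarrow> 0"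
    if \<sigma>: "\<sigma> \<in> {1, -1}" and "\<And>n. \<delta> n \<in> {0..1}" "\<delta> \<longlonglongrightarrow> 0" "b \<longlonglongrightarrow> 0" "\<And>n. z n \<in> K" for \<sigma> \<delta> b z
    unfolding \<Sigma>
  proof (rule hitting_probability_tendsto_0[OF assms(1-5) U _ _ R assms(18) K that(2-5)])
    show "\<bar>\<sigma>\<bar> = 1" using \<sigma> by auto
    show "strong_solution \<gamma> L \<epsilon> U \<mu> W\<^sub>\<theta> W\<^sub>p W\<^sub>r d \<sigma> x (Z d \<sigma> x)" if "d \<in> {0..1}" for d x
      using assms(7) that \<sigma> unfolding controlled_coefficients_def by blast
  qed
  show ?thesis
  proof (intro ballI conjI allI impI SUP_tendsto_at_right_0)
    fix \<sigma> :: real and x :: "nat \<Rightarrow> real" and z :: "nat \<Rightarrow> 'd state"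
    assume \<sigma>: "\<sigma> \<in> {1, -1}" and x: "\<And>n. x n > 0" "x \<longlonglongrightarrow> 0" and z: "\<And>n. z n \<in> K"
    show "(\<lambda>n. emeasure \<mu> (hit_with_small_r \<mu> (Z 0 \<sigma> (z n)) \<Sigma> (x n) M)) \<longlonglongrightarrow> 0"
      by (rule hit[OF \<sigma> _ _ x(2) z]) auto
  next
    fix \<sigma> l K\<^sub>0 :: real and x :: "nat \<Rightarrow> real" and z :: "nat \<Rightarrow> 'd state"
    assume \<sigma>: "\<sigma> \<in> {1, -1}" and l: "l \<in> {0<..<1/2}" and x: "\<And>n. x n > 0" "x \<longlonglongrightarrow> 0" and z: "\<And>n. z n \<in> K"
    \<comment> \<open>The equations are assumed for \<delta> up to 1 only; the cut-off is inactive
      for all but finitely many \<open>n\<close>.\<close>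
    let ?\<delta> = "\<lambda>n. min 1 (x n)"
    have "?\<delta> \<longlonglongrightarrow> min 1 0" by (intro tendsto_intros x)
    moreover have "(\<lambda>n. x n powr (l / 4)) \<longlonglongrightarrow> 0"
      using x l by (intro tendsto_zero_powrI[where b = "l / 4"]) (auto simp: less_imp_le)
    then have "(\<lambda>n. K\<^sub>0 * x n powr (l / 4)) \<longlonglongrightarrow> 0" by (rule tendsto_mult_right_zero)
    ultimately have "(\<lambda>n. emeasure \<mu> (hit_with_small_r \<mu> (Z (?\<delta> n) \<sigma> (z n)) \<Sigma> (K\<^sub>0 * x n powr (l / 4)) M)) \<longlonglongrightarrow> 0"
      using x(1) by (intro hit[OF \<sigma> _ _ _ z]) (auto simp: less_imp_le)
    moreover have "\<forall>\<^sub>F n in sequentially. x n < 1" using x(2) by (rule order_tendstoD) simp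
    then have "\<forall>\<^sub>F n in sequentially. emeasure \<mu> (hit_with_small_r \<mu> (Z (?\<delta> n) \<sigma> (z n)) \<Sigma> (K\<^sub>0 * x n powr (l / 4)) M)
        = emeasure \<mu> (hit_with_small_r \<mu> (Z (x n) \<sigma> (z n)) \<Sigma> (K\<^sub>0 * x n powr (l / 4)) M)"
      by eventually_elim (simp add: min_def)
    ultimately show "(\<lambda>n. emeasure \<mu> (hit_with_small_r \<mu> (Z (x n) \<sigma> (z n)) \<Sigma> (K\<^sub>0 * x n powr (l / 4)) M)) \<longlonglongrightarrow> 0"
      by (rule Lim_transform_eventually)
  qed
qed

end
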